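(* Let $X$ be a reduced curve over an algebraically closed field $k$ having only nodal singularities and let $\mathcal{A}$ be its Auslander sheaf. Then the essential image of the functor $\mathbb{F}=\mathcal{F}\otimes_{\mathcal{O}}-:\mathrm{Coh}(X)\to\mathrm{Coh}(\mathcal{A})$ is closed under extensions in $\mathrm{Coh}(\mathcal{A})$.
   Context: A singular point $x$ is a node if $\widehat{\mathcal{O}}_x\cong k[[u,v]]/(uv)$. $\mathcal{O}=\mathcal{O}_X$, $\mathcal{I}$ is the ideal sheaf of the singular locus of $X$ (reduced scheme structure), $\mathcal{F}=\mathcal{I}\oplus\mathcal{O}$, and the Auslander sheaf is the sheaf of $\mathcal{O}$-algebras $\mathcal{A}=\mathcal{E}nd_X(\mathcal{F})$. $\mathrm{Coh}(\mathcal{A})$ is the category of coherent left $\mathcal{A}$-modules; $\mathcal{F}$ is naturally a left $\mathcal{A}$-module. Closed under extensions means: if $0\to\mathcal{M}'\to\mathcal{M}\to\mathcal{M}''\to0$ is exact in $\mathrm{Coh}(\mathcal{A})$ with $\mathcal{M}',\mathcal{M}''$ in the essential image, then $\mathcal{M}$ is in the essential image. *)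

theory Defs
  imports "HOL-Analysis.Abstract_Topology" "HOL-Algebra.Algebra" "HOL-Library.Extended_Nat"
begin

no_notation var (\<open>X\<index>\<close>)

section \<open>Rings and left modules\<close>

text \<open>For commutative \<open>R\<close> this is \<^locale>\<open>module\<close>; endomorphism rings need the noncommutative version.\<close>

locale left_module = R?: ring R + M?: abelian_group M
  for R :: "('a, 'y) ring_scheme" (structure) and M :: "('a, 'm, 'z) module_scheme" (structure) +
  assumes smult_closed:
      "\<lbrakk>a \<in> carrier R; x \<in> carrier M\<rbrakk> \<Longrightarrow> a \<odot>\<^bsub>M\<^esub> x \<in> carrier M"
    and smult_l_distr:
      "\<lbrakk>a \<in> carrier R; b \<in> carrier R; x \<in> carrier M\<rbrakk> \<Longrightarrow>
        (a \<oplus>\<^bsub>R\<^esub> b) \<odot>\<^bsub>M\<^esub> x = a \<odot>\<^bsub>M\<^esub> x \<oplus>\<^bsub>M\<^esub> b \<odot>\<^bsub>M\<^esub> x"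
    and smult_r_distr:
      "\<lbrakk>a \<in> carrier R; x \<in> carrier M; y \<in> carrier M\<rbrakk> \<Longrightarrow>
        a \<odot>\<^bsub>M\<^esub> (x \<oplus>\<^bsub>M\<^esub> y) = a \<odot>\<^bsub>M\<^esub> x \<oplus>\<^bsub>M\<^esub> a \<odot>\<^bsub>M\<^esub> y"
    and smult_assoc:
      "\<lbrakk>a \<in> carrier R; b \<in> carrier R; x \<in> carrier M\<rbrakk> \<Longrightarrow>
        (a \<otimes>\<^bsub>R\<^esub> b) \<odot>\<^bsub>M\<^esub> x = a \<odot>\<^bsub>M\<^esub> (b \<odot>\<^bsub>M\<^esub> x)"
    and smult_one: "x \<in> carrier M \<Longrightarrow> \<one>\<^bsub>R\<^esub> \<odot>\<^bsub>M\<^esub> x = x"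

definition local_ring :: "('r, 'z) ring_scheme \<Rightarrow> bool" where
  "local_ring R \<longleftrightarrow> cring R \<and> (\<exists>!m. maximalideal m R)"

definition max_ideal :: "('r, 'z) ring_scheme \<Rightarrow> 'r set" where
  "max_ideal R = (THE m. maximalideal m R)"

text \<open>Supremum of the lengths \<open>n\<close> of chains \<open>c 0 \<subset> \<dots> \<subset> c n\<close> in a family of sets.\<close>

definition chain_dim :: "'x set set \<Rightarrow> enat" where
  "chain_dim P = Sup {enat n | n. \<exists>c. (\<forall>i\<le>n. c i \<in> P) \<and> (\<forall>i<n. c i \<subset> c (Suc i))}"

definition krull_dim :: "('r, 'z) ring_scheme \<Rightarrow> enat" where
  "krull_dim R = chain_dim {p. primeideal p R}"

definition regular_local_ring :: "('r, 'z) ring_scheme \<Rightarrow> bool" where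
  "regular_local_ring R \<longleftrightarrow> local_ring R \<and> noetherian_ring R \<and>
     (\<exists>S. finite S \<and> S \<subseteq> carrier R \<and> max_ideal R = Idl\<^bsub>R\<^esub> S \<and> enat (card S) = krull_dim R)"

primrec ideal_power :: "('r, 'z) ring_scheme \<Rightarrow> 'r set \<Rightarrow> nat \<Rightarrow> 'r set" where
  "ideal_power R I 0 = carrier R"
| "ideal_power R I (Suc n) = ideal_prod R (ideal_power R I n) I"

text \<open>The inverse limit of the rings \<open>R / I ^ n\<close>.  Elements of the quotients are cosets, and a coset
  of \<open>I ^ (n + 1)\<close> maps to a coset of \<open>I ^ n\<close> iff it is contained in it.\<close>

definition completion :: "('r, 'z) ring_scheme \<Rightarrow> 'r set \<Rightarrow> (nat \<Rightarrow> 'r set) ring" where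
  "completion R I =
    \<lparr>carrier = {f. \<forall>n. f n \<in> carrier (R Quot (ideal_power R I n)) \<and> f (Suc n) \<subseteq> f n},
     monoid.mult = (\<lambda>f g n. f n \<otimes>\<^bsub>R Quot (ideal_power R I n)\<^esub> g n),
     monoid.one = (\<lambda>n. \<one>\<^bsub>R Quot (ideal_power R I n)\<^esub>),
     ring.zero = (\<lambda>n. \<zero>\<^bsub>R Quot (ideal_power R I n)\<^esub>),
     ring.add = (\<lambda>f g n. f n \<oplus>\<^bsub>R Quot (ideal_power R I n)\<^esub> g n)\<rparr>"

definition to_completion :: "('r, 'z) ring_scheme \<Rightarrow> 'r set \<Rightarrow> 'r \<Rightarrow> nat \<Rightarrow> 'r set" where
  "to_completion R I r = (\<lambda>n. ideal_power R I n +>\<^bsub>R\<^esub> r)"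

text \<open>\<open>K[[u,v]]\<close>; \<open>f i j\<close> is the coefficient of \<open>u^i v^j\<close>.\<close>

definition power_series2 :: "('k, 'z) ring_scheme \<Rightarrow> (nat \<Rightarrow> nat \<Rightarrow> 'k) ring" where
  "power_series2 K =
    \<lparr>carrier = {f. \<forall>i j. f i j \<in> carrier K},
     monoid.mult = (\<lambda>f g i j. finsum K (\<lambda>(a, b). f a b \<otimes>\<^bsub>K\<^esub> g (i - a) (j - b)) ({..i} \<times> {..j})),
     monoid.one = (\<lambda>i j. if i = 0 \<and> j = 0 then \<one>\<^bsub>K\<^esub> else \<zero>\<^bsub>K\<^esub>),
     ring.zero = (\<lambda>i j. \<zero>\<^bsub>K\<^esub>),
     ring.add = (\<lambda>f g i j. f i j \<oplus>\<^bsub>K\<^esub> g i j)\<rparr>"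

definition const2 :: "('k, 'z) ring_scheme \<Rightarrow> 'k \<Rightarrow> nat \<Rightarrow> nat \<Rightarrow> 'k" where
  "const2 K c = (\<lambda>i j. if i = 0 \<and> j = 0 then c else \<zero>\<^bsub>K\<^esub>)"

definition var_u :: "('k, 'z) ring_scheme \<Rightarrow> nat \<Rightarrow> nat \<Rightarrow> 'k" where
  "var_u K = (\<lambda>i j. if i = 1 \<and> j = 0 then \<one>\<^bsub>K\<^esub> else \<zero>\<^bsub>K\<^esub>)"

definition var_v :: "('k, 'z) ring_scheme \<Rightarrow> nat \<Rightarrow> nat \<Rightarrow> 'k" where
  "var_v K = (\<lambda>i j. if i = 0 \<and> j = 1 then \<one>\<^bsub>K\<^esub> else \<zero>\<^bsub>K\<^esub>)"

definition node_ideal :: "('k, 'z) ring_scheme \<Rightarrow> (nat \<Rightarrow> nat \<Rightarrow> 'k) set" where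
  "node_ideal K = PIdl\<^bsub>power_series2 K\<^esub> (var_u K \<otimes>\<^bsub>power_series2 K\<^esub> var_v K)"

definition node_ring :: "('k, 'z) ring_scheme \<Rightarrow> (nat \<Rightarrow> nat \<Rightarrow> 'k) set ring" where
  "node_ring K = power_series2 K Quot node_ideal K"

section \<open>Sheaves\<close>

text \<open>\<open>Sec F U\<close> is the ring or module of sections over \<open>U\<close>, and \<open>Res F U V\<close> is the restriction map
  from \<open>U\<close> to \<open>V\<close>; only open sets \<open>V \<subseteq> U\<close> matter.\<close>

record ('a, 'x, 's) presheaf =
  Sec :: "'a set \<Rightarrow> 's"
  Res :: "'a set \<Rightarrow> 'a set \<Rightarrow> 'x \<Rightarrow> 'x"

type_synonym ('a, 'r) ring_presheaf = "('a, 'r, 'r ring) presheaf"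
type_synonym ('a, 'b, 'm) mod_presheaf = "('a, 'm, ('b, 'm) module) presheaf"

definition is_presheaf :: "'a topology \<Rightarrow> ('a, 'x, ('x, 'z) partial_object_scheme) presheaf \<Rightarrow> bool" where
  "is_presheaf T F \<longleftrightarrow>
     (\<forall>U V. openin T U \<and> openin T V \<and> V \<subseteq> U \<longrightarrow> Res F U V \<in> carrier (Sec F U) \<rightarrow> carrier (Sec F V)) \<and>
     (\<forall>U. openin T U \<longrightarrow> (\<forall>s\<in>carrier (Sec F U). Res F U U s = s)) \<and>
     (\<forall>U V W. openin T U \<and> openin T V \<and> openin T W \<and> W \<subseteq> V \<and> V \<subseteq> U \<longrightarrow>
        (\<forall>s\<in>carrier (Sec F U). Res F V W (Res F U V s) = Res F U W s))"

definition is_sheaf :: "'a topology \<Rightarrow> ('a, 'x, ('x, 'z) partial_object_scheme) presheaf \<Rightarrow> bool" where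
  "is_sheaf T F \<longleftrightarrow> is_presheaf T F \<and>
     (\<forall>\<U> s. (\<forall>U\<in>\<U>. openin T U \<and> s U \<in> carrier (Sec F U)) \<and>
        (\<forall>U\<in>\<U>. \<forall>V\<in>\<U>. Res F U (U \<inter> V) (s U) = Res F V (U \<inter> V) (s V)) \<longrightarrow>
        (\<exists>!t. t \<in> carrier (Sec F (\<Union>\<U>)) \<and> (\<forall>U\<in>\<U>. Res F (\<Union>\<U>) U t = s U)))"

definition sheaf_of_rings :: "'a topology \<Rightarrow> ('a, 'r) ring_presheaf \<Rightarrow> bool" where
  "sheaf_of_rings T A \<longleftrightarrow> is_sheaf T A \<and>
     (\<forall>U. openin T U \<longrightarrow> ring (Sec A U)) \<and>
     (\<forall>U V. openin T U \<and> openin T V \<and> V \<subseteq> U \<longrightarrow> Res A U V \<in> ring_hom (Sec A U) (Sec A V))"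

definition sheaf_of_left_modules ::
    "'a topology \<Rightarrow> ('a, 'b) ring_presheaf \<Rightarrow> ('a, 'b, 'm) mod_presheaf \<Rightarrow> bool" where
  "sheaf_of_left_modules T A M \<longleftrightarrow> is_sheaf T M \<and>
     (\<forall>U. openin T U \<longrightarrow> left_module (Sec A U) (Sec M U)) \<and>
     (\<forall>U V. openin T U \<and> openin T V \<and> V \<subseteq> U \<longrightarrow>
        (\<forall>x\<in>carrier (Sec M U). \<forall>y\<in>carrier (Sec M U).
           Res M U V (x \<oplus>\<^bsub>Sec M U\<^esub> y) = Res M U V x \<oplus>\<^bsub>Sec M V\<^esub> Res M U V y) \<and>
        (\<forall>a\<in>carrier (Sec A U). \<forall>x\<in>carrier (Sec M U).
           Res M U V (a \<odot>\<^bsub>Sec M U\<^esub> x) = Res A U V a \<odot>\<^bsub>Sec M V\<^esub> Res M U V x))"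

subsection \<open>Germs, stalks, sheafification\<close>

text \<open>The equivalence class of \<open>(U, s)\<close> in the colimit over the open neighbourhoods of \<open>x\<close>.\<close>

definition germ ::
    "'a topology \<Rightarrow> ('a, 'x, ('x, 'z) partial_object_scheme) presheaf \<Rightarrow> 'a \<Rightarrow> 'a set \<Rightarrow> 'x \<Rightarrow> ('a set \<times> 'x) set"
  where
  "germ T F x U s = {(V, t). openin T V \<and> x \<in> V \<and> t \<in> carrier (Sec F V) \<and>
     (\<exists>W. openin T W \<and> x \<in> W \<and> W \<subseteq> U \<inter> V \<and> Res F U W s = Res F V W t)}"

definition germs ::
    "'a topology \<Rightarrow> ('a, 'x, ('x, 'z) partial_object_scheme) presheaf \<Rightarrow> 'a \<Rightarrow> ('a set \<times> 'x) set set" where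
  "germs T F x = {germ T F x U s | U s. openin T U \<and> x \<in> U \<and> s \<in> carrier (Sec F U)}"

text \<open>Operations on classes are given by the union over all representatives, as in
  \<^const>\<open>FactRing\<close>; the classes united all coincide.\<close>

definition stalk :: "'a topology \<Rightarrow> ('a, 'r) ring_presheaf \<Rightarrow> 'a \<Rightarrow> ('a set \<times> 'r) set ring" where
  "stalk T A x =
    \<lparr>carrier = germs T A x,
     monoid.mult = (\<lambda>g h. \<Union>{germ T A x U (s \<otimes>\<^bsub>Sec A U\<^esub> t) | U s t. (U, s) \<in> g \<and> (U, t) \<in> h}),
     monoid.one = germ T A x (topspace T) \<one>\<^bsub>Sec A (topspace T)\<^esub>,
     ring.zero = germ T A x (topspace T) \<zero>\<^bsub>Sec A (topspace T)\<^esub>,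
     ring.add = (\<lambda>g h. \<Union>{germ T A x U (s \<oplus>\<^bsub>Sec A U\<^esub> t) | U s t. (U, s) \<in> g \<and> (U, t) \<in> h})\<rparr>"

definition sheafify ::
    "'a topology \<Rightarrow> ('a, 'b) ring_presheaf \<Rightarrow> ('a, 'b, 'm) mod_presheaf \<Rightarrow>
     ('a, 'b, 'a \<Rightarrow> ('a set \<times> 'm) set) mod_presheaf" where
  "sheafify T A P =
    \<lparr>Sec = (\<lambda>U.
       \<lparr>carrier = {s \<in> (\<Pi>\<^sub>E x\<in>U. germs T P x).
                    \<forall>x\<in>U. \<exists>V t. openin T V \<and> x \<in> V \<and> V \<subseteq> U \<and> t \<in> carrier (Sec P V) \<and>
                      (\<forall>y\<in>V. s y = germ T P y V t)},
        monoid.mult = undefined, monoid.one = undefined,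
        ring.zero = (\<lambda>x\<in>U. germ T P x U \<zero>\<^bsub>Sec P U\<^esub>),
        ring.add = (\<lambda>s s'. \<lambda>x\<in>U.
           \<Union>{germ T P x V (t \<oplus>\<^bsub>Sec P V\<^esub> t') | V t t'. (V, t) \<in> s x \<and> (V, t') \<in> s' x}),
        smult = (\<lambda>a s. \<lambda>x\<in>U.
           \<Union>{germ T P x V (Res A U V a \<odot>\<^bsub>Sec P V\<^esub> t) | V t. V \<subseteq> U \<and> (V, t) \<in> s x})\<rparr>),
     Res = (\<lambda>U V s. restrict s V)\<rparr>"

subsection \<open>Morphisms\<close>

definition sheaf_hom ::
    "'a topology \<Rightarrow> ('a, 'b) ring_presheaf \<Rightarrow> ('a, 'b, 'm) mod_presheaf \<Rightarrow> ('a, 'b, 'n) mod_presheaf \<Rightarrow>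
     ('a set \<Rightarrow> 'm \<Rightarrow> 'n) \<Rightarrow> bool" where
  "sheaf_hom T A M N h \<longleftrightarrow>
     (\<forall>U. openin T U \<longrightarrow>
        h U \<in> carrier (Sec M U) \<rightarrow> carrier (Sec N U) \<and>
        (\<forall>x\<in>carrier (Sec M U). \<forall>y\<in>carrier (Sec M U).
           h U (x \<oplus>\<^bsub>Sec M U\<^esub> y) = h U x \<oplus>\<^bsub>Sec N U\<^esub> h U y) \<and>
        (\<forall>a\<in>carrier (Sec A U). \<forall>x\<in>carrier (Sec M U).
           h U (a \<odot>\<^bsub>Sec M U\<^esub> x) = a \<odot>\<^bsub>Sec N U\<^esub> h U x)) \<and>
     (\<forall>U V. openin T U \<and> openin T V \<and> V \<subseteq> U \<longrightarrow>
        (\<forall>x\<in>carrier (Sec M U). Res N U V (h U x) = h V (Res M U V x)))"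

definition sheaf_isomorphic ::
    "'a topology \<Rightarrow> ('a, 'b) ring_presheaf \<Rightarrow> ('a, 'b, 'm) mod_presheaf \<Rightarrow> ('a, 'b, 'n) mod_presheaf \<Rightarrow> bool" where
  "sheaf_isomorphic T A M N \<longleftrightarrow>
     (\<exists>h. sheaf_hom T A M N h \<and>
        (\<forall>U. openin T U \<longrightarrow> bij_betw (h U) (carrier (Sec M U)) (carrier (Sec N U))))"

definition locally_in_image ::
    "'a topology \<Rightarrow> ('a, 'b, 'm) mod_presheaf \<Rightarrow> ('a, 'b, 'n) mod_presheaf \<Rightarrow> ('a set \<Rightarrow> 'm \<Rightarrow> 'n) \<Rightarrow>
     'a set \<Rightarrow> 'n \<Rightarrow> bool" where
  "locally_in_image T M N h U y \<longleftrightarrow>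
     (\<forall>x\<in>U. \<exists>V. openin T V \<and> x \<in> V \<and> V \<subseteq> U \<and> Res N U V y \<in> h V ` carrier (Sec M V))"

definition short_exact ::
    "'a topology \<Rightarrow> ('a, 'b) ring_presheaf \<Rightarrow>
     ('a, 'b, 'l) mod_presheaf \<Rightarrow> ('a, 'b, 'm) mod_presheaf \<Rightarrow> ('a, 'b, 'n) mod_presheaf \<Rightarrow>
     ('a set \<Rightarrow> 'l \<Rightarrow> 'm) \<Rightarrow> ('a set \<Rightarrow> 'm \<Rightarrow> 'n) \<Rightarrow> bool" where
  "short_exact T A L M N f g \<longleftrightarrow> sheaf_hom T A L M f \<and> sheaf_hom T A M N g \<and>
     (\<forall>U. openin T U \<longrightarrow>
        (\<forall>x\<in>carrier (Sec L U). f U x = \<zero>\<^bsub>Sec M U\<^esub> \<longrightarrow> x = \<zero>\<^bsub>Sec L U\<^esub>) \<and>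
        (\<forall>y\<in>carrier (Sec M U). g U y = \<zero>\<^bsub>Sec N U\<^esub> \<longleftrightarrow> locally_in_image T L M f U y) \<and>
        (\<forall>z\<in>carrier (Sec N U). locally_in_image T M N g U z))"

section \<open>Schemes\<close>

record ('a, 'r) ringed_space =
  Space :: "'a topology"
  Struct :: "('a, 'r) ring_presheaf"

abbreviation pts :: "('a, 'r) ringed_space \<Rightarrow> 'a set" where
  "pts X \<equiv> topspace (Space X)"

abbreviation Opn :: "('a, 'r) ringed_space \<Rightarrow> 'a set \<Rightarrow> bool" where
  "Opn X \<equiv> openin (Space X)"

abbreviation Loc :: "('a, 'r) ringed_space \<Rightarrow> 'a \<Rightarrow> ('a set \<times> 'r) set ring" where
  "Loc X \<equiv> stalk (Space X) (Struct X)"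

definition locally_ringed_space :: "('a, 'r) ringed_space \<Rightarrow> bool" where
  "locally_ringed_space X \<longleftrightarrow> sheaf_of_rings (Space X) (Struct X) \<and>
     (\<forall>U. Opn X U \<longrightarrow> cring (Sec (Struct X) U)) \<and>
     (\<forall>x\<in>pts X. local_ring (Loc X x))"

definition open_subspace :: "('a, 'r) ringed_space \<Rightarrow> 'a set \<Rightarrow> ('a, 'r) ringed_space" where
  "open_subspace X U = X\<lparr>Space := subtopology (Space X) U\<rparr>"

definition isomorphic_ringed_spaces :: "('a, 'r) ringed_space \<Rightarrow> ('b, 's) ringed_space \<Rightarrow> bool" where
  "isomorphic_ringed_spaces X Y \<longleftrightarrow>
     (\<exists>f h. homeomorphic_map (Space X) (Space Y) f \<and>
       (\<forall>V. Opn Y V \<longrightarrow> h V \<in> ring_iso (Sec (Struct Y) V) (Sec (Struct X) {x \<in> pts X. f x \<in> V})) \<and>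
       (\<forall>V W. Opn Y V \<and> Opn Y W \<and> W \<subseteq> V \<longrightarrow>
          (\<forall>s\<in>carrier (Sec (Struct Y) V).
             Res (Struct X) {x \<in> pts X. f x \<in> V} {x \<in> pts X. f x \<in> W} (h V s) =
             h W (Res (Struct Y) V W s))))"

text \<open>The fraction \<open>a / s\<close> in the localization at the prime ideal \<open>p\<close>, as an equivalence class of pairs.\<close>

definition frac :: "'r ring \<Rightarrow> 'r set \<Rightarrow> 'r \<Rightarrow> 'r \<Rightarrow> ('r \<times> 'r) set" where
  "frac R p a s = {(b, t). b \<in> carrier R \<and> t \<in> carrier R - p \<and>
     (\<exists>u\<in>carrier R - p. u \<otimes>\<^bsub>R\<^esub> (a \<otimes>\<^bsub>R\<^esub> t) = u \<otimes>\<^bsub>R\<^esub> (b \<otimes>\<^bsub>R\<^esub> s))}"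

definition localization :: "'r ring \<Rightarrow> 'r set \<Rightarrow> ('r \<times> 'r) set ring" where
  "localization R p =
    \<lparr>carrier = {frac R p a s | a s. a \<in> carrier R \<and> s \<in> carrier R - p},
     monoid.mult = (\<lambda>g h. \<Union>{frac R p (a \<otimes>\<^bsub>R\<^esub> b) (s \<otimes>\<^bsub>R\<^esub> t) | a s b t. (a, s) \<in> g \<and> (b, t) \<in> h}),
     monoid.one = frac R p \<one>\<^bsub>R\<^esub> \<one>\<^bsub>R\<^esub>,
     ring.zero = frac R p \<zero>\<^bsub>R\<^esub> \<one>\<^bsub>R\<^esub>,
     ring.add = (\<lambda>g h. \<Union>{frac R p (a \<otimes>\<^bsub>R\<^esub> t \<oplus>\<^bsub>R\<^esub> b \<otimes>\<^bsub>R\<^esub> s) (s \<otimes>\<^bsub>R\<^esub> t) | a s b t.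
                        (a, s) \<in> g \<and> (b, t) \<in> h})\<rparr>"

definition Spec_top :: "'r ring \<Rightarrow> 'r set topology" where
  "Spec_top R = topology_generated_by {{p. primeideal p R \<and> f \<notin> p} | f. f \<in> carrier R}"

definition Spec :: "'r ring \<Rightarrow> ('r set, 'r set \<Rightarrow> ('r \<times> 'r) set) ringed_space" where
  "Spec R =
    \<lparr>Space = Spec_top R,
     Struct = \<lparr>Sec = (\<lambda>U.
       \<lparr>carrier = {s \<in> (\<Pi>\<^sub>E p\<in>U. carrier (localization R p)).
                    \<forall>p\<in>U. \<exists>V a f. openin (Spec_top R) V \<and> p \<in> V \<and> V \<subseteq> U \<and>
                      a \<in> carrier R \<and> f \<in> carrier R \<and> (\<forall>q\<in>V. f \<notin> q \<and> s q = frac R q a f)},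
        monoid.mult = (\<lambda>s t. \<lambda>p\<in>U. s p \<otimes>\<^bsub>localization R p\<^esub> t p),
        monoid.one = (\<lambda>p\<in>U. \<one>\<^bsub>localization R p\<^esub>),
        ring.zero = (\<lambda>p\<in>U. \<zero>\<^bsub>localization R p\<^esub>),
        ring.add = (\<lambda>s t. \<lambda>p\<in>U. s p \<oplus>\<^bsub>localization R p\<^esub> t p)\<rparr>),
       Res = (\<lambda>U V s. restrict s V)\<rparr>\<rparr>"

text \<open>If \<open>U\<close> is isomorphic to \<open>Spec R\<close>, then \<open>R\<close> is isomorphic to the ring of sections over \<open>U\<close>, so
  it is no restriction to look for \<open>R\<close> on the type of sections.\<close>

definition affine_open :: "('a, 'r) ringed_space \<Rightarrow> 'a set \<Rightarrow> bool" where
  "affine_open X U \<longleftrightarrow> Opn X U \<and>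
     (\<exists>R::'r ring. cring R \<and> isomorphic_ringed_spaces (open_subspace X U) (Spec R))"

definition scheme :: "('a, 'r) ringed_space \<Rightarrow> bool" where
  "scheme X \<longleftrightarrow> locally_ringed_space X \<and> (\<forall>x\<in>pts X. \<exists>U. x \<in> U \<and> affine_open X U)"

definition reduced :: "('a, 'r) ringed_space \<Rightarrow> bool" where
  "reduced X \<longleftrightarrow> (\<forall>U s (n::nat). Opn X U \<and> s \<in> carrier (Sec (Struct X) U) \<and>
     s [^]\<^bsub>Sec (Struct X) U\<^esub> n = \<zero>\<^bsub>Sec (Struct X) U\<^esub> \<longrightarrow> s = \<zero>\<^bsub>Sec (Struct X) U\<^esub>)"

text \<open>A morphism from \<open>X\<close> to the spectrum of \<open>K\<close> amounts to a ring homomorphism \<open>\<sigma>\<close> from \<open>K\<close> to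
  the global sections.\<close>

definition scheme_over :: "'k ring \<Rightarrow> ('a, 'r) ringed_space \<Rightarrow> ('k \<Rightarrow> 'r) \<Rightarrow> bool" where
  "scheme_over K X \<sigma> \<longleftrightarrow> scheme X \<and> \<sigma> \<in> ring_hom K (Sec (Struct X) (pts X))"

definition finite_type_over :: "'k ring \<Rightarrow> ('a, 'r) ringed_space \<Rightarrow> ('k \<Rightarrow> 'r) \<Rightarrow> bool" where
  "finite_type_over K X \<sigma> \<longleftrightarrow>
     (\<exists>\<U>. finite \<U> \<and> \<Union>\<U> = pts X \<and>
       (\<forall>U\<in>\<U>. affine_open X U \<and>
         (\<exists>S. finite S \<and> S \<subseteq> carrier (Sec (Struct X) U) \<and>
            generate_ring (Sec (Struct X) U) ((\<lambda>c. Res (Struct X) (pts X) U (\<sigma> c)) ` carrier K \<union> S) =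
            carrier (Sec (Struct X) U))))"

text \<open>The products \<open>U \<times> V\<close> of affine opens cover \<open>X \<times> X\<close> (over an affine base), and the
  preimage of \<open>U \<times> V\<close> under the diagonal is \<open>U \<inter> V\<close>.  Hence the diagonal is a closed immersion iff
  \<open>U \<inter> V\<close> is always affine and its ring is a quotient of the tensor product of those of \<open>U\<close> and \<open>V\<close>.\<close>

definition separated :: "('a, 'r) ringed_space \<Rightarrow> bool" where
  "separated X \<longleftrightarrow>
     (\<forall>U V. affine_open X U \<and> affine_open X V \<longrightarrow> affine_open X (U \<inter> V) \<and>
        generate_ring (Sec (Struct X) (U \<inter> V))
          (Res (Struct X) U (U \<inter> V) ` carrier (Sec (Struct X) U) \<union>
           Res (Struct X) V (U \<inter> V) ` carrier (Sec (Struct X) V)) =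
        carrier (Sec (Struct X) (U \<inter> V)))"

definition irreducible_closed :: "'a topology \<Rightarrow> 'a set \<Rightarrow> bool" where
  "irreducible_closed T Z \<longleftrightarrow> closedin T Z \<and> Z \<noteq> {} \<and>
     (\<forall>A B. closedin T A \<and> closedin T B \<and> Z \<subseteq> A \<union> B \<longrightarrow> Z \<subseteq> A \<or> Z \<subseteq> B)"

definition irreducible_component :: "'a topology \<Rightarrow> 'a set \<Rightarrow> bool" where
  "irreducible_component T Z \<longleftrightarrow> irreducible_closed T Z \<and>
     (\<forall>Y. irreducible_closed T Y \<and> Z \<subseteq> Y \<longrightarrow> Y = Z)"

definition reduced_curve :: "'k ring \<Rightarrow> ('a, 'r) ringed_space \<Rightarrow> ('k \<Rightarrow> 'r) \<Rightarrow> bool" where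
  "reduced_curve K X \<sigma> \<longleftrightarrow>
     scheme_over K X \<sigma> \<and> finite_type_over K X \<sigma> \<and> separated X \<and> reduced X \<and>
     (\<forall>Z. irreducible_component (Space X) Z \<longrightarrow>
        chain_dim {Y. irreducible_closed (Space X) Y \<and> Y \<subseteq> Z} = 1)"

definition singular_points :: "('a, 'r) ringed_space \<Rightarrow> 'a set" where
  "singular_points X = {x \<in> pts X. \<not> regular_local_ring (Loc X x)}"

text \<open>The isomorphism is one of \<open>K\<close>-algebras.\<close>

definition node :: "'k ring \<Rightarrow> ('a, 'r) ringed_space \<Rightarrow> ('k \<Rightarrow> 'r) \<Rightarrow> 'a \<Rightarrow> bool" where
  "node K X \<sigma> x \<longleftrightarrow> x \<in> singular_points X \<and>
     (\<exists>h \<in> ring_iso (completion (Loc X x) (max_ideal (Loc X x))) (node_ring K).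
        \<forall>c\<in>carrier K.
          h (to_completion (Loc X x) (max_ideal (Loc X x)) (germ (Space X) (Struct X) x (pts X) (\<sigma> c))) =
          node_ideal K +>\<^bsub>power_series2 K\<^esub> const2 K c)"

section \<open>Coherent sheaves\<close>

definition generated_by ::
    "'a topology \<Rightarrow> ('a, 'b) ring_presheaf \<Rightarrow> ('a, 'b, 'm) mod_presheaf \<Rightarrow> 'a set \<Rightarrow> nat \<Rightarrow> (nat \<Rightarrow> 'm) \<Rightarrow> bool"
  where
  "generated_by T R M U n s \<longleftrightarrow> (\<forall>i<n. s i \<in> carrier (Sec M U)) \<and>
     (\<forall>V t. openin T V \<and> V \<subseteq> U \<and> t \<in> carrier (Sec M V) \<longrightarrow>
       (\<forall>x\<in>V. \<exists>W a. openin T W \<and> x \<in> W \<and> W \<subseteq> V \<and> (\<forall>i<n. a i \<in> carrier (Sec R W)) \<and>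
          Res M V W t = finsum (Sec M W) (\<lambda>i. a i \<odot>\<^bsub>Sec M W\<^esub> Res M U W (s i)) {..<n}))"

definition finite_type_on ::
    "'a topology \<Rightarrow> ('a, 'b) ring_presheaf \<Rightarrow> ('a, 'b, 'm) mod_presheaf \<Rightarrow> 'a set \<Rightarrow> bool" where
  "finite_type_on T R M U \<longleftrightarrow>
     (\<forall>x\<in>U. \<exists>V n s. openin T V \<and> x \<in> V \<and> V \<subseteq> U \<and> generated_by T R M V n s)"

text \<open>The kernel of the homomorphism from the free module of rank \<open>n\<close> on \<open>U\<close> to \<open>M\<close> on \<open>U\<close> given by
  sections \<open>s 0, \<dots>, s (n - 1)\<close> over \<open>U\<close>.\<close>

definition relation_sheaf ::
    "('a, 'b) ring_presheaf \<Rightarrow> ('a, 'b, 'm) mod_presheaf \<Rightarrow> 'a set \<Rightarrow> nat \<Rightarrow> (nat \<Rightarrow> 'm) \<Rightarrow>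
     ('a, 'b, nat \<Rightarrow> 'b) mod_presheaf" where
  "relation_sheaf R M U n s =
    \<lparr>Sec = (\<lambda>V.
       \<lparr>carrier = {a \<in> (\<Pi>\<^sub>E i\<in>{..<n}. carrier (Sec R V)).
                    finsum (Sec M V) (\<lambda>i. a i \<odot>\<^bsub>Sec M V\<^esub> Res M U V (s i)) {..<n} = \<zero>\<^bsub>Sec M V\<^esub>},
        monoid.mult = undefined, monoid.one = undefined,
        ring.zero = (\<lambda>i\<in>{..<n}. \<zero>\<^bsub>Sec R V\<^esub>),
        ring.add = (\<lambda>a b. \<lambda>i\<in>{..<n}. a i \<oplus>\<^bsub>Sec R V\<^esub> b i),
        smult = (\<lambda>r a. \<lambda>i\<in>{..<n}. r \<otimes>\<^bsub>Sec R V\<^esub> a i)\<rparr>),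
     Res = (\<lambda>V W a. \<lambda>i\<in>{..<n}. Res R V W (a i))\<rparr>"

definition coherent :: "('a, 'r) ringed_space \<Rightarrow> ('a, 'r, 'm) mod_presheaf \<Rightarrow> bool" where
  "coherent X M \<longleftrightarrow> sheaf_of_left_modules (Space X) (Struct X) M \<and>
     finite_type_on (Space X) (Struct X) M (pts X) \<and>
     (\<forall>U n s. Opn X U \<and> (\<forall>i<n. s i \<in> carrier (Sec M U)) \<longrightarrow>
        finite_type_on (Space X) (Struct X) (relation_sheaf (Struct X) M U n s) U)"

text \<open>Here \<open>\<iota> U\<close> maps sections of \<open>R\<close> over \<open>U\<close> to sections of \<open>A\<close>, where \<open>M\<close> is an \<open>A\<close>-module.\<close>

definition restrict_scalars ::
    "('a set \<Rightarrow> 'r \<Rightarrow> 'b) \<Rightarrow> ('a, 'b, 'm) mod_presheaf \<Rightarrow> ('a, 'r, 'm) mod_presheaf" where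
  "restrict_scalars \<iota> M =
    \<lparr>Sec = (\<lambda>U.
       \<lparr>carrier = carrier (Sec M U),
        monoid.mult = monoid.mult (Sec M U), monoid.one = monoid.one (Sec M U),
        ring.zero = ring.zero (Sec M U), ring.add = ring.add (Sec M U),
        smult = (\<lambda>r. smult (Sec M U) (\<iota> U r))\<rparr>),
     Res = Res M\<rparr>"

section \<open>Sheaves of endomorphisms\<close>

definition linear_endos :: "('r, 'z) ring_scheme \<Rightarrow> ('r, 'm) module \<Rightarrow> ('m \<Rightarrow> 'm) set" where
  "linear_endos R M = {f \<in> carrier M \<rightarrow>\<^sub>E carrier M.
     (\<forall>x\<in>carrier M. \<forall>y\<in>carrier M. f (x \<oplus>\<^bsub>M\<^esub> y) = f x \<oplus>\<^bsub>M\<^esub> f y) \<and>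
     (\<forall>r\<in>carrier R. \<forall>x\<in>carrier M. f (r \<odot>\<^bsub>M\<^esub> x) = r \<odot>\<^bsub>M\<^esub> f x)}"

definition on_opens :: "'a topology \<Rightarrow> 'a set \<Rightarrow> ('a set \<Rightarrow> 'x) \<Rightarrow> 'a set \<Rightarrow> 'x" where
  "on_opens T U = (\<lambda>g. restrict g {V. openin T V \<and> V \<subseteq> U})"

text \<open>A section over \<open>U\<close> is an endomorphism of the restriction of \<open>F\<close> to \<open>U\<close>: a family, indexed by the
  open subsets of \<open>U\<close>, of linear maps commuting with restriction.\<close>

definition End_sheaf ::
    "'a topology \<Rightarrow> ('a, 'r) ring_presheaf \<Rightarrow> ('a, 'r, 'm) mod_presheaf \<Rightarrow> ('a, 'a set \<Rightarrow> 'm \<Rightarrow> 'm) ring_presheaf"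
  where
  "End_sheaf T R F =
    \<lparr>Sec = (\<lambda>U.
       \<lparr>carrier = {\<phi> \<in> (\<Pi>\<^sub>E V\<in>{V. openin T V \<and> V \<subseteq> U}. linear_endos (Sec R V) (Sec F V)).
                    \<forall>V W. openin T V \<and> openin T W \<and> W \<subseteq> V \<and> V \<subseteq> U \<longrightarrow>
                      (\<forall>x\<in>carrier (Sec F V). Res F V W (\<phi> V x) = \<phi> W (Res F V W x))},
        monoid.mult = (\<lambda>\<phi> \<psi>. on_opens T U (\<lambda>V. \<lambda>x\<in>carrier (Sec F V). \<phi> V (\<psi> V x))),
        monoid.one = on_opens T U (\<lambda>V. \<lambda>x\<in>carrier (Sec F V). x),
        ring.zero = on_opens T U (\<lambda>V. \<lambda>x\<in>carrier (Sec F V). \<zero>\<^bsub>Sec F V\<^esub>),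
        ring.add = (\<lambda>\<phi> \<psi>. on_opens T U (\<lambda>V. \<lambda>x\<in>carrier (Sec F V). \<phi> V x \<oplus>\<^bsub>Sec F V\<^esub> \<psi> V x))\<rparr>),
     Res = (\<lambda>U V \<phi>. on_opens T V \<phi>)\<rparr>"

definition End_scalar ::
    "'a topology \<Rightarrow> ('a, 'r) ring_presheaf \<Rightarrow> ('a, 'r, 'm) mod_presheaf \<Rightarrow> 'a set \<Rightarrow> 'r \<Rightarrow> 'a set \<Rightarrow> 'm \<Rightarrow> 'm"
  where
  "End_scalar T R F U r =
     on_opens T U (\<lambda>V. \<lambda>x\<in>carrier (Sec F V). Res R U V r \<odot>\<^bsub>Sec F V\<^esub> x)"

text \<open>\<open>F\<close> as a left module over its own endomorphism sheaf.\<close>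

definition End_tautological ::
    "('a, 'r, 'm) mod_presheaf \<Rightarrow> ('a, 'a set \<Rightarrow> 'm \<Rightarrow> 'm, 'm) mod_presheaf" where
  "End_tautological F =
    \<lparr>Sec = (\<lambda>U.
       \<lparr>carrier = carrier (Sec F U),
        monoid.mult = monoid.mult (Sec F U), monoid.one = monoid.one (Sec F U),
        ring.zero = ring.zero (Sec F U), ring.add = ring.add (Sec F U),
        smult = (\<lambda>\<phi> x. \<phi> U x)\<rparr>),
     Res = Res F\<rparr>"

section \<open>Tensor products\<close>

definition tensor_relations ::
    "('r, 'z) ring_scheme \<Rightarrow> ('r, 'm) module \<Rightarrow> ('r, 'n) module \<Rightarrow> ('m \<times> 'n \<Rightarrow>\<^sub>0 int) set" where
  "tensor_relations R M N =
     {frag_of (x \<oplus>\<^bsub>M\<^esub> x', y) - frag_of (x, y) - frag_of (x', y) | x x' y.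
        x \<in> carrier M \<and> x' \<in> carrier M \<and> y \<in> carrier N} \<union>
     {frag_of (x, y \<oplus>\<^bsub>N\<^esub> y') - frag_of (x, y) - frag_of (x, y') | x y y'.
        x \<in> carrier M \<and> y \<in> carrier N \<and> y' \<in> carrier N} \<union>
     {frag_of (r \<odot>\<^bsub>M\<^esub> x, y) - frag_of (x, r \<odot>\<^bsub>N\<^esub> y) | r x y.
        r \<in> carrier R \<and> x \<in> carrier M \<and> y \<in> carrier N}"

definition tensor_kernel ::
    "('r, 'z) ring_scheme \<Rightarrow> ('r, 'm) module \<Rightarrow> ('r, 'n) module \<Rightarrow> ('m \<times> 'n \<Rightarrow>\<^sub>0 int) set" where
  "tensor_kernel R M N =
     generate (free_Abelian_group (carrier M \<times> carrier N)) (tensor_relations R M N)"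

text \<open>The tensor product of \<open>M\<close> and \<open>N\<close> over the commutative ring \<open>R\<close> as an abelian group, written
  multiplicatively.\<close>

definition tensor_group ::
    "('r, 'z) ring_scheme \<Rightarrow> ('r, 'm) module \<Rightarrow> ('r, 'n) module \<Rightarrow> ('m \<times> 'n \<Rightarrow>\<^sub>0 int) set monoid" where
  "tensor_group R M N = free_Abelian_group (carrier M \<times> carrier N) Mod tensor_kernel R M N"

text \<open>The map induced by \<open>f\<close> and \<open>g\<close> into the tensor product of \<open>M\<close> and \<open>N\<close>; a coset
  is sent to the coset that contains its image.\<close>

definition tensor_map ::
    "('r, 'z) ring_scheme \<Rightarrow> ('r, 'm) module \<Rightarrow> ('r, 'n) module \<Rightarrow> ('p \<Rightarrow> 'm) \<Rightarrow> ('q \<Rightarrow> 'n) \<Rightarrow>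
     ('p \<times> 'q \<Rightarrow>\<^sub>0 int) set \<Rightarrow> ('m \<times> 'n \<Rightarrow>\<^sub>0 int) set" where
  "tensor_map R M N f g C =
     tensor_kernel R M N <#>\<^bsub>free_Abelian_group (carrier M \<times> carrier N)\<^esub>
       (frag_extend (\<lambda>(x, y). frag_of (f x, g y)) ` C)"

text \<open>\<open>L\<close> is a left \<open>A\<close>-module, \<open>\<iota>\<close> the structure map from \<open>R\<close> to the \<open>R\<close>-algebra \<open>A\<close>, and
  \<open>N\<close> an \<open>R\<close>-module; \<open>A\<close> acts through \<open>L\<close>.\<close>

definition tensor_presheaf ::
    "('a, 'r) ring_presheaf \<Rightarrow> ('a set \<Rightarrow> 'r \<Rightarrow> 'b) \<Rightarrow> ('a, 'b, 'm) mod_presheaf \<Rightarrow> ('a, 'r, 'n) mod_presheaf \<Rightarrow>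
     ('a, 'b, ('m \<times> 'n \<Rightarrow>\<^sub>0 int) set) mod_presheaf" where
  "tensor_presheaf R \<iota> L N = (let F = restrict_scalars \<iota> L in
    \<lparr>Sec = (\<lambda>U.
       \<lparr>carrier = carrier (tensor_group (Sec R U) (Sec F U) (Sec N U)),
        monoid.mult = undefined, monoid.one = undefined,
        ring.zero = \<one>\<^bsub>tensor_group (Sec R U) (Sec F U) (Sec N U)\<^esub>,
        ring.add = monoid.mult (tensor_group (Sec R U) (Sec F U) (Sec N U)),
        smult = (\<lambda>a. tensor_map (Sec R U) (Sec F U) (Sec N U) (smult (Sec L U) a) (\<lambda>y. y))\<rparr>),
     Res = (\<lambda>U V. tensor_map (Sec R V) (Sec F V) (Sec N V) (Res F U V) (Res N U V))\<rparr>)"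

section \<open>The Auslander sheaf\<close>

text \<open>The ideal sheaf of the reduced closed subscheme on the singular locus: sections vanishing in the
  residue field at every singular point.\<close>

definition singular_ideal :: "('a, 'r) ringed_space \<Rightarrow> 'a set \<Rightarrow> 'r set" where
  "singular_ideal X U = {s \<in> carrier (Sec (Struct X) U).
     \<forall>x\<in>U \<inter> singular_points X. germ (Space X) (Struct X) x U s \<in> max_ideal (Loc X x)}"

text \<open>The direct sum of the ideal sheaf of the singular locus and the structure sheaf.\<close>

definition F_sheaf :: "('a, 'r) ringed_space \<Rightarrow> ('a, 'r, 'r \<times> 'r) mod_presheaf" where
  "F_sheaf X =
    \<lparr>Sec = (\<lambda>U. let R = Sec (Struct X) U in
       \<lparr>carrier = singular_ideal X U \<times> carrier R,
        monoid.mult = undefined, monoid.one = undefined,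
        ring.zero = (\<zero>\<^bsub>R\<^esub>, \<zero>\<^bsub>R\<^esub>),
        ring.add = (\<lambda>(i, s) (j, t). (i \<oplus>\<^bsub>R\<^esub> j, s \<oplus>\<^bsub>R\<^esub> t)),
        smult = (\<lambda>r (i, s). (r \<otimes>\<^bsub>R\<^esub> i, r \<otimes>\<^bsub>R\<^esub> s))\<rparr>),
     Res = (\<lambda>U V (i, s). (Res (Struct X) U V i, Res (Struct X) U V s))\<rparr>"

type_synonym ('a, 'r) auslander_section = "'a set \<Rightarrow> 'r \<times> 'r \<Rightarrow> 'r \<times> 'r"

definition Auslander_sheaf ::
    "('a, 'r) ringed_space \<Rightarrow> ('a, ('a, 'r) auslander_section) ring_presheaf" where
  "Auslander_sheaf X = End_sheaf (Space X) (Struct X) (F_sheaf X)"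

definition Auslander_scalar ::
    "('a, 'r) ringed_space \<Rightarrow> 'a set \<Rightarrow> 'r \<Rightarrow> ('a, 'r) auslander_section" where
  "Auslander_scalar X = End_scalar (Space X) (Struct X) (F_sheaf X)"

text \<open>A sheaf of modules over the Auslander sheaf is coherent if its underlying sheaf of modules over
  the structure sheaf is.\<close>

definition coherent_Auslander ::
    "('a, 'r) ringed_space \<Rightarrow> ('a, ('a, 'r) auslander_section, 'n) mod_presheaf \<Rightarrow> bool" where
  "coherent_Auslander X N \<longleftrightarrow>
     sheaf_of_left_modules (Space X) (Auslander_sheaf X) N \<and>
     coherent X (restrict_scalars (Auslander_scalar X) N)"

definition F_functor ::
    "('a, 'r) ringed_space \<Rightarrow> ('a, 'r, 'm) mod_presheaf \<Rightarrow>
     ('a, ('a, 'r) auslander_section, 'a \<Rightarrow> ('a set \<times> (('r \<times> 'r) \<times> 'm \<Rightarrow>\<^sub>0 int) set) set) mod_presheaf" where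
  "F_functor X M =
     sheafify (Space X) (Auslander_sheaf X)
       (tensor_presheaf (Struct X) (Auslander_scalar X) (End_tautological (F_sheaf X)) M)"

text \<open>HOL cannot quantify over types inside a formula, so the first argument names the type on which the
  sections of the preimage \<open>M\<close> live.  The choice \<open>'n\<close> is the largest that matters: \<open>M\<close> is
  isomorphic to the image on \<open>N\<close> of the idempotent of the Auslander sheaf projecting to the
  structure sheaf, whose sections form a subset of those of \<open>N\<close>.\<close>

definition essential_image ::
    "'m itself \<Rightarrow> ('a, 'r) ringed_space \<Rightarrow> ('a, ('a, 'r) auslander_section, 'n) mod_presheaf \<Rightarrow> bool" where
  "essential_image _ X N \<longleftrightarrow> coherent_Auslander X N \<and>
     (\<exists>M::('a, 'r, 'm) mod_presheaf. coherent X M \<and>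
        sheaf_isomorphic (Space X) (Auslander_sheaf X) (F_functor X M) N)"

end

theory Submission
  imports Defs
begin

text \<open>Let \<open>e\<close> be the idempotent of \<open>\<A>\<close> projecting \<open>\<F> = \<I> \<oplus> \<O>\<close> to \<open>\<O>\<close>.  Then \<open>\<F> = \<A> e\<close> and
  \<open>e \<A> e = \<O>\<close>, so \<open>\<F> \<otimes> -\<close> is left adjoint to the exact functor \<open>N \<mapsto> e N\<close>, and \<open>N\<close> lies in the
  essential image iff the counit \<open>\<F> \<otimes> e N \<rightarrow> N\<close> is an isomorphism.  As \<open>\<F> \<otimes> -\<close> is right exact, this
  property passes to extensions by a diagram chase.  All arguments are local: instead of stalks they use formal
  sums of pairs of sections, up to shrinking the neighbourhood of a point.\<close>

section \<open>Tensor products\<close>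

text \<open>The ideal of a node is not flat, so \<F> \<otimes> - is not left exact. The comparison
  is between a right exact row \<F> \<otimes> e N' -> \<F> \<otimes> e N -> \<F> \<otimes> e N'' ->
  0 and the short exact row of the extension; the injectivity missing on the left is made up for by
  that of \<open>i\<close> and of the counit of \<open>N'\<close>. The counit is a convenient
  criterion because it mentions \<open>N\<close> alone and no chosen preimage, and because it comes
  with a canonical preimage: e N is a subsheaf of \<open>N\<close>, hence lives on the type that
  \<open>essential_image\<close> prescribes, and it is a direct \<O>-summand of \<open>N\<close>,
  hence coherent. \<open>F_functor\<close> sheafifies a presheaf whose sections are cosets of formal
  sums modulo \<open>tensor_kernel\<close>. A section of that presheaf dies in the sheafification
  iff, near every point, a representative falls into the kernel after restriction. This is why
  injectivity and surjectivity are demanded only near each point, and why relations as well as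
  sections must be lifted along \<open>p\<close>.\<close>

lemma keys_diff_subset:
  fixes c d :: "'s \<Rightarrow>\<^sub>0 int"
  shows "\<lbrakk>Poly_Mapping.keys c \<subseteq> S; Poly_Mapping.keys d \<subseteq> S\<rbrakk> \<Longrightarrow> Poly_Mapping.keys (c - d) \<subseteq> S"
  using keys_diff[of c d] by blast

lemma keys_add_subset:
  fixes c d :: "'s \<Rightarrow>\<^sub>0 int"
  shows "\<lbrakk>Poly_Mapping.keys c \<subseteq> S; Poly_Mapping.keys d \<subseteq> S\<rbrakk> \<Longrightarrow> Poly_Mapping.keys (c + d) \<subseteq> S"
  using keys_add[of c d] by blast

text \<open>Only closure of the operations is assumed: it is what keeps the tensor relations inside
  the free abelian group on pairs, so that kernel and cosets are well formed.\<close>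

locale tensor_pair =
  fixes R :: "('r, 'z) ring_scheme" and M :: "('r, 'm) module" and N :: "('r, 'n) module"
  assumes left_add: "\<lbrakk>x \<in> carrier M; x' \<in> carrier M\<rbrakk> \<Longrightarrow> x \<oplus>\<^bsub>M\<^esub> x' \<in> carrier M"
    and right_add: "\<lbrakk>y \<in> carrier N; y' \<in> carrier N\<rbrakk> \<Longrightarrow> y \<oplus>\<^bsub>N\<^esub> y' \<in> carrier N"
    and left_smult: "\<lbrakk>r \<in> carrier R; x \<in> carrier M\<rbrakk> \<Longrightarrow> r \<odot>\<^bsub>M\<^esub> x \<in> carrier M"
    and right_smult: "\<lbrakk>r \<in> carrier R; y \<in> carrier N\<rbrakk> \<Longrightarrow> r \<odot>\<^bsub>N\<^esub> y \<in> carrier N"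
begin

abbreviation formal_sums :: "('m \<times> 'n \<Rightarrow>\<^sub>0 int) monoid" where
  "formal_sums \<equiv> free_Abelian_group (carrier M \<times> carrier N)"

definition tensor_class :: "('m \<times> 'n \<Rightarrow>\<^sub>0 int) \<Rightarrow> ('m \<times> 'n \<Rightarrow>\<^sub>0 int) set" where
  "tensor_class c = tensor_kernel R M N #>\<^bsub>formal_sums\<^esub> c"

lemma tensor_relations_subset: "tensor_relations R M N \<subseteq> carrier formal_sums"
proof
  fix c assume "c \<in> tensor_relations R M N"
  then show "c \<in> carrier formal_sums"
    by (simp add: tensor_relations_def)
      (elim disjE exE conjE; simp add: keys_diff_subset left_add right_add left_smult right_smult)
qed

lemma subgroup_tensor_kernel: "subgroup (tensor_kernel R M N) formal_sums"
  unfolding tensor_kernel_def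
  by (rule group.generate_is_subgroup[OF group_free_Abelian_group tensor_relations_subset])

lemma normal_tensor_kernel: "normal (tensor_kernel R M N) formal_sums"
  by (rule comm_group.subgroup_imp_normal[OF abelian_free_Abelian_group subgroup_tensor_kernel])

lemma kernel_keys: "c \<in> tensor_kernel R M N \<Longrightarrow> Poly_Mapping.keys c \<subseteq> carrier M \<times> carrier N"
  using subgroup.mem_carrier[OF subgroup_tensor_kernel] by simp

lemma kernel_zero: "0 \<in> tensor_kernel R M N"
  using subgroup.one_closed[OF subgroup_tensor_kernel] by simp

lemma kernel_add:
  "\<lbrakk>c \<in> tensor_kernel R M N; d \<in> tensor_kernel R M N\<rbrakk> \<Longrightarrow> c + d \<in> tensor_kernel R M N"
  using subgroup.m_closed[OF subgroup_tensor_kernel] by simp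

lemma kernel_uminus: "c \<in> tensor_kernel R M N \<Longrightarrow> - c \<in> tensor_kernel R M N"
  using subgroup.m_inv_closed[OF subgroup_tensor_kernel] kernel_keys by fastforce

lemma kernel_diff:
  "\<lbrakk>c \<in> tensor_kernel R M N; d \<in> tensor_kernel R M N\<rbrakk> \<Longrightarrow> c - d \<in> tensor_kernel R M N"
  using kernel_add[OF _ kernel_uminus] by fastforce

lemma kernel_left_add:
  "\<lbrakk>x \<in> carrier M; x' \<in> carrier M; y \<in> carrier N\<rbrakk> \<Longrightarrow>
    frag_of (x \<oplus>\<^bsub>M\<^esub> x', y) - frag_of (x, y) - frag_of (x', y) \<in> tensor_kernel R M N"
  unfolding tensor_kernel_def by (rule generate.incl) (auto simp: tensor_relations_def)

lemma kernel_right_add: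
  "\<lbrakk>x \<in> carrier M; y \<in> carrier N; y' \<in> carrier N\<rbrakk> \<Longrightarrow>
    frag_of (x, y \<oplus>\<^bsub>N\<^esub> y') - frag_of (x, y) - frag_of (x, y') \<in> tensor_kernel R M N"
  unfolding tensor_kernel_def by (rule generate.incl) (auto simp: tensor_relations_def)

lemma kernel_balanced:
  "\<lbrakk>r \<in> carrier R; x \<in> carrier M; y \<in> carrier N\<rbrakk> \<Longrightarrow>
    frag_of (r \<odot>\<^bsub>M\<^esub> x, y) - frag_of (x, r \<odot>\<^bsub>N\<^esub> y) \<in> tensor_kernel R M N"
  unfolding tensor_kernel_def by (rule generate.incl) (auto simp: tensor_relations_def)

text \<open>For statements about the kernel that are additive. The induction rule of
  \<open>generate\<close> yields inverses of generators only; the case \<open>uminus\<close> covers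
  them by allowing every kernel element. Kernel membership stays available in the cases
  \<open>uminus\<close> and \<open>add\<close>, where it bounds the supports.\<close>

lemma tensor_kernel_induct [consumes 1, case_names zero left right balanced uminus add]:
  assumes "c \<in> tensor_kernel R M N"
    and "P 0"
    and "\<And>x x' y. \<lbrakk>x \<in> carrier M; x' \<in> carrier M; y \<in> carrier N\<rbrakk> \<Longrightarrow>
      P (frag_of (x \<oplus>\<^bsub>M\<^esub> x', y) - frag_of (x, y) - frag_of (x', y))"
    and "\<And>x y y'. \<lbrakk>x \<in> carrier M; y \<in> carrier N; y' \<in> carrier N\<rbrakk> \<Longrightarrow>
      P (frag_of (x, y \<oplus>\<^bsub>N\<^esub> y') - frag_of (x, y) - frag_of (x, y'))"
    and "\<And>r x y. \<lbrakk>r \<in> carrier R; x \<in> carrier M; y \<in> carrier N\<rbrakk> \<Longrightarrow>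
      P (frag_of (r \<odot>\<^bsub>M\<^esub> x, y) - frag_of (x, r \<odot>\<^bsub>N\<^esub> y))"
    and um: "\<And>c. \<lbrakk>c \<in> tensor_kernel R M N; P c\<rbrakk> \<Longrightarrow> P (- c)"
    and "\<And>c d. \<lbrakk>c \<in> tensor_kernel R M N; d \<in> tensor_kernel R M N; P c; P d\<rbrakk> \<Longrightarrow> P (c + d)"
  shows "P c"
  using assms(1) unfolding tensor_kernel_def
proof (induction rule: generate.induct)
  case one
  then show ?case using assms(2) by simp
next
  case (incl h)
  then show ?case using assms(3-5) by (auto simp: tensor_relations_def)
next
  case (inv h)
  then have "P h" using assms(3-5) by (auto simp: tensor_relations_def)
  moreover have "Poly_Mapping.keys h \<subseteq> carrier M \<times> carrier N"
    using subsetD[OF tensor_relations_subset inv] by simp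
  ultimately show ?case using um generate.incl[OF inv, of formal_sums] by (simp add: tensor_kernel_def)
next
  case (eng h1 h2)
  then show ?case using assms(7) by (simp add: tensor_kernel_def)
qed

text \<open>From here on an equality in the tensor product becomes membership of a difference in the
  kernel, so that the cosets themselves rarely have to be opened.\<close>

lemma tensor_class_eq_iff:
  assumes "Poly_Mapping.keys c \<subseteq> carrier M \<times> carrier N" "Poly_Mapping.keys d \<subseteq> carrier M \<times> carrier N"
  shows "tensor_class c = tensor_class d \<longleftrightarrow> c - d \<in> tensor_kernel R M N"
proof
  assume "tensor_class c = tensor_class d"
  moreover have "c \<in> tensor_class c"
    unfolding tensor_class_def r_coset_def using kernel_zero by force
  ultimately obtain k where "k \<in> tensor_kernel R M N" "c = k + d"
    unfolding tensor_class_def r_coset_def by auto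
  then show "c - d \<in> tensor_kernel R M N" by simp
next
  assume k: "c - d \<in> tensor_kernel R M N"
  have "tensor_class c \<subseteq> tensor_class d" if "c - d \<in> tensor_kernel R M N" for c d
    using kernel_add[OF _ that] unfolding tensor_class_def r_coset_def
    by (force simp: algebra_simps)
  from this[OF k] this[of d c] kernel_uminus[OF k] show "tensor_class c = tensor_class d" by auto
qed

lemma carrier_tensor_group:
  "carrier (tensor_group R M N) = tensor_class ` {c. Poly_Mapping.keys c \<subseteq> carrier M \<times> carrier N}"
  by (auto simp: tensor_group_def carrier_FactGroup tensor_class_def)

lemma tensor_class_add:
  assumes "Poly_Mapping.keys c \<subseteq> carrier M \<times> carrier N" "Poly_Mapping.keys d \<subseteq> carrier M \<times> carrier N"
  shows "monoid.mult (tensor_group R M N) (tensor_class c) (tensor_class d) = tensor_class (c + d)"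
  using normal.rcos_sum[OF normal_tensor_kernel, of c d] assms
  by (simp add: tensor_group_def tensor_class_def)

end

text \<open>The tensor product of two maps on the level of representatives. It is additive by
  construction, whether or not \<open>f\<close> and \<open>g\<close> are.\<close>

abbreviation pair_map :: "('m \<Rightarrow> 'p) \<Rightarrow> ('n \<Rightarrow> 'q) \<Rightarrow> ('m \<times> 'n \<Rightarrow>\<^sub>0 int) \<Rightarrow> ('p \<times> 'q \<Rightarrow>\<^sub>0 int)" where
  "pair_map f g \<equiv> frag_extend (\<lambda>(x, y). frag_of (f x, g y))"

lemma pair_map_keys:
  assumes "Poly_Mapping.keys c \<subseteq> S \<times> T" "f \<in> S \<rightarrow> S'" "g \<in> T \<rightarrow> T'"
  shows "Poly_Mapping.keys (pair_map f g c) \<subseteq> S' \<times> T'"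
  using keys_frag_extend[of "\<lambda>(x, y). frag_of (f x, g y)" c] assms by fastforce

lemma pair_map_compose: "pair_map f g (pair_map f' g' c) = pair_map (\<lambda>x. f (f' x)) (\<lambda>x. g (g' x)) c"
proof -
  \<comment> \<open>\<open>frag_extend_compose\<close> wants an inner map that sends generators to
    generators, so it is written as \<open>frag_of\<close> after
    \<open>map_prod f' g'\<close>.\<close>
  have "pair_map f' g' c = frag_extend (frag_of \<circ> map_prod f' g') c"
    by (rule arg_cong[where f="\<lambda>h. frag_extend h c"]) auto
  then show ?thesis
    by (simp add: frag_extend_compose) (rule arg_cong[where f="\<lambda>h. frag_extend h c"], auto)
qed

lemma pair_map_cong:
  assumes "Poly_Mapping.keys c \<subseteq> S \<times> T" "\<And>x. x \<in> S \<Longrightarrow> f x = f' x" "\<And>y. y \<in> T \<Longrightarrow> g y = g' y"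
  shows "pair_map f g c = pair_map f' g' c"
  by (rule frag_extend_eq) (use assms in auto)

lemma pair_map_id:
  assumes "Poly_Mapping.keys c \<subseteq> S \<times> T" "\<And>x. x \<in> S \<Longrightarrow> f x = x" "\<And>y. y \<in> T \<Longrightarrow> g y = y"
  shows "pair_map f g c = c"
proof -
  have "pair_map f g c = frag_extend frag_of c"
    by (rule frag_extend_eq) (use assms in auto)
  then show ?thesis by (simp flip: frag_expansion)
qed

lemma pair_map_hom:
  assumes "f \<in> S \<rightarrow> S'" "g \<in> Y \<rightarrow> Y'"
  shows "pair_map f g \<in> hom (free_Abelian_group (S \<times> Y)) (free_Abelian_group (S' \<times> Y'))"
  by (rule homI) (use pair_map_keys[OF _ assms] in \<open>simp_all add: frag_extend_add\<close>)

text \<open>Semilinear over \<rho>, so that one locale serves three times: restriction to a smaller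
  open set (\<rho> restricts functions), the action of an endomorphism on the left factor and a
  module homomorphism on the right factor (\<rho> is the identity).\<close>

locale tensor_pair_map = P: tensor_pair R M N + P': tensor_pair R' M' N'
  for R :: "('r, 'z) ring_scheme" and M :: "('r, 'm) module" and N :: "('r, 'n) module"
    and R' :: "('r1, 'z1) ring_scheme" and M' :: "('r1, 'm1) module" and N' :: "('r1, 'n1) module" +
  fixes \<rho> :: "'r \<Rightarrow> 'r1" and f :: "'m \<Rightarrow> 'm1" and g :: "'n \<Rightarrow> 'n1"
  assumes ring_map: "\<rho> \<in> carrier R \<rightarrow> carrier R'"
    and left_map: "f \<in> carrier M \<rightarrow> carrier M'" and right_map: "g \<in> carrier N \<rightarrow> carrier N'"
    and left_map_add: "\<lbrakk>x \<in> carrier M; x' \<in> carrier M\<rbrakk> \<Longrightarrow> f (x \<oplus>\<^bsub>M\<^esub> x') = f x \<oplus>\<^bsub>M'\<^esub> f x'"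
    and right_map_add: "\<lbrakk>y \<in> carrier N; y' \<in> carrier N\<rbrakk> \<Longrightarrow> g (y \<oplus>\<^bsub>N\<^esub> y') = g y \<oplus>\<^bsub>N'\<^esub> g y'"
    and left_map_smult: "\<lbrakk>r \<in> carrier R; x \<in> carrier M\<rbrakk> \<Longrightarrow> f (r \<odot>\<^bsub>M\<^esub> x) = \<rho> r \<odot>\<^bsub>M'\<^esub> f x"
    and right_map_smult: "\<lbrakk>r \<in> carrier R; y \<in> carrier N\<rbrakk> \<Longrightarrow> g (r \<odot>\<^bsub>N\<^esub> y) = \<rho> r \<odot>\<^bsub>N'\<^esub> g y"
begin

lemma pair_map_kernel:
  assumes "c \<in> tensor_kernel R M N"
  shows "pair_map f g c \<in> tensor_kernel R' M' N'"
  using assms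
proof (induction rule: P.tensor_kernel_induct)
  case zero
  then show ?case by (simp add: P'.kernel_zero)
next
  case (left x x' y)
  then show ?case
    using P'.kernel_left_add[of "f x" "f x'" "g y"] left_map right_map
    by (auto simp: frag_extend_diff left_map_add)
next
  case (right x y y')
  then show ?case
    using P'.kernel_right_add[of "f x" "g y" "g y'"] left_map right_map
    by (auto simp: frag_extend_diff right_map_add)
next
  case (balanced r x y)
  then show ?case
    using P'.kernel_balanced[of "\<rho> r" "f x" "g y"] ring_map left_map right_map
    by (auto simp: frag_extend_diff left_map_smult right_map_smult)
next
  case (uminus c)
  then show ?case by (simp add: frag_extend_minus P'.kernel_uminus)
next
  case (add c d)
  then show ?case by (simp add: frag_extend_add P'.kernel_add)
qed

lemma pair_map_carrier:
  "Poly_Mapping.keys c \<subseteq> carrier M \<times> carrier N \<Longrightarrow>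
    Poly_Mapping.keys (pair_map f g c) \<subseteq> carrier M' \<times> carrier N'"
  by (rule pair_map_keys[OF _ left_map right_map])

text \<open>A coset consists of the translates of \<open>c\<close> by kernel elements; by
  \<open>pair_map_kernel\<close> the images of these elements are absorbed into the kernel that
  \<open>tensor_map\<close> adds.\<close>

lemma tensor_map_class:
  assumes "Poly_Mapping.keys c \<subseteq> carrier M \<times> carrier N"
  shows "tensor_map R' M' N' f g (P.tensor_class c) = P'.tensor_class (pair_map f g c)"
proof -
  have "(\<exists>k'\<in>tensor_kernel R' M' N'. \<exists>k\<in>tensor_kernel R M N. d = k' + pair_map f g (k + c)) \<longleftrightarrow>
      (\<exists>k'\<in>tensor_kernel R' M' N'. d = k' + pair_map f g c)" (is "?L = ?R") for d
  proof
    assume ?L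
    then obtain k' k where "k' \<in> tensor_kernel R' M' N'" "k \<in> tensor_kernel R M N"
      "d = (k' + pair_map f g k) + pair_map f g c"
      by (auto simp: frag_extend_add add.assoc)
    then show ?R using P'.kernel_add pair_map_kernel by blast
  next
    assume ?R
    then show ?L using P.kernel_zero by force
  qed
  then show ?thesis
    unfolding tensor_map_def P.tensor_class_def P'.tensor_class_def r_coset_def set_mult_def
    by auto
qed

end

section \<open>Sheafification\<close>

text \<open>Filter of small open neighbourhoods of \<open>x\<close>. A property holds eventually if
  it holds on all sufficiently small ones; finitely many shrinkings then combine by
  \<open>eventually_elim\<close>, without explicit intersections.\<close>

definition nhd :: "'a topology \<Rightarrow> 'a \<Rightarrow> 'a set filter" where
  "nhd T x = (INF W\<in>{W. openin T W \<and> x \<in> W}. principal {V. openin T V \<and> x \<in> V \<and> V \<subseteq> W})"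

text \<open>The neighbourhoods are directed under intersection, and the bound by \<open>U\<close>
  costs nothing because \<open>W\<close> can be replaced by \<open>W \<inter> U\<close>.\<close>

lemma eventually_nhd:
  assumes "openin T U" "x \<in> U"
  shows "eventually P (nhd T x) \<longleftrightarrow>
    (\<exists>W. openin T W \<and> x \<in> W \<and> W \<subseteq> U \<and> (\<forall>V. openin T V \<and> x \<in> V \<and> V \<subseteq> W \<longrightarrow> P V))"
proof -
  have "eventually P (nhd T x) \<longleftrightarrow>
      (\<exists>W\<in>{W. openin T W \<and> x \<in> W}. eventually P (principal {V. openin T V \<and> x \<in> V \<and> V \<subseteq> W}))"
    unfolding nhd_def
  proof (rule eventually_INF_base)
    show "{W. openin T W \<and> x \<in> W} \<noteq> {}" using assms by auto
    fix V W assume "V \<in> {W. openin T W \<and> x \<in> W}" "W \<in> {W. openin T W \<and> x \<in> W}"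
    then show "\<exists>V'\<in>{W. openin T W \<and> x \<in> W}. principal {V. openin T V \<and> x \<in> V \<and> V \<subseteq> V'} \<le>
        inf (principal {V'. openin T V' \<and> x \<in> V' \<and> V' \<subseteq> V}) (principal {V. openin T V \<and> x \<in> V \<and> V \<subseteq> W})"
      by (intro bexI[of _ "V \<inter> W"]) auto
  qed
  also have "\<dots> \<longleftrightarrow> (\<exists>W. openin T W \<and> x \<in> W \<and> (\<forall>V. openin T V \<and> x \<in> V \<and> V \<subseteq> W \<longrightarrow> P V))"
    by (auto simp: eventually_principal)
  also have "\<dots> \<longleftrightarrow> (\<exists>W. openin T W \<and> x \<in> W \<and> W \<subseteq> U \<and> (\<forall>V. openin T V \<and> x \<in> V \<and> V \<subseteq> W \<longrightarrow> P V))"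
  proof (intro iffI; elim exE conjE)
    fix W assume "openin T W" "x \<in> W" "\<forall>V. openin T V \<and> x \<in> V \<and> V \<subseteq> W \<longrightarrow> P V"
    then show "\<exists>W. openin T W \<and> x \<in> W \<and> W \<subseteq> U \<and> (\<forall>V. openin T V \<and> x \<in> V \<and> V \<subseteq> W \<longrightarrow> P V)"
      using assms by (intro exI[of _ "W \<inter> U"]) auto
  qed blast
  finally show ?thesis .
qed

lemma eventually_nhdI:
  assumes "openin T U" "x \<in> U" "\<And>V. \<lbrakk>openin T V; x \<in> V; V \<subseteq> U\<rbrakk> \<Longrightarrow> P V"
  shows "eventually P (nhd T x)"
  using assms by (auto simp: eventually_nhd[OF assms(1,2)])

lemma eventually_nhd_subset:
  assumes "openin T U" "x \<in> U"
  shows "\<forall>\<^sub>F W in nhd T x. openin T W \<and> x \<in> W \<and> W \<subseteq> U"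
  by (rule eventually_nhdI[OF assms]) auto

lemma eventually_nhdE:
  assumes "eventually P (nhd T x)" "openin T U" "x \<in> U"
  obtains W where "openin T W" "x \<in> W" "W \<subseteq> U" "P W"
  using assms(1) unfolding eventually_nhd[OF assms(2,3)] by blast

locale presheaf =
  fixes T :: "'a topology" and F :: "('a, 'x, ('x, 'z) partial_object_scheme) presheaf"
  assumes is_presheaf: "is_presheaf T F"
begin

lemma res_closed:
  "\<lbrakk>openin T U; openin T V; V \<subseteq> U; s \<in> carrier (Sec F U)\<rbrakk> \<Longrightarrow> Res F U V s \<in> carrier (Sec F V)"
  using is_presheaf unfolding is_presheaf_def by (elim conjE) (metis PiE)

lemma res_id: "\<lbrakk>openin T U; s \<in> carrier (Sec F U)\<rbrakk> \<Longrightarrow> Res F U U s = s"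
  using is_presheaf unfolding is_presheaf_def by blast

lemma res_res:
  "\<lbrakk>openin T U; openin T V; openin T W; W \<subseteq> V; V \<subseteq> U; s \<in> carrier (Sec F U)\<rbrakk> \<Longrightarrow>
    Res F V W (Res F U V s) = Res F U W s"
  using is_presheaf unfolding is_presheaf_def by blast

text \<open>Agreement on one neighbourhood persists on all smaller ones by functoriality of
  restriction. Hence the existential in \<open>germ\<close> is an eventual statement, and equality
  of germs becomes a matter of filters.\<close>

lemma mem_germ_iff:
  assumes "openin T U" "x \<in> U" "s \<in> carrier (Sec F U)"
  shows "(V, t) \<in> germ T F x U s \<longleftrightarrow> openin T V \<and> x \<in> V \<and> t \<in> carrier (Sec F V) \<and>
    (\<forall>\<^sub>F W in nhd T x. Res F U W s = Res F V W t)"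
proof (cases "openin T V \<and> x \<in> V \<and> t \<in> carrier (Sec F V)")
  case True
  then have UV: "openin T (U \<inter> V)" "x \<in> U \<inter> V" using assms by auto
  have "(\<exists>W. openin T W \<and> x \<in> W \<and> W \<subseteq> U \<inter> V \<and> Res F U W s = Res F V W t) \<longleftrightarrow>
      (\<forall>\<^sub>F W in nhd T x. Res F U W s = Res F V W t)" (is "?L \<longleftrightarrow> ?R")
  proof
    assume ?L
    then obtain W where W: "openin T W" "x \<in> W" "W \<subseteq> U \<inter> V" "Res F U W s = Res F V W t" by blast
    show ?R
    proof (rule eventually_nhdI[OF W(1,2)])
      fix W' assume "openin T W'" "x \<in> W'" "W' \<subseteq> W"
      then show "Res F U W' s = Res F V W' t"
        using W assms True res_res[of U W W' s] res_res[of V W W' t] by simp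
    qed
  next
    assume ?R
    then show ?L by (rule eventually_nhdE[OF _ UV]) auto
  qed
  then show ?thesis using True by (simp add: germ_def)
qed (auto simp: germ_def)

lemma self_mem_germ:
  "\<lbrakk>openin T U; x \<in> U; s \<in> carrier (Sec F U)\<rbrakk> \<Longrightarrow> (U, s) \<in> germ T F x U s"
  by (simp add: mem_germ_iff)

lemma germ_eq_iff:
  assumes "openin T U" "x \<in> U" "s \<in> carrier (Sec F U)" "openin T V" "x \<in> V" "t \<in> carrier (Sec F V)"
  shows "germ T F x U s = germ T F x V t \<longleftrightarrow> (\<forall>\<^sub>F W in nhd T x. Res F U W s = Res F V W t)"
proof
  assume "germ T F x U s = germ T F x V t"
  then have "(V, t) \<in> germ T F x U s" using self_mem_germ assms by simp
  then show "\<forall>\<^sub>F W in nhd T x. Res F U W s = Res F V W t" using assms by (simp add: mem_germ_iff)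
next
  assume *: "\<forall>\<^sub>F W in nhd T x. Res F U W s = Res F V W t"
  have "(\<forall>\<^sub>F W in nhd T x. Res F U W s = Res F W' W t') \<longleftrightarrow>
      (\<forall>\<^sub>F W in nhd T x. Res F V W t = Res F W' W t')" for W' t'
    by (rule eventually_cong[OF *]) simp
  then show "germ T F x U s = germ T F x V t" using assms by (auto simp: mem_germ_iff)
qed

lemma germ_res:
  assumes "openin T U" "openin T V" "x \<in> V" "V \<subseteq> U" "s \<in> carrier (Sec F U)"
  shows "germ T F x V (Res F U V s) = germ T F x U s"
proof (subst germ_eq_iff)
  show "\<forall>\<^sub>F W in nhd T x. Res F V W (Res F U V s) = Res F U W s"
    by (rule eventually_nhdI[OF assms(2,3)]) (use assms in \<open>simp add: res_res\<close>)
qed (use assms in \<open>auto intro: res_closed\<close>)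

lemma mem_germ_eq:
  assumes "openin T U" "x \<in> U" "s \<in> carrier (Sec F U)" "(V, t) \<in> germ T F x U s"
  shows "openin T V" "x \<in> V" "t \<in> carrier (Sec F V)" "germ T F x V t = germ T F x U s"
  using assms by (auto simp: mem_germ_iff germ_eq_iff elim: eventually_mono)

text \<open>Stalks and \<open>sheafify\<close> define their operations as unions over all pairs of
  representatives. Compatibility with restriction makes every member of such a union the same germ,
  and the pair over \<open>U\<close> shows that the union is not empty.\<close>

lemma germ_union_binop:
  assumes closed: "\<And>W a b. \<lbrakk>openin T W; a \<in> carrier (Sec F W); b \<in> carrier (Sec F W)\<rbrakk> \<Longrightarrow>
      opr W a b \<in> carrier (Sec F W)"
    and res: "\<And>W V a b. \<lbrakk>openin T W; openin T V; V \<subseteq> W; a \<in> carrier (Sec F W); b \<in> carrier (Sec F W)\<rbrakk> \<Longrightarrow>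
      Res F W V (opr W a b) = opr V (Res F W V a) (Res F W V b)"
    and U: "openin T U" "x \<in> U" "s \<in> carrier (Sec F U)" "t \<in> carrier (Sec F U)"
  shows "\<Union>{germ T F x W (opr W a b) | W a b. (W, a) \<in> germ T F x U s \<and> (W, b) \<in> germ T F x U t} =
    germ T F x U (opr U s t)"
proof -
  have "germ T F x W (opr W a b) = germ T F x U (opr U s t)"
    if ab: "(W, a) \<in> germ T F x U s" "(W, b) \<in> germ T F x U t" for W a b
  proof -
    note W = mem_germ_eq[OF U(1,2,3) ab(1)] mem_germ_eq[OF U(1,2,4) ab(2)]
    have "\<forall>\<^sub>F V in nhd T x. Res F U V s = Res F W V a" "\<forall>\<^sub>F V in nhd T x. Res F U V t = Res F W V b"
      using ab U by (auto simp: mem_germ_iff)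
    then have "\<forall>\<^sub>F V in nhd T x. Res F W V (opr W a b) = Res F U V (opr U s t)"
      using eventually_nhd_subset[OF U(1,2)] eventually_nhd_subset[OF W(1,2)]
      by eventually_elim (use U W in \<open>simp add: res\<close>)
    then show ?thesis using U W closed by (simp add: germ_eq_iff)
  qed
  moreover have "(U, s) \<in> germ T F x U s" "(U, t) \<in> germ T F x U t" using U by (auto intro: self_mem_germ)
  ultimately show ?thesis by blast
qed

end

text \<open>Meant for the presheaf tensor product as well as for sheaves of modules; it therefore
  records just closure and compatibility with restriction, which fix the operations on
  germs.\<close>

locale module_presheaf = presheaf T P + A: presheaf T A
  for T :: "'a topology" and A :: "('a, 'b) ring_presheaf" and P :: "('a, 'b, 'm) mod_presheaf" +
  assumes add_closed: "\<lbrakk>openin T U; s \<in> carrier (Sec P U); t \<in> carrier (Sec P U)\<rbrakk> \<Longrightarrow>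
      s \<oplus>\<^bsub>Sec P U\<^esub> t \<in> carrier (Sec P U)"
    and smult_closed: "\<lbrakk>openin T U; a \<in> carrier (Sec A U); s \<in> carrier (Sec P U)\<rbrakk> \<Longrightarrow>
      a \<odot>\<^bsub>Sec P U\<^esub> s \<in> carrier (Sec P U)"
    and res_add: "\<lbrakk>openin T U; openin T V; V \<subseteq> U; s \<in> carrier (Sec P U); t \<in> carrier (Sec P U)\<rbrakk> \<Longrightarrow>
      Res P U V (s \<oplus>\<^bsub>Sec P U\<^esub> t) = Res P U V s \<oplus>\<^bsub>Sec P V\<^esub> Res P U V t"
    and res_smult: "\<lbrakk>openin T U; openin T V; V \<subseteq> U; a \<in> carrier (Sec A U); s \<in> carrier (Sec P U)\<rbrakk> \<Longrightarrow>
      Res P U V (a \<odot>\<^bsub>Sec P U\<^esub> s) = Res A U V a \<odot>\<^bsub>Sec P V\<^esub> Res P U V s"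
begin

lemma sheafify_add_germ:
  assumes "openin T U" "openin T V" "x \<in> V" "V \<subseteq> U" "t \<in> carrier (Sec P V)" "t' \<in> carrier (Sec P V)"
    "s x = germ T P x V t" "s' x = germ T P x V t'"
  shows "(s \<oplus>\<^bsub>Sec (sheafify T A P) U\<^esub> s') x = germ T P x V (t \<oplus>\<^bsub>Sec P V\<^esub> t')"
  using assms germ_union_binop[of "\<lambda>V. ring.add (Sec P V)" V x t t']
  by (auto simp: sheafify_def add_closed res_add)

text \<open>Representatives are taken on subsets of \<open>U\<close> only, where the scalar
  \<open>a\<close> can be restricted; near \<open>x\<close> the scaled representatives agree, so
  their germs coincide.\<close>

lemma sheafify_smult_germ:
  assumes U: "openin T U" "openin T V" "x \<in> V" "V \<subseteq> U" "t \<in> carrier (Sec P V)" "a \<in> carrier (Sec A U)"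
    and s: "s x = germ T P x V t"
  shows "(a \<odot>\<^bsub>Sec (sheafify T A P) U\<^esub> s) x = germ T P x V (Res A U V a \<odot>\<^bsub>Sec P V\<^esub> t)"
proof -
  have "germ T P x W (Res A U W a \<odot>\<^bsub>Sec P W\<^esub> b) = germ T P x V (Res A U V a \<odot>\<^bsub>Sec P V\<^esub> t)"
    if "W \<subseteq> U" and b: "(W, b) \<in> germ T P x V t" for W b
  proof -
    note W = mem_germ_eq[OF U(2,3,5) b]
    have "\<forall>\<^sub>F Z in nhd T x. Res P V Z t = Res P W Z b"
      using b U by (auto simp: mem_germ_iff)
    then have "\<forall>\<^sub>F Z in nhd T x. Res P W Z (Res A U W a \<odot>\<^bsub>Sec P W\<^esub> b) = Res P V Z (Res A U V a \<odot>\<^bsub>Sec P V\<^esub> t)"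
      using eventually_nhd_subset[OF U(2,3)] eventually_nhd_subset[OF W(1,2)]
      by eventually_elim (use U W that in \<open>simp add: res_smult A.res_closed A.res_res\<close>)
    then show ?thesis using U W that by (simp add: germ_eq_iff smult_closed A.res_closed)
  qed
  moreover have "(V, t) \<in> germ T P x V t" using U by (auto intro: self_mem_germ)
  ultimately have "\<Union>{germ T P x W (Res A U W a \<odot>\<^bsub>Sec P W\<^esub> b) | W b. W \<subseteq> U \<and> (W, b) \<in> germ T P x V t} =
      germ T P x V (Res A U V a \<odot>\<^bsub>Sec P V\<^esub> t)"
    using U by blast
  then show ?thesis using U s by (auto simp: sheafify_def)
qed

end

section \<open>Equality and gluing in a sheaf from agreement near points\<close>

lemma sheaf_separated:
  assumes N: "is_sheaf T N" and U: "openin T U" "m \<in> carrier (Sec N U)" "n \<in> carrier (Sec N U)"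
    and loc: "\<And>x. x \<in> U \<Longrightarrow> \<forall>\<^sub>F W in nhd T x. Res N U W m = Res N U W n"
  shows "m = n"
proof -
  interpret presheaf T N using N by unfold_locales (simp add: is_sheaf_def)
  \<comment> \<open>The open sets on which \<open>m\<close> and \<open>n\<close> agree cover
    \<open>U\<close>; both sections then glue the same family, and uniqueness in the sheaf axiom
    identifies them.\<close>
  define \<U> where "\<U> = {W. openin T W \<and> W \<subseteq> U \<and> Res N U W m = Res N U W n}"
  have "\<exists>W\<in>\<U>. x \<in> W" if "x \<in> U" for x
    by (rule eventually_nhdE[OF loc[OF that] U(1) that]) (auto simp: \<U>_def)
  then have UN: "\<Union>\<U> = U" by (auto simp: \<U>_def)
  have "\<exists>!t. t \<in> carrier (Sec N (\<Union>\<U>)) \<and> (\<forall>W\<in>\<U>. Res N (\<Union>\<U>) W t = Res N U W m)"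
    using N[unfolded is_sheaf_def, THEN conjunct2, rule_format, of \<U> "\<lambda>W. Res N U W m"] U
    by (auto simp: \<U>_def intro!: res_closed simp: res_res openin_Int)
  then show ?thesis unfolding UN using U by (auto simp: \<U>_def)
qed

text \<open>Agreement is demanded near each point of an overlap only; \<open>sheaf_separated\<close>
  turns this into the equality on the whole overlap that the sheaf axiom wants.\<close>

lemma sheaf_glue:
  assumes N: "is_sheaf T N" and U: "openin T U"
    and \<U>: "\<Union>\<U> = U" "\<And>V. V \<in> \<U> \<Longrightarrow> openin T V" "\<And>V. V \<in> \<U> \<Longrightarrow> s V \<in> carrier (Sec N V)"
    and loc: "\<And>V V' x. \<lbrakk>V \<in> \<U>; V' \<in> \<U>; x \<in> V; x \<in> V'\<rbrakk> \<Longrightarrow> \<forall>\<^sub>F W in nhd T x. Res N V W (s V) = Res N V' W (s V')"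
  obtains n where "n \<in> carrier (Sec N U)" "\<And>V. V \<in> \<U> \<Longrightarrow> Res N U V n = s V"
proof -
  interpret presheaf T N using N by unfold_locales (simp add: is_sheaf_def)
  have "Res N V (V \<inter> V') (s V) = Res N V' (V \<inter> V') (s V')" if V: "V \<in> \<U>" "V' \<in> \<U>" for V V'
  proof (rule sheaf_separated[OF N])
    fix x assume x: "x \<in> V \<inter> V'"
    have "\<forall>\<^sub>F W in nhd T x. Res N V W (s V) = Res N V' W (s V')" using V x loc by blast
    moreover have "\<forall>\<^sub>F W in nhd T x. openin T W \<and> x \<in> W \<and> W \<subseteq> V \<inter> V'"
      by (rule eventually_nhd_subset) (use V \<U> x in auto)
    ultimately show "\<forall>\<^sub>F W in nhd T x. Res N (V \<inter> V') W (Res N V (V \<inter> V') (s V)) =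
        Res N (V \<inter> V') W (Res N V' (V \<inter> V') (s V'))"
      by eventually_elim (use V \<U> in \<open>simp add: res_res openin_Int\<close>)
  qed (use V \<U> in \<open>auto intro!: res_closed simp: openin_Int\<close>)
  then have "\<exists>!t. t \<in> carrier (Sec N (\<Union>\<U>)) \<and> (\<forall>W\<in>\<U>. Res N (\<Union>\<U>) W t = s W)"
    using N[unfolded is_sheaf_def, THEN conjunct2, rule_format, of \<U> s] \<U> by auto
  then obtain t where "t \<in> carrier (Sec N U)" "\<forall>W\<in>\<U>. Res N U W t = s W"
    unfolding \<U>(1) by (elim ex1E conjE)
  then show thesis by (intro that) blast+
qed

section \<open>Homomorphisms and isomorphisms of presheaves of modules\<close>

lemma sheaf_hom_closed:
  "\<lbrakk>sheaf_hom T A M N h; openin T U; m \<in> carrier (Sec M U)\<rbrakk> \<Longrightarrow> h U m \<in> carrier (Sec N U)"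
  unfolding sheaf_hom_def by (drule conjunct1, drule spec[of _ U], drule mp, assumption, elim conjE, erule funcset_mem)

lemma sheaf_hom_add:
  "\<lbrakk>sheaf_hom T A M N h; openin T U; m \<in> carrier (Sec M U); m' \<in> carrier (Sec M U)\<rbrakk> \<Longrightarrow>
    h U (m \<oplus>\<^bsub>Sec M U\<^esub> m') = h U m \<oplus>\<^bsub>Sec N U\<^esub> h U m'"
  unfolding sheaf_hom_def by (elim conjE) metis

lemma sheaf_hom_smult:
  "\<lbrakk>sheaf_hom T A M N h; openin T U; a \<in> carrier (Sec A U); m \<in> carrier (Sec M U)\<rbrakk> \<Longrightarrow>
    h U (a \<odot>\<^bsub>Sec M U\<^esub> m) = a \<odot>\<^bsub>Sec N U\<^esub> h U m"
  unfolding sheaf_hom_def by (elim conjE) metis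

lemma sheaf_hom_res:
  "\<lbrakk>sheaf_hom T A M N h; openin T U; openin T V; V \<subseteq> U; m \<in> carrier (Sec M U)\<rbrakk> \<Longrightarrow>
    Res N U V (h U m) = h V (Res M U V m)"
  unfolding sheaf_hom_def by (elim conjE) metis

lemma sheaf_hom_compose:
  assumes "sheaf_hom T A L M f" "sheaf_hom T A M N g"
  shows "sheaf_hom T A L N (\<lambda>U x. g U (f U x))"
  unfolding sheaf_hom_def
  using assms by (auto simp: sheaf_hom_closed[of T A] sheaf_hom_add[of T A] sheaf_hom_smult[of T A] sheaf_hom_res[of T A])

text \<open>Needed because the map built in \<open>sheafify_isomorphic\<close> runs from the sheaf
  to the sheafification, against the required direction.\<close>

lemma (in module_presheaf) sheaf_isomorphic_sym:
  assumes h: "sheaf_hom T A P N h" and bij: "\<And>U. openin T U \<Longrightarrow> bij_betw (h U) (carrier (Sec P U)) (carrier (Sec N U))"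
  shows "sheaf_isomorphic T A N P"
proof -
  define g where "g = (\<lambda>U. inv_into (carrier (Sec P U)) (h U))"
  have bij': "bij_betw (g U) (carrier (Sec N U)) (carrier (Sec P U))" if "openin T U" for U
    unfolding g_def using bij[OF that] by (rule bij_betw_inv_into)
  have gh: "g U (h U x) = x" if "openin T U" "x \<in> carrier (Sec P U)" for U x
    unfolding g_def using bij_betw_inv_into_left[OF bij] that by blast
  have surj: "\<exists>x\<in>carrier (Sec P U). n = h U x" if "openin T U" "n \<in> carrier (Sec N U)" for U n
    using bij[OF that(1)] that(2) by (auto simp: bij_betw_def)
  have "sheaf_hom T A N P g"
    unfolding sheaf_hom_def
  proof (intro conjI allI impI ballI; (elim conjE)?)
    fix U assume U: "openin T U"
    show "g U \<in> carrier (Sec N U) \<rightarrow> carrier (Sec P U)" using bij'[OF U] by (auto simp: bij_betw_def)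
    show "g U (m \<oplus>\<^bsub>Sec N U\<^esub> n) = g U m \<oplus>\<^bsub>Sec P U\<^esub> g U n"
      if "m \<in> carrier (Sec N U)" "n \<in> carrier (Sec N U)" for m n
      using surj[OF U that(1)] surj[OF U that(2)] U
      by (auto simp: gh add_closed simp flip: sheaf_hom_add[OF h])
    show "g U (a \<odot>\<^bsub>Sec N U\<^esub> n) = a \<odot>\<^bsub>Sec P U\<^esub> g U n"
      if "a \<in> carrier (Sec A U)" "n \<in> carrier (Sec N U)" for a n
      using surj[OF U that(2)] U that(1)
      by (auto simp: gh smult_closed simp flip: sheaf_hom_smult[OF h])
  next
    fix U V n assume "openin T U" "openin T V" "V \<subseteq> U" "n \<in> carrier (Sec N U)"
    then show "Res P U V (g U n) = g V (Res N U V n)"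
      using surj[of U n] by (auto simp: gh sheaf_hom_res[OF h] res_closed)
  qed
  then show ?thesis unfolding sheaf_isomorphic_def using bij' by blast
qed

text \<open>Bijectivity on stalks, said without stalks. Injectivity compares two sections rather
  than one section with zero, since \<open>module_presheaf\<close> offers no subtraction.\<close>

definition locally_bijective ::
    "'a topology \<Rightarrow> ('a, 'b, 'm) mod_presheaf \<Rightarrow> ('a, 'b, 'n) mod_presheaf \<Rightarrow> ('a set \<Rightarrow> 'm \<Rightarrow> 'n) \<Rightarrow> bool" where
  "locally_bijective T P N \<beta> \<longleftrightarrow>
     (\<forall>U x t t'. openin T U \<and> x \<in> U \<and> t \<in> carrier (Sec P U) \<and> t' \<in> carrier (Sec P U) \<and> \<beta> U t = \<beta> U t' \<longrightarrow>
        (\<forall>\<^sub>F W in nhd T x. Res P U W t = Res P U W t')) \<and>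
     (\<forall>U x n. openin T U \<and> x \<in> U \<and> n \<in> carrier (Sec N U) \<longrightarrow>
        (\<forall>\<^sub>F W in nhd T x. Res N U W n \<in> \<beta> W ` carrier (Sec P W)))"

lemma
  assumes "locally_bijective T P N \<beta>" "openin T U" "x \<in> U"
  shows locally_bijective_inj: "\<lbrakk>t \<in> carrier (Sec P U); t' \<in> carrier (Sec P U); \<beta> U t = \<beta> U t'\<rbrakk> \<Longrightarrow>
      \<forall>\<^sub>F W in nhd T x. Res P U W t = Res P U W t'"
    and locally_bijective_surj: "n \<in> carrier (Sec N U) \<Longrightarrow>
      \<forall>\<^sub>F W in nhd T x. Res N U W n \<in> \<beta> W ` carrier (Sec P W)"
  using assms unfolding locally_bijective_def by auto

context module_presheaf
begin

lemma sheafify_carrierI: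
  assumes "s \<in> extensional U"
    "\<And>x. x \<in> U \<Longrightarrow> \<exists>V t. openin T V \<and> x \<in> V \<and> V \<subseteq> U \<and> t \<in> carrier (Sec P V) \<and> (\<forall>y\<in>V. s y = germ T P y V t)"
  shows "s \<in> carrier (Sec (sheafify T A P) U)"
proof -
  have "s x \<in> germs T P x" if "x \<in> U" for x
    using assms(2)[OF that] unfolding germs_def by blast
  then show ?thesis using assms by (auto simp: sheafify_def PiE_def)
qed

lemma sheafify_carrierE:
  assumes "s \<in> carrier (Sec (sheafify T A P) U)" "x \<in> U"
  obtains V t where "openin T V" "x \<in> V" "V \<subseteq> U" "t \<in> carrier (Sec P V)" "\<And>y. y \<in> V \<Longrightarrow> s y = germ T P y V t"
  using assms by (auto simp: sheafify_def)

lemma sheafify_extensional: "s \<in> carrier (Sec (sheafify T A P) U) \<Longrightarrow> s \<in> extensional U"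
  by (auto simp: sheafify_def PiE_def)

lemma sheafify_op_extensional:
  "s \<oplus>\<^bsub>Sec (sheafify T A P) U\<^esub> s' \<in> extensional U" "a \<odot>\<^bsub>Sec (sheafify T A P) U\<^esub> s \<in> extensional U"
  by (auto simp: sheafify_def)

lemma sheafify_res: "Res (sheafify T A P) U V s = restrict s V"
  by (simp add: sheafify_def)

text \<open>A map out of the sheafification would have to be defined by gluing. The inverse has a
  closed formula: \<open>k U n\<close> sends \<open>x\<close> to the set of all pairs whose image
  under \<beta> has the germ of \<open>n\<close> at \<open>x\<close>.\<close>

lemma sheafify_isomorphic:
  assumes N: "module_presheaf T A N" "is_sheaf T N" and \<beta>: "sheaf_hom T A P N \<beta>" "locally_bijective T P N \<beta>"
  shows "sheaf_isomorphic T A (sheafify T A P) N"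
proof -
  interpret N: module_presheaf T A N by fact
  define k where "k U n = (\<lambda>x\<in>U. {(V, t). openin T V \<and> x \<in> V \<and> t \<in> carrier (Sec P V) \<and>
    (\<forall>\<^sub>F W in nhd T x. Res N V W (\<beta> V t) = Res N U W n)})" for U n
  \<comment> \<open>Local injectivity of \<beta> enters here: all preimages of one germ of
    \<open>N\<close> have the same germ, so the set defining \<open>k\<close> is a single germ of
    \<open>P\<close>.\<close>
  have k_germ: "k U n y = germ T P y V t"
    if V: "openin T U" "openin T V" "V \<subseteq> U" "t \<in> carrier (Sec P V)" "n \<in> carrier (Sec N U)"
      "\<beta> V t = Res N U V n" "y \<in> V" for U V n t y
  proof -
    have "(\<forall>\<^sub>F W in nhd T y. Res N V' W (\<beta> V' t') = Res N U W n) \<longleftrightarrow>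
        (\<forall>\<^sub>F W in nhd T y. Res P V W t = Res P V' W t')" (is "?L \<longleftrightarrow> ?R")
      if V': "openin T V'" "y \<in> V'" "t' \<in> carrier (Sec P V')" for V' t'
    proof -
      have VV': "openin T (V \<inter> V')" "y \<in> V \<inter> V'" using V V' by auto
      have "Res N V W (\<beta> V t) = Res N U W n" if "openin T W" "W \<subseteq> V" for W
        using that V by (simp add: N.res_res)
      then have "?L \<longleftrightarrow> (\<forall>\<^sub>F W in nhd T y. \<beta> W (Res P V W t) = \<beta> W (Res P V' W t'))"
        using V V' by (intro eventually_cong[OF eventually_nhd_subset[OF VV']])
          (auto simp flip: sheaf_hom_res[OF \<beta>(1)])
      also have "\<dots> \<longleftrightarrow> ?R"
      proof
        assume "\<forall>\<^sub>F W in nhd T y. \<beta> W (Res P V W t) = \<beta> W (Res P V' W t')"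
        then obtain W where W: "openin T W" "y \<in> W" "W \<subseteq> V \<inter> V'" "\<beta> W (Res P V W t) = \<beta> W (Res P V' W t')"
          by (rule eventually_nhdE[OF _ VV'])
        then have "\<forall>\<^sub>F Z in nhd T y. Res P W Z (Res P V W t) = Res P W Z (Res P V' W t')"
          using V V' by (intro locally_bijective_inj[OF \<beta>(2)]) (auto intro: res_closed)
        then show ?R using eventually_nhd_subset[OF W(1,2)]
          by eventually_elim (use V V' W in \<open>simp add: res_res\<close>)
      qed (auto elim: eventually_mono)
      finally show ?thesis .
    qed
    then show ?thesis using V by (auto simp: k_def mem_germ_iff)
  qed
  have loc: "\<exists>V t. openin T V \<and> x \<in> V \<and> V \<subseteq> U \<and> t \<in> carrier (Sec P V) \<and> \<beta> V t = Res N U V n"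
    if "openin T U" "x \<in> U" "n \<in> carrier (Sec N U)" for U x n
    by (rule eventually_nhdE[OF locally_bijective_surj[OF \<beta>(2) that] that(1,2)]) (metis imageE)
  have k_carrier: "k U n \<in> carrier (Sec (sheafify T A P) U)"
    if "openin T U" "n \<in> carrier (Sec N U)" for U n
  proof (rule sheafify_carrierI)
    show "k U n \<in> extensional U" by (simp add: k_def)
    fix x assume "x \<in> U"
    from loc[OF that(1) this that(2)] show "\<exists>V t. openin T V \<and> x \<in> V \<and> V \<subseteq> U \<and> t \<in> carrier (Sec P V) \<and>
        (\<forall>y\<in>V. k U n y = germ T P y V t)"
      using k_germ that by metis
  qed
  have hom: "sheaf_hom T A N (sheafify T A P) k"
    unfolding sheaf_hom_def
  proof (intro conjI allI impI ballI; (elim conjE)?)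
    fix U assume U: "openin T U"
    show "k U \<in> carrier (Sec N U) \<rightarrow> carrier (Sec (sheafify T A P) U)" using k_carrier[OF U] by auto
    show "k U (m \<oplus>\<^bsub>Sec N U\<^esub> n) = k U m \<oplus>\<^bsub>Sec (sheafify T A P) U\<^esub> k U n"
      if mn: "m \<in> carrier (Sec N U)" "n \<in> carrier (Sec N U)" for m n
    proof (rule extensionalityI[where A=U])
      fix x assume x: "x \<in> U"
      obtain V t where V: "openin T V" "x \<in> V" "V \<subseteq> U" "t \<in> carrier (Sec P V)" "\<beta> V t = Res N U V m"
        using loc[OF U x mn(1)] by blast
      obtain V' t' where V': "openin T V'" "x \<in> V'" "V' \<subseteq> U" "t' \<in> carrier (Sec P V')" "\<beta> V' t' = Res N U V' n"
        using loc[OF U x mn(2)] by blast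
      define W where "W = V \<inter> V'"
      define b b' where "b = Res P V W t" and "b' = Res P V' W t'"
      have W: "openin T W" "x \<in> W" "W \<subseteq> U" "W \<subseteq> V" "W \<subseteq> V'" using V V' by (auto simp: W_def)
      have b: "b \<in> carrier (Sec P W)" "b' \<in> carrier (Sec P W)"
        using V V' W by (auto simp: b_def b'_def intro: res_closed)
      have \<beta>b: "\<beta> W b = Res N U W m" "\<beta> W b' = Res N U W n"
        using V V' W U mn by (auto simp: b_def b'_def N.res_res simp flip: sheaf_hom_res[OF \<beta>(1)])
      have "\<beta> W (b \<oplus>\<^bsub>Sec P W\<^esub> b') = Res N U W (m \<oplus>\<^bsub>Sec N U\<^esub> n)"
        using W U b mn by (simp add: sheaf_hom_add[OF \<beta>(1)] \<beta>b N.res_add)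
      then have "k U (m \<oplus>\<^bsub>Sec N U\<^esub> n) x = germ T P x W (b \<oplus>\<^bsub>Sec P W\<^esub> b')"
        using W U b mn by (intro k_germ) (auto simp: N.add_closed add_closed)
      also have "\<dots> = (k U m \<oplus>\<^bsub>Sec (sheafify T A P) U\<^esub> k U n) x"
        by (rule sheafify_add_germ[where s="k U m" and s'="k U n" and x=x, OF U W(1-3) b k_germ[OF U W(1,3) b(1) mn(1) \<beta>b(1) W(2)]
              k_germ[OF U W(1,3) b(2) mn(2) \<beta>b(2) W(2)], symmetric])
      finally show "k U (m \<oplus>\<^bsub>Sec N U\<^esub> n) x = (k U m \<oplus>\<^bsub>Sec (sheafify T A P) U\<^esub> k U n) x" .
    qed (simp_all add: sheafify_op_extensional k_def)
    show "k U (a \<odot>\<^bsub>Sec N U\<^esub> n) = a \<odot>\<^bsub>Sec (sheafify T A P) U\<^esub> k U n"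
      if an: "a \<in> carrier (Sec A U)" "n \<in> carrier (Sec N U)" for a n
    proof (rule extensionalityI[where A=U])
      fix x assume x: "x \<in> U"
      obtain V t where V: "openin T V" "x \<in> V" "V \<subseteq> U" "t \<in> carrier (Sec P V)" "\<beta> V t = Res N U V n"
        using loc[OF U x an(2)] by blast
      have aV: "Res A U V a \<in> carrier (Sec A V)" using A.res_closed U V an by blast
      have "\<beta> V (Res A U V a \<odot>\<^bsub>Sec P V\<^esub> t) = Res N U V (a \<odot>\<^bsub>Sec N U\<^esub> n)"
        using V U an aV by (simp add: sheaf_hom_smult[OF \<beta>(1)] N.res_smult)
      then have "k U (a \<odot>\<^bsub>Sec N U\<^esub> n) x = germ T P x V (Res A U V a \<odot>\<^bsub>Sec P V\<^esub> t)"
        using V U an aV by (intro k_germ) (auto simp: N.smult_closed smult_closed)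
      also have "\<dots> = (a \<odot>\<^bsub>Sec (sheafify T A P) U\<^esub> k U n) x"
        by (rule sheafify_smult_germ[where s="k U n" and x=x, OF U V(1,2,3,4) an(1)
              k_germ[OF U V(1,3,4) an(2) V(5,2)], symmetric])
      finally show "k U (a \<odot>\<^bsub>Sec N U\<^esub> n) x = (a \<odot>\<^bsub>Sec (sheafify T A P) U\<^esub> k U n) x" .
    qed (simp_all add: sheafify_op_extensional k_def)
  next
    fix U V n assume U: "openin T U" "openin T V" "V \<subseteq> U" "n \<in> carrier (Sec N U)"
    have "(\<forall>\<^sub>F W in nhd T x. Res N V' W t = Res N U W n) \<longleftrightarrow>
        (\<forall>\<^sub>F W in nhd T x. Res N V' W t = Res N V W (Res N U V n))" if "x \<in> V" for x V' t
      by (rule eventually_cong[OF eventually_nhd_subset[OF U(2) that]]) (use U in \<open>simp add: N.res_res\<close>)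
    then show "Res (sheafify T A P) U V (k U n) = k V (Res N U V n)"
      using U by (intro extensionalityI[where A=V]) (auto simp: sheafify_res k_def)
  qed
  have bij: "bij_betw (k U) (carrier (Sec N U)) (carrier (Sec (sheafify T A P) U))" if U: "openin T U" for U
    unfolding bij_betw_def
  proof (intro conjI inj_onI equalityI subsetI)
    fix m n assume mn: "m \<in> carrier (Sec N U)" "n \<in> carrier (Sec N U)" and k: "k U m = k U n"
    show "m = n"
    proof (rule sheaf_separated[OF N(2) U mn])
      fix x assume x: "x \<in> U"
      obtain V t where V: "openin T V" "x \<in> V" "V \<subseteq> U" "t \<in> carrier (Sec P V)" "\<beta> V t = Res N U V m"
        using loc[OF U x mn(1)] by blast
      \<comment> \<open>A local preimage of \<open>m\<close> represents \<open>k U m x\<close> and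
        thus lies in \<open>k U n x\<close>; its image under \<beta> therefore agrees near
        \<open>x\<close> with both sections.\<close>
      have "(V, t) \<in> k U m x" using V U mn self_mem_germ[OF V(1,2,4)] k_germ[OF U V(1,3,4) mn(1) V(5,2)] by simp
      then have "(V, t) \<in> k U n x" by (simp add: k)
      then have "\<forall>\<^sub>F W in nhd T x. Res N V W (\<beta> V t) = Res N U W n" using x by (simp add: k_def)
      then show "\<forall>\<^sub>F W in nhd T x. Res N U W m = Res N U W n"
        using eventually_nhd_subset[OF V(1,2)] by eventually_elim (use V U mn in \<open>simp add: N.res_res\<close>)
    qed
  next
    fix s assume s: "s \<in> carrier (Sec (sheafify T A P) U)"
    \<comment> \<open>Surjectivity: on each open set where \<open>s\<close> is given by one section
      of \<open>P\<close>, such a section \<tau> is chosen. Different choices have equal germs, so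
      their images under \<beta> agree near every point and glue to the preimage
      \<open>n\<close>.\<close>
    define Q where "Q V t \<longleftrightarrow> t \<in> carrier (Sec P V) \<and> (\<forall>y\<in>V. s y = germ T P y V t)" for V t
    define \<U> where "\<U> = {V. openin T V \<and> V \<subseteq> U \<and> (\<exists>t. Q V t)}"
    define \<tau> where "\<tau> V = (SOME t. Q V t)" for V
    have \<tau>: "\<tau> V \<in> carrier (Sec P V)" "\<And>y. y \<in> V \<Longrightarrow> s y = germ T P y V (\<tau> V)" if "V \<in> \<U>" for V
      using someI_ex[of "Q V"] that by (auto simp: \<U>_def \<tau>_def Q_def)
    have cover: "\<exists>V\<in>\<U>. x \<in> V" if "x \<in> U" for x
      by (rule sheafify_carrierE[OF s that]) (unfold \<U>_def Q_def, blast)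
    have op: "openin T V" "V \<subseteq> U" if "V \<in> \<U>" for V using that by (auto simp: \<U>_def)
    obtain n where n: "n \<in> carrier (Sec N U)" "\<And>V. V \<in> \<U> \<Longrightarrow> Res N U V n = \<beta> V (\<tau> V)"
    proof (rule sheaf_glue[OF N(2) U, of \<U> "\<lambda>V. \<beta> V (\<tau> V)"])
      show "\<Union>\<U> = U" using cover op by blast
      show "openin T V" if "V \<in> \<U>" for V using op that by blast
      show "\<beta> V (\<tau> V) \<in> carrier (Sec N V)" if "V \<in> \<U>" for V
        using \<tau> op that by (auto intro: sheaf_hom_closed[OF \<beta>(1)])
      fix V V' x assume V: "V \<in> \<U>" "V' \<in> \<U>" "x \<in> V" "x \<in> V'"
      then have "germ T P x V (\<tau> V) = germ T P x V' (\<tau> V')" using \<tau> by metis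
      then have "\<forall>\<^sub>F W in nhd T x. Res P V W (\<tau> V) = Res P V' W (\<tau> V')"
        using V \<tau> op by (simp add: germ_eq_iff)
      then show "\<forall>\<^sub>F W in nhd T x. Res N V W (\<beta> V (\<tau> V)) = Res N V' W (\<beta> V' (\<tau> V'))"
        using eventually_nhd_subset[OF op(1)[OF V(1)] V(3)] eventually_nhd_subset[OF op(1)[OF V(2)] V(4)]
        by eventually_elim (use V \<tau> op in \<open>simp add: sheaf_hom_res[OF \<beta>(1)]\<close>)
    qed blast
    have "k U n = s"
    proof (rule extensionalityI[where A=U])
      show "s \<in> extensional U" using s by (rule sheafify_extensional)
      fix x assume "x \<in> U"
      then obtain V where V: "V \<in> \<U>" "x \<in> V" using cover by blast
      then show "k U n x = s x" using \<tau> op n U by (simp add: k_germ)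
    qed (simp add: k_def)
    then show "s \<in> k U ` carrier (Sec N U)" using n by blast
  qed (use k_carrier U in auto)
  show ?thesis by (rule N.sheaf_isomorphic_sym[OF hom bij])
qed

text \<open>The isomorphism is composed with the canonical map \<gamma> into the sheafification.
  Equal values of \<gamma> mean equal germs, and every section of the sheafification is locally a
  value of \<gamma>.\<close>

lemma sheafify_isomorphicD:
  assumes "sheaf_isomorphic T A (sheafify T A P) N"
  obtains \<beta> where "sheaf_hom T A P N \<beta>" "locally_bijective T P N \<beta>"
proof -
  obtain h where h: "sheaf_hom T A (sheafify T A P) N h"
    and bij: "\<And>U. openin T U \<Longrightarrow> bij_betw (h U) (carrier (Sec (sheafify T A P) U)) (carrier (Sec N U))"
    using assms unfolding sheaf_isomorphic_def by blast
  define \<gamma> where "\<gamma> U t = (\<lambda>y\<in>U. germ T P y U t)" for U t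
  have \<gamma>_carrier: "\<gamma> U t \<in> carrier (Sec (sheafify T A P) U)" if "openin T U" "t \<in> carrier (Sec P U)" for U t
    using that by (intro sheafify_carrierI) (auto simp: \<gamma>_def)
  have \<gamma>: "sheaf_hom T A P (sheafify T A P) \<gamma>"
    unfolding sheaf_hom_def
  proof (intro conjI allI impI ballI; (elim conjE)?)
    fix U assume U: "openin T U"
    show "\<gamma> U \<in> carrier (Sec P U) \<rightarrow> carrier (Sec (sheafify T A P) U)" using \<gamma>_carrier[OF U] by auto
    show "\<gamma> U (t \<oplus>\<^bsub>Sec P U\<^esub> t') = \<gamma> U t \<oplus>\<^bsub>Sec (sheafify T A P) U\<^esub> \<gamma> U t'"
      if "t \<in> carrier (Sec P U)" "t' \<in> carrier (Sec P U)" for t t'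
    proof (rule extensionalityI[where A=U])
      fix x assume "x \<in> U"
      then show "\<gamma> U (t \<oplus>\<^bsub>Sec P U\<^esub> t') x = (\<gamma> U t \<oplus>\<^bsub>Sec (sheafify T A P) U\<^esub> \<gamma> U t') x"
        using U that by (subst sheafify_add_germ[of U U x t t']) (auto simp: \<gamma>_def)
    qed (simp_all add: sheafify_op_extensional \<gamma>_def)
    show "\<gamma> U (a \<odot>\<^bsub>Sec P U\<^esub> t) = a \<odot>\<^bsub>Sec (sheafify T A P) U\<^esub> \<gamma> U t"
      if "a \<in> carrier (Sec A U)" "t \<in> carrier (Sec P U)" for a t
    proof (rule extensionalityI[where A=U])
      fix x assume "x \<in> U"
      then show "\<gamma> U (a \<odot>\<^bsub>Sec P U\<^esub> t) x = (a \<odot>\<^bsub>Sec (sheafify T A P) U\<^esub> \<gamma> U t) x"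
        using U that by (subst sheafify_smult_germ[of U U x t a]) (auto simp: \<gamma>_def A.res_id)
    qed (simp_all add: sheafify_op_extensional \<gamma>_def)
  next
    fix U V t assume "openin T U" "openin T V" "V \<subseteq> U" "t \<in> carrier (Sec P U)"
    then show "Res (sheafify T A P) U V (\<gamma> U t) = \<gamma> V (Res P U V t)"
      by (intro extensionalityI[where A=V]) (auto simp: sheafify_res \<gamma>_def germ_res)
  qed
  show thesis
  proof (rule that[OF sheaf_hom_compose[OF \<gamma> h]])
    show "locally_bijective T P N (\<lambda>U t. h U (\<gamma> U t))"
      unfolding locally_bijective_def
    proof (intro conjI allI impI; elim conjE)
      fix U x t t'
      assume U: "openin T U" "x \<in> U" "t \<in> carrier (Sec P U)" "t' \<in> carrier (Sec P U)" "h U (\<gamma> U t) = h U (\<gamma> U t')"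
      then have "\<gamma> U t = \<gamma> U t'"
        using bij[OF U(1)] \<gamma>_carrier by (auto simp: bij_betw_def dest: inj_onD)
      then have "\<gamma> U t x = \<gamma> U t' x" by simp
      then show "\<forall>\<^sub>F W in nhd T x. Res P U W t = Res P U W t'"
        using U by (simp add: \<gamma>_def germ_eq_iff)
    next
      fix U x n assume U: "openin T U" "x \<in> U" "n \<in> carrier (Sec N U)"
      then obtain s where s: "s \<in> carrier (Sec (sheafify T A P) U)" "n = h U s"
        using bij[OF U(1)] by (auto simp: bij_betw_def)
      obtain V t where V: "openin T V" "x \<in> V" "V \<subseteq> U" "t \<in> carrier (Sec P V)" "\<And>y. y \<in> V \<Longrightarrow> s y = germ T P y V t"
        using sheafify_carrierE[OF s(1) U(2)] by blast
      show "\<forall>\<^sub>F W in nhd T x. Res N U W n \<in> (\<lambda>t. h W (\<gamma> W t)) ` carrier (Sec P W)"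
      proof (rule eventually_nhdI[OF V(1,2)])
        fix W assume W: "openin T W" "x \<in> W" "W \<subseteq> V"
        have "restrict s W = \<gamma> W (Res P V W t)"
          using V W by (intro extensionalityI[where A=W]) (auto simp: \<gamma>_def germ_res)
        then have "Res N U W n = h W (\<gamma> W (Res P V W t))"
          using s U V W by (simp add: sheaf_hom_res[OF h] sheafify_res)
        then show "Res N U W n \<in> (\<lambda>t. h W (\<gamma> W t)) ` carrier (Sec P W)" using V W res_closed by blast
      qed
    qed
  qed
qed

end

section \<open>The Auslander sheaf\<close>

lemma module_presheaf_of_sheaf:
  assumes "sheaf_of_left_modules T A N" "is_presheaf T A"
  shows "module_presheaf T A N"
proof
  show "is_presheaf T N" using assms(1) by (simp add: sheaf_of_left_modules_def is_sheaf_def)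
  show "is_presheaf T A" by fact
  fix U s t assume U: "openin T U" "s \<in> carrier (Sec N U)"
  interpret left_module "Sec A U" "Sec N U" using assms U by (simp add: sheaf_of_left_modules_def)
  show "s \<oplus>\<^bsub>Sec N U\<^esub> t \<in> carrier (Sec N U)" if "t \<in> carrier (Sec N U)" using U that by simp
  show "a \<odot>\<^bsub>Sec N U\<^esub> s \<in> carrier (Sec N U)" if "a \<in> carrier (Sec A U)" for a
    using U that by (simp add: smult_closed)
qed (use assms in \<open>simp_all add: sheaf_of_left_modules_def\<close>)

locale locally_ringed =
  fixes X :: "('a, 'r) ringed_space"
  assumes locally_ringed: "locally_ringed_space X"
begin

abbreviation "T \<equiv> Space X"
abbreviation "\<O> \<equiv> Struct X"
abbreviation "\<F> \<equiv> F_sheaf X"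
abbreviation "\<A> \<equiv> Auslander_sheaf X"
abbreviation "\<iota> \<equiv> Auslander_scalar X"

section \<open>Germs of the structure sheaf, the ideal of the singular locus and \<F>\<close>

lemma cring_sections: "openin T U \<Longrightarrow> cring (Sec \<O> U)"
  using locally_ringed by (simp add: locally_ringed_space_def)

lemma res_ring_hom: "\<lbrakk>openin T U; openin T V; V \<subseteq> U\<rbrakk> \<Longrightarrow> Res \<O> U V \<in> ring_hom (Sec \<O> U) (Sec \<O> V)"
  using locally_ringed by (simp add: locally_ringed_space_def sheaf_of_rings_def)

sublocale \<O>: presheaf T \<O>
  by unfold_locales (use locally_ringed in \<open>simp add: locally_ringed_space_def sheaf_of_rings_def is_sheaf_def\<close>)

lemma ideal_max_ideal: "x \<in> topspace T \<Longrightarrow> ideal (max_ideal (Loc X x)) (Loc X x)"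
  using locally_ringed theI'[of "\<lambda>m. maximalideal m (Loc X x)"]
  by (auto simp: locally_ringed_space_def local_ring_def max_ideal_def intro: maximalideal.axioms(1))

lemma germ_add:
  assumes "openin T U" "x \<in> U" "s \<in> carrier (Sec \<O> U)" "t \<in> carrier (Sec \<O> U)"
  shows "germ T \<O> x U (s \<oplus>\<^bsub>Sec \<O> U\<^esub> t) = germ T \<O> x U s \<oplus>\<^bsub>Loc X x\<^esub> germ T \<O> x U t"
proof -
  have "a \<oplus>\<^bsub>Sec \<O> W\<^esub> b \<in> carrier (Sec \<O> W)"
    if "openin T W" "a \<in> carrier (Sec \<O> W)" "b \<in> carrier (Sec \<O> W)" for W a b
  proof -
    interpret cring "Sec \<O> W" using that cring_sections by blast
    show ?thesis using that by simp
  qed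
  then show ?thesis
    using \<O>.germ_union_binop[of "\<lambda>V. ring.add (Sec \<O> V)" U x s t] assms
    by (simp add: stalk_def ring_hom_add[OF res_ring_hom])
qed

lemma germ_mult:
  assumes "openin T U" "x \<in> U" "s \<in> carrier (Sec \<O> U)" "t \<in> carrier (Sec \<O> U)"
  shows "germ T \<O> x U (s \<otimes>\<^bsub>Sec \<O> U\<^esub> t) = germ T \<O> x U s \<otimes>\<^bsub>Loc X x\<^esub> germ T \<O> x U t"
proof -
  have "a \<otimes>\<^bsub>Sec \<O> W\<^esub> b \<in> carrier (Sec \<O> W)"
    if "openin T W" "a \<in> carrier (Sec \<O> W)" "b \<in> carrier (Sec \<O> W)" for W a b
  proof -
    interpret cring "Sec \<O> W" using that cring_sections by blast
    show ?thesis using that by simp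
  qed
  then show ?thesis
    using \<O>.germ_union_binop[of "\<lambda>V. monoid.mult (Sec \<O> V)" U x s t] assms
    by (simp add: stalk_def ring_hom_mult[OF res_ring_hom])
qed

lemma germ_carrier:
  "\<lbrakk>openin T U; x \<in> U; s \<in> carrier (Sec \<O> U)\<rbrakk> \<Longrightarrow> germ T \<O> x U s \<in> carrier (Loc X x)"
  by (auto simp: stalk_def germs_def)

lemma singular_ideal_subset: "s \<in> singular_ideal X U \<Longrightarrow> s \<in> carrier (Sec \<O> U)"
  by (simp add: singular_ideal_def)

lemma singular_ideal_add:
  assumes "openin T U" "s \<in> singular_ideal X U" "t \<in> singular_ideal X U"
  shows "s \<oplus>\<^bsub>Sec \<O> U\<^esub> t \<in> singular_ideal X U"
proof -
  interpret cring "Sec \<O> U" using assms cring_sections by blast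
  have "germ T \<O> x U (s \<oplus>\<^bsub>Sec \<O> U\<^esub> t) \<in> max_ideal (Loc X x)" if x: "x \<in> U" "x \<in> singular_points X" for x
  proof -
    interpret m: ideal "max_ideal (Loc X x)" "Loc X x"
      using x by (intro ideal_max_ideal) (simp add: singular_points_def)
    show ?thesis using assms x by (simp add: germ_add singular_ideal_def)
  qed
  then show ?thesis using assms by (auto simp: singular_ideal_def)
qed

lemma singular_ideal_mult:
  assumes "openin T U" "r \<in> carrier (Sec \<O> U)" "s \<in> singular_ideal X U"
  shows "r \<otimes>\<^bsub>Sec \<O> U\<^esub> s \<in> singular_ideal X U"
proof -
  interpret cring "Sec \<O> U" using assms cring_sections by blast
  have "germ T \<O> x U (r \<otimes>\<^bsub>Sec \<O> U\<^esub> s) \<in> max_ideal (Loc X x)" if x: "x \<in> U" "x \<in> singular_points X" for x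
  proof -
    interpret m: ideal "max_ideal (Loc X x)" "Loc X x"
      using x by (intro ideal_max_ideal) (simp add: singular_points_def)
    show ?thesis using assms x by (simp add: germ_mult singular_ideal_def m.I_l_closed germ_carrier)
  qed
  then show ?thesis using assms by (auto simp: singular_ideal_def)
qed

lemma singular_ideal_zero:
  assumes "openin T U"
  shows "\<zero>\<^bsub>Sec \<O> U\<^esub> \<in> singular_ideal X U"
proof -
  interpret cring "Sec \<O> U" using assms cring_sections by blast
  have "germ T \<O> x U \<zero>\<^bsub>Sec \<O> U\<^esub> \<in> max_ideal (Loc X x)" if x: "x \<in> U" "x \<in> singular_points X" for x
  proof -
    interpret m: ideal "max_ideal (Loc X x)" "Loc X x"
      using x by (intro ideal_max_ideal) (simp add: singular_points_def)
    interpret top: cring "Sec \<O> (topspace T)" using cring_sections by blast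
    \<comment> \<open>The zero of the stalk is by definition the germ of the global zero, so the
      zero over \<open>U\<close> is first recognized as its restriction.\<close>
    have "Res \<O> (topspace T) U \<zero>\<^bsub>Sec \<O> (topspace T)\<^esub> = \<zero>\<^bsub>Sec \<O> U\<^esub>"
      by (rule ring_hom_zero[OF res_ring_hom]) (use assms openin_subset in \<open>auto intro: top.ring_axioms ring_axioms\<close>)
    then have "germ T \<O> x U \<zero>\<^bsub>Sec \<O> U\<^esub> = \<zero>\<^bsub>Loc X x\<^esub>"
      using \<O>.germ_res[of "topspace T" U x "\<zero>\<^bsub>Sec \<O> (topspace T)\<^esub>"] assms x openin_subset[OF assms]
      by (simp add: stalk_def)
    then show ?thesis using additive_subgroup.zero_closed[OF m.is_additive_subgroup] by simp
  qed
  then show ?thesis using assms by (auto simp: singular_ideal_def)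
qed

lemma singular_ideal_res:
  assumes "openin T U" "openin T V" "V \<subseteq> U" "s \<in> singular_ideal X U"
  shows "Res \<O> U V s \<in> singular_ideal X V"
  using assms by (auto simp: singular_ideal_def \<O>.res_closed \<O>.germ_res)

lemma F_carrier: "carrier (Sec \<F> U) = singular_ideal X U \<times> carrier (Sec \<O> U)"
  by (simp add: F_sheaf_def Let_def)

lemma F_add: "f \<oplus>\<^bsub>Sec \<F> U\<^esub> g = (fst f \<oplus>\<^bsub>Sec \<O> U\<^esub> fst g, snd f \<oplus>\<^bsub>Sec \<O> U\<^esub> snd g)"
  by (simp add: F_sheaf_def Let_def split_beta)

lemma F_smult: "r \<odot>\<^bsub>Sec \<F> U\<^esub> f = (r \<otimes>\<^bsub>Sec \<O> U\<^esub> fst f, r \<otimes>\<^bsub>Sec \<O> U\<^esub> snd f)"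
  by (simp add: F_sheaf_def Let_def split_beta)

lemma F_res: "Res \<F> U V f = (Res \<O> U V (fst f), Res \<O> U V (snd f))"
  by (simp add: F_sheaf_def split_beta)

lemma F_presheaf: "is_presheaf T \<F>"
  unfolding is_presheaf_def
  by (auto simp: F_carrier F_res singular_ideal_res singular_ideal_subset \<O>.res_closed \<O>.res_id \<O>.res_res)

sublocale \<F>: module_presheaf T \<O> \<F>
proof
  show "is_presheaf T \<F>" by (rule F_presheaf)
  fix U f g assume U: "openin T U" "f \<in> carrier (Sec \<F> U)"
  interpret cring "Sec \<O> U" using U cring_sections by blast
  show "f \<oplus>\<^bsub>Sec \<F> U\<^esub> g \<in> carrier (Sec \<F> U)" if "g \<in> carrier (Sec \<F> U)"
    using U that by (auto simp: F_carrier F_add singular_ideal_add)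
  show "r \<odot>\<^bsub>Sec \<F> U\<^esub> f \<in> carrier (Sec \<F> U)" if "r \<in> carrier (Sec \<O> U)" for r
    using U that by (auto simp: F_carrier F_smult singular_ideal_mult)
  show "Res \<F> U V (f \<oplus>\<^bsub>Sec \<F> U\<^esub> g) = Res \<F> U V f \<oplus>\<^bsub>Sec \<F> V\<^esub> Res \<F> U V g"
    if "openin T V" "V \<subseteq> U" "g \<in> carrier (Sec \<F> U)" for V
    using U that by (auto simp: F_carrier F_add F_res singular_ideal_subset ring_hom_add[OF res_ring_hom])
  show "Res \<F> U V (r \<odot>\<^bsub>Sec \<F> U\<^esub> f) = Res \<O> U V r \<odot>\<^bsub>Sec \<F> V\<^esub> Res \<F> U V f"
    if "openin T V" "V \<subseteq> U" "r \<in> carrier (Sec \<O> U)" for V r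
    using U that by (auto simp: F_carrier F_smult F_res singular_ideal_subset ring_hom_mult[OF res_ring_hom])
qed

text \<open>The generator of the summand \<O> of \<F>. An endomorphism is determined on that summand
  by the image of this section.\<close>

definition unit_section :: "'a set \<Rightarrow> 'r \<times> 'r" where
  "unit_section U = (\<zero>\<^bsub>Sec \<O> U\<^esub>, \<one>\<^bsub>Sec \<O> U\<^esub>)"

lemma unit_section_carrier: "openin T U \<Longrightarrow> unit_section U \<in> carrier (Sec \<F> U)"
  using cring.cring_simprules(6)[OF cring_sections[of U]]
  by (simp add: unit_section_def F_carrier singular_ideal_zero)

lemma snd_carrier: "f \<in> carrier (Sec \<F> U) \<Longrightarrow> snd f \<in> carrier (Sec \<O> U)"
  by (auto simp: F_carrier)

lemma snd_unit_section: "snd (unit_section U) = \<one>\<^bsub>Sec \<O> U\<^esub>"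
  by (simp add: unit_section_def)

lemma unit_section_res:
  assumes "openin T U" "openin T V" "V \<subseteq> U"
  shows "Res \<F> U V (unit_section U) = unit_section V"
  using ring_hom_zero[OF res_ring_hom[OF assms]] ring_hom_one[OF res_ring_hom[OF assms]]
    cring.axioms(1)[OF cring_sections[OF assms(1)]] cring.axioms(1)[OF cring_sections[OF assms(2)]]
  by (simp add: unit_section_def F_res)

lemma
  assumes "openin T U" "f \<in> carrier (Sec \<F> U)"
  shows F_smult_one: "\<one>\<^bsub>Sec \<O> U\<^esub> \<odot>\<^bsub>Sec \<F> U\<^esub> f = f"
    and F_smult_assoc: "\<lbrakk>r \<in> carrier (Sec \<O> U); s \<in> carrier (Sec \<O> U)\<rbrakk> \<Longrightarrow>
      (r \<otimes>\<^bsub>Sec \<O> U\<^esub> s) \<odot>\<^bsub>Sec \<F> U\<^esub> f = r \<odot>\<^bsub>Sec \<F> U\<^esub> (s \<odot>\<^bsub>Sec \<F> U\<^esub> f)"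
    and F_smult_l_distr: "\<lbrakk>r \<in> carrier (Sec \<O> U); s \<in> carrier (Sec \<O> U)\<rbrakk> \<Longrightarrow>
      (r \<oplus>\<^bsub>Sec \<O> U\<^esub> s) \<odot>\<^bsub>Sec \<F> U\<^esub> f = r \<odot>\<^bsub>Sec \<F> U\<^esub> f \<oplus>\<^bsub>Sec \<F> U\<^esub> s \<odot>\<^bsub>Sec \<F> U\<^esub> f"
    and F_smult_r_distr: "\<lbrakk>r \<in> carrier (Sec \<O> U); g \<in> carrier (Sec \<F> U)\<rbrakk> \<Longrightarrow>
      r \<odot>\<^bsub>Sec \<F> U\<^esub> (f \<oplus>\<^bsub>Sec \<F> U\<^esub> g) = r \<odot>\<^bsub>Sec \<F> U\<^esub> f \<oplus>\<^bsub>Sec \<F> U\<^esub> r \<odot>\<^bsub>Sec \<F> U\<^esub> g"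
proof -
  interpret cring "Sec \<O> U" using assms cring_sections by blast
  show "\<one>\<^bsub>Sec \<O> U\<^esub> \<odot>\<^bsub>Sec \<F> U\<^esub> f = f" "\<lbrakk>r \<in> carrier (Sec \<O> U); s \<in> carrier (Sec \<O> U)\<rbrakk> \<Longrightarrow>
      (r \<otimes>\<^bsub>Sec \<O> U\<^esub> s) \<odot>\<^bsub>Sec \<F> U\<^esub> f = r \<odot>\<^bsub>Sec \<F> U\<^esub> (s \<odot>\<^bsub>Sec \<F> U\<^esub> f)"
    "\<lbrakk>r \<in> carrier (Sec \<O> U); s \<in> carrier (Sec \<O> U)\<rbrakk> \<Longrightarrow>
      (r \<oplus>\<^bsub>Sec \<O> U\<^esub> s) \<odot>\<^bsub>Sec \<F> U\<^esub> f = r \<odot>\<^bsub>Sec \<F> U\<^esub> f \<oplus>\<^bsub>Sec \<F> U\<^esub> s \<odot>\<^bsub>Sec \<F> U\<^esub> f"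
    "\<lbrakk>r \<in> carrier (Sec \<O> U); g \<in> carrier (Sec \<F> U)\<rbrakk> \<Longrightarrow>
      r \<odot>\<^bsub>Sec \<F> U\<^esub> (f \<oplus>\<^bsub>Sec \<F> U\<^esub> g) = r \<odot>\<^bsub>Sec \<F> U\<^esub> f \<oplus>\<^bsub>Sec \<F> U\<^esub> r \<odot>\<^bsub>Sec \<F> U\<^esub> g"
    using assms by (auto simp: F_carrier F_smult F_add singular_ideal_subset m_assoc l_distr r_distr)
qed

subsection \<open>Endomorphisms\<close>

lemma on_opens_apply: "\<lbrakk>openin T V; V \<subseteq> U\<rbrakk> \<Longrightarrow> on_opens T U g V = g V"
  by (simp add: on_opens_def)

lemma on_opens_cong:
  "(\<And>V. \<lbrakk>openin T V; V \<subseteq> U\<rbrakk> \<Longrightarrow> g V = h V) \<Longrightarrow> on_opens T U g = on_opens T U h"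
  unfolding on_opens_def by (rule restrict_ext) auto

lemma A_mult: "a \<otimes>\<^bsub>Sec \<A> U\<^esub> b = on_opens T U (\<lambda>V. \<lambda>x\<in>carrier (Sec \<F> V). a V (b V x))"
  by (simp add: Auslander_sheaf_def End_sheaf_def)

lemma A_add: "a \<oplus>\<^bsub>Sec \<A> U\<^esub> b = on_opens T U (\<lambda>V. \<lambda>x\<in>carrier (Sec \<F> V). a V x \<oplus>\<^bsub>Sec \<F> V\<^esub> b V x)"
  by (simp add: Auslander_sheaf_def End_sheaf_def)

lemma A_res: "Res \<A> U V a = on_opens T V a"
  by (simp add: Auslander_sheaf_def End_sheaf_def)

lemma A_carrier: "a \<in> carrier (Sec \<A> U) \<longleftrightarrow>
    a \<in> extensional {V. openin T V \<and> V \<subseteq> U} \<and>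
    (\<forall>V. openin T V \<and> V \<subseteq> U \<longrightarrow> a V \<in> linear_endos (Sec \<O> V) (Sec \<F> V)) \<and>
    (\<forall>V W. openin T V \<and> openin T W \<and> W \<subseteq> V \<and> V \<subseteq> U \<longrightarrow>
       (\<forall>x\<in>carrier (Sec \<F> V). Res \<F> V W (a V x) = a W (Res \<F> V W x)))"
  by (auto simp: Auslander_sheaf_def End_sheaf_def PiE_def Pi_def)

text \<open>Common source of both kinds of endomorphisms in the proof: those attached to a section
  of \<F> and those given by scalars.\<close>

lemma A_on_opensI:
  assumes "\<And>V x. \<lbrakk>openin T V; V \<subseteq> U; x \<in> carrier (Sec \<F> V)\<rbrakk> \<Longrightarrow> g V x \<in> carrier (Sec \<F> V)"
    and "\<And>V x y. \<lbrakk>openin T V; V \<subseteq> U; x \<in> carrier (Sec \<F> V); y \<in> carrier (Sec \<F> V)\<rbrakk> \<Longrightarrow>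
      g V (x \<oplus>\<^bsub>Sec \<F> V\<^esub> y) = g V x \<oplus>\<^bsub>Sec \<F> V\<^esub> g V y"
    and "\<And>V r x. \<lbrakk>openin T V; V \<subseteq> U; r \<in> carrier (Sec \<O> V); x \<in> carrier (Sec \<F> V)\<rbrakk> \<Longrightarrow>
      g V (r \<odot>\<^bsub>Sec \<F> V\<^esub> x) = r \<odot>\<^bsub>Sec \<F> V\<^esub> g V x"
    and "\<And>V W x. \<lbrakk>openin T V; openin T W; W \<subseteq> V; V \<subseteq> U; x \<in> carrier (Sec \<F> V)\<rbrakk> \<Longrightarrow>
      Res \<F> V W (g V x) = g W (Res \<F> V W x)"
  shows "on_opens T U (\<lambda>V. \<lambda>x\<in>carrier (Sec \<F> V). g V x) \<in> carrier (Sec \<A> U)"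
  unfolding A_carrier
proof (intro conjI allI impI; (elim conjE)?)
  show "on_opens T U (\<lambda>V. \<lambda>x\<in>carrier (Sec \<F> V). g V x) \<in> extensional {V. openin T V \<and> V \<subseteq> U}"
    by (simp add: on_opens_def)
  fix V assume V: "openin T V" "V \<subseteq> U"
  show "on_opens T U (\<lambda>V. \<lambda>x\<in>carrier (Sec \<F> V). g V x) V \<in> linear_endos (Sec \<O> V) (Sec \<F> V)"
    using V assms(1-3)[of V] by (auto simp: on_opens_apply linear_endos_def \<F>.add_closed \<F>.smult_closed)
next
  fix V W assume V: "openin T V" "openin T W" "W \<subseteq> V" "V \<subseteq> U"
  then have "W \<subseteq> U" by blast
  then show "\<forall>x\<in>carrier (Sec \<F> V). Res \<F> V W (on_opens T U (\<lambda>V. \<lambda>x\<in>carrier (Sec \<F> V). g V x) V x) =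
      on_opens T U (\<lambda>V. \<lambda>x\<in>carrier (Sec \<F> V). g V x) W (Res \<F> V W x)"
    using V assms(4)[of V W] \<F>.res_closed[of V W] by (simp add: on_opens_apply)
qed

lemma
  assumes "a \<in> carrier (Sec \<A> U)" "openin T V" "V \<subseteq> U" "x \<in> carrier (Sec \<F> V)"
  shows A_closed: "a V x \<in> carrier (Sec \<F> V)"
    and A_linear_add: "y \<in> carrier (Sec \<F> V) \<Longrightarrow> a V (x \<oplus>\<^bsub>Sec \<F> V\<^esub> y) = a V x \<oplus>\<^bsub>Sec \<F> V\<^esub> a V y"
    and A_linear_smult: "r \<in> carrier (Sec \<O> V) \<Longrightarrow> a V (r \<odot>\<^bsub>Sec \<F> V\<^esub> x) = r \<odot>\<^bsub>Sec \<F> V\<^esub> a V x"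
proof -
  have *: "a V \<in> linear_endos (Sec \<O> V) (Sec \<F> V)" using assms by (simp add: A_carrier)
  show "a V x \<in> carrier (Sec \<F> V)" using * assms(4) unfolding linear_endos_def by auto
  show "y \<in> carrier (Sec \<F> V) \<Longrightarrow> a V (x \<oplus>\<^bsub>Sec \<F> V\<^esub> y) = a V x \<oplus>\<^bsub>Sec \<F> V\<^esub> a V y"
    using * assms(4) unfolding linear_endos_def by auto
  show "r \<in> carrier (Sec \<O> V) \<Longrightarrow> a V (r \<odot>\<^bsub>Sec \<F> V\<^esub> x) = r \<odot>\<^bsub>Sec \<F> V\<^esub> a V x"
    using * assms(4) unfolding linear_endos_def by auto
qed

lemma A_natural:
  "\<lbrakk>a \<in> carrier (Sec \<A> U); openin T V; openin T W; W \<subseteq> V; V \<subseteq> U; x \<in> carrier (Sec \<F> V)\<rbrakk> \<Longrightarrow>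
    Res \<F> V W (a V x) = a W (Res \<F> V W x)"
  unfolding A_carrier by blast

lemma A_presheaf: "is_presheaf T \<A>"
  unfolding is_presheaf_def
proof (intro conjI allI impI ballI; (elim conjE)?)
  fix U V assume U: "openin T U" "openin T V" "V \<subseteq> U"
  have "on_opens T V a \<in> carrier (Sec \<A> V)" if "a \<in> carrier (Sec \<A> U)" for a
    unfolding A_carrier
  proof (intro conjI allI impI; (elim conjE)?)
    show "on_opens T V a \<in> extensional {W. openin T W \<and> W \<subseteq> V}" by (simp add: on_opens_def)
    show "on_opens T V a W \<in> linear_endos (Sec \<O> W) (Sec \<F> W)" if "openin T W" "W \<subseteq> V" for W
      using \<open>a \<in> _\<close> that U by (auto simp: on_opens_apply A_carrier)
    fix W Z assume W: "openin T W" "openin T Z" "Z \<subseteq> W" "W \<subseteq> V"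
    then have "Z \<subseteq> V" "W \<subseteq> U" using U by auto
    then show "\<forall>x\<in>carrier (Sec \<F> W). Res \<F> W Z (on_opens T V a W x) = on_opens T V a Z (Res \<F> W Z x)"
      using A_natural[OF that] W U by (simp add: on_opens_apply)
  qed
  then show "Res \<A> U V \<in> carrier (Sec \<A> U) \<rightarrow> carrier (Sec \<A> V)" by (simp add: A_res)
next
  fix U a assume "openin T U" "a \<in> carrier (Sec \<A> U)"
  then show "Res \<A> U U a = a" by (simp add: A_res on_opens_def A_carrier extensional_restrict)
next
  fix U V W a assume "openin T U" "openin T V" "openin T W" "W \<subseteq> V" "V \<subseteq> U" "a \<in> carrier (Sec \<A> U)"
  then show "Res \<A> V W (Res \<A> U V a) = Res \<A> U W a"
    by (auto simp: A_res intro!: on_opens_cong on_opens_apply)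
qed

text \<open>Under \<open>Hom(\<O>, \<F>) = \<F>\<close> the section \<open>f\<close> of \<open>\<F>\<close> is the endomorphism killing the ideal summand
  and sending \<open>1\<close> to \<open>f\<close>; the idempotent of the structure sheaf is the endomorphism of \<open>(0, 1)\<close>.\<close>

definition section_endo :: "'a set \<Rightarrow> 'r \<times> 'r \<Rightarrow> ('a, 'r) auslander_section" where
  "section_endo U f = on_opens T U (\<lambda>V. \<lambda>x\<in>carrier (Sec \<F> V). snd x \<odot>\<^bsub>Sec \<F> V\<^esub> Res \<F> U V f)"

lemma section_endo_apply:
  "\<lbrakk>openin T V; V \<subseteq> U; x \<in> carrier (Sec \<F> V)\<rbrakk> \<Longrightarrow> section_endo U f V x = snd x \<odot>\<^bsub>Sec \<F> V\<^esub> Res \<F> U V f"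
  by (simp add: section_endo_def on_opens_apply)

lemma section_endo_carrier:
  assumes U: "openin T U" "f \<in> carrier (Sec \<F> U)"
  shows "section_endo U f \<in> carrier (Sec \<A> U)"
  unfolding section_endo_def
proof (rule A_on_opensI)
  fix V x assume V: "openin T V" "V \<subseteq> U" "x \<in> carrier (Sec \<F> V)"
  have f: "Res \<F> U V f \<in> carrier (Sec \<F> V)" using U V \<F>.res_closed by blast
  then show "snd x \<odot>\<^bsub>Sec \<F> V\<^esub> Res \<F> U V f \<in> carrier (Sec \<F> V)"
    using V by (simp add: \<F>.smult_closed snd_carrier)
  show "snd (x \<oplus>\<^bsub>Sec \<F> V\<^esub> y) \<odot>\<^bsub>Sec \<F> V\<^esub> Res \<F> U V f =
      snd x \<odot>\<^bsub>Sec \<F> V\<^esub> Res \<F> U V f \<oplus>\<^bsub>Sec \<F> V\<^esub> snd y \<odot>\<^bsub>Sec \<F> V\<^esub> Res \<F> U V f"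
    if "y \<in> carrier (Sec \<F> V)" for y
    using f V that F_smult_l_distr[OF V(1) f snd_carrier[OF V(3)] snd_carrier[OF that]] by (simp add: F_add)
  show "snd (r \<odot>\<^bsub>Sec \<F> V\<^esub> x) \<odot>\<^bsub>Sec \<F> V\<^esub> Res \<F> U V f = r \<odot>\<^bsub>Sec \<F> V\<^esub> (snd x \<odot>\<^bsub>Sec \<F> V\<^esub> Res \<F> U V f)"
    if "r \<in> carrier (Sec \<O> V)" for r
    using F_smult_assoc[OF V(1) f that snd_carrier[OF V(3)]] by (simp add: F_smult)
  show "Res \<F> V W (snd x \<odot>\<^bsub>Sec \<F> V\<^esub> Res \<F> U V f) = snd (Res \<F> V W x) \<odot>\<^bsub>Sec \<F> W\<^esub> Res \<F> U W f"
    if "openin T W" "W \<subseteq> V" for W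
    using that U V f by (simp add: \<F>.res_smult snd_carrier \<F>.res_res) (simp add: F_res)
qed

lemma section_endo_add:
  assumes "openin T U" "f \<in> carrier (Sec \<F> U)" "g \<in> carrier (Sec \<F> U)"
  shows "section_endo U (f \<oplus>\<^bsub>Sec \<F> U\<^esub> g) = section_endo U f \<oplus>\<^bsub>Sec \<A> U\<^esub> section_endo U g"
  unfolding A_add section_endo_def
  using assms
  by (intro on_opens_cong restrict_ext)
    (simp add: on_opens_apply \<F>.res_add F_smult_r_distr \<F>.res_closed snd_carrier)

text \<open>Makes \<F> -> \<A> e a map of left \<A>-modules. Naturality of \<open>a\<close> moves it
  past the restriction of \<open>f\<close>, and \<O>-linearity pulls out the coefficient
  \<open>snd x\<close>.\<close>

lemma section_endo_image:
  assumes "openin T U" "a \<in> carrier (Sec \<A> U)" "f \<in> carrier (Sec \<F> U)"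
  shows "section_endo U (a U f) = a \<otimes>\<^bsub>Sec \<A> U\<^esub> section_endo U f"
  unfolding A_mult section_endo_def
  using assms
  by (intro on_opens_cong restrict_ext)
    (simp add: on_opens_apply A_natural A_linear_smult \<F>.res_closed snd_carrier)

lemma scalar_eq: "\<iota> U r = on_opens T U (\<lambda>V. \<lambda>x\<in>carrier (Sec \<F> V). Res \<O> U V r \<odot>\<^bsub>Sec \<F> V\<^esub> x)"
  by (simp add: Auslander_scalar_def End_scalar_def)

lemma scalar_apply:
  "\<lbrakk>openin T U; r \<in> carrier (Sec \<O> U); f \<in> carrier (Sec \<F> U)\<rbrakk> \<Longrightarrow> \<iota> U r U f = r \<odot>\<^bsub>Sec \<F> U\<^esub> f"
  by (simp add: scalar_eq on_opens_apply \<O>.res_id)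

lemma scalar_carrier:
  assumes U: "openin T U" "r \<in> carrier (Sec \<O> U)"
  shows "\<iota> U r \<in> carrier (Sec \<A> U)"
  unfolding scalar_eq
proof (rule A_on_opensI)
  fix V x assume V: "openin T V" "V \<subseteq> U" "x \<in> carrier (Sec \<F> V)"
  interpret cring "Sec \<O> V" using V cring_sections by blast
  have r: "Res \<O> U V r \<in> carrier (Sec \<O> V)" using U V \<O>.res_closed by blast
  then show "Res \<O> U V r \<odot>\<^bsub>Sec \<F> V\<^esub> x \<in> carrier (Sec \<F> V)" using V by (simp add: \<F>.smult_closed)
  show "Res \<O> U V r \<odot>\<^bsub>Sec \<F> V\<^esub> (x \<oplus>\<^bsub>Sec \<F> V\<^esub> y) = Res \<O> U V r \<odot>\<^bsub>Sec \<F> V\<^esub> x \<oplus>\<^bsub>Sec \<F> V\<^esub> Res \<O> U V r \<odot>\<^bsub>Sec \<F> V\<^esub> y"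
    if "y \<in> carrier (Sec \<F> V)" for y
    using r V that by (simp add: F_smult_r_distr)
  show "Res \<O> U V r \<odot>\<^bsub>Sec \<F> V\<^esub> (s \<odot>\<^bsub>Sec \<F> V\<^esub> x) = s \<odot>\<^bsub>Sec \<F> V\<^esub> (Res \<O> U V r \<odot>\<^bsub>Sec \<F> V\<^esub> x)"
    if "s \<in> carrier (Sec \<O> V)" for s
    using r V that by (simp add: m_comm flip: F_smult_assoc)
  show "Res \<F> V W (Res \<O> U V r \<odot>\<^bsub>Sec \<F> V\<^esub> x) = Res \<O> U W r \<odot>\<^bsub>Sec \<F> W\<^esub> Res \<F> V W x"
    if "openin T W" "W \<subseteq> V" for W
    using that U V r by (simp add: \<F>.res_smult \<O>.res_res)
qed

text \<open>Commutativity of \<O> lets the scalar pass from the argument to \<open>f\<close>. This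
  is what makes the counit balanced over \<O>.\<close>

lemma section_endo_scalar:
  assumes U: "openin T U" "f \<in> carrier (Sec \<F> U)" "r \<in> carrier (Sec \<O> U)"
  shows "section_endo U f \<otimes>\<^bsub>Sec \<A> U\<^esub> \<iota> U r = section_endo U (r \<odot>\<^bsub>Sec \<F> U\<^esub> f)"
  unfolding A_mult section_endo_def scalar_eq
proof (intro on_opens_cong restrict_ext)
  fix V x assume V: "openin T V" "V \<subseteq> U" "x \<in> carrier (Sec \<F> V)"
  interpret cring "Sec \<O> V" using V cring_sections by blast
  note cl = \<O>.res_closed[OF U(1) V(1,2) U(3)] \<F>.res_closed[OF U(1) V(1,2) U(2)] snd_carrier[OF V(3)]
  have "snd (Res \<O> U V r \<odot>\<^bsub>Sec \<F> V\<^esub> x) = snd x \<otimes>\<^bsub>Sec \<O> V\<^esub> Res \<O> U V r"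
    using cl by (simp add: F_smult m_comm)
  then show "on_opens T U (\<lambda>V. \<lambda>x\<in>carrier (Sec \<F> V). snd x \<odot>\<^bsub>Sec \<F> V\<^esub> Res \<F> U V f) V
      (on_opens T U (\<lambda>V. \<lambda>x\<in>carrier (Sec \<F> V). Res \<O> U V r \<odot>\<^bsub>Sec \<F> V\<^esub> x) V x) =
    snd x \<odot>\<^bsub>Sec \<F> V\<^esub> Res \<F> U V (r \<odot>\<^bsub>Sec \<F> U\<^esub> f)"
    using U V cl by (simp add: on_opens_apply \<F>.smult_closed \<F>.res_smult F_smult_assoc)
qed

text \<open>All endomorphisms attached to sections lie in \<A> e, because they factor through the
  projection to \<O>. For \<open>f = unit_section U\<close> this is the idempotence of e.\<close>

lemma section_endo_idem:
  assumes U: "openin T U" "f \<in> carrier (Sec \<F> U)"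
  shows "section_endo U f \<otimes>\<^bsub>Sec \<A> U\<^esub> section_endo U (unit_section U) = section_endo U f"
  unfolding A_mult
  unfolding section_endo_def[of U f]
proof (intro on_opens_cong restrict_ext)
  fix V x assume V: "openin T V" "V \<subseteq> U" "x \<in> carrier (Sec \<F> V)"
  interpret cring "Sec \<O> V" using V cring_sections by blast
  have "section_endo U (unit_section U) V x = snd x \<odot>\<^bsub>Sec \<F> V\<^esub> unit_section V"
    using U V by (simp add: section_endo_apply unit_section_res)
  moreover have "snd (snd x \<odot>\<^bsub>Sec \<F> V\<^esub> unit_section V) = snd x"
    using snd_carrier[OF V(3)] by (simp add: F_smult snd_unit_section)
  moreover have "snd x \<odot>\<^bsub>Sec \<F> V\<^esub> unit_section V \<in> carrier (Sec \<F> V)"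
    using V by (simp add: \<F>.smult_closed snd_carrier unit_section_carrier)
  ultimately show "on_opens T U (\<lambda>V. \<lambda>x\<in>carrier (Sec \<F> V). snd x \<odot>\<^bsub>Sec \<F> V\<^esub> Res \<F> U V f) V
      (section_endo U (unit_section U) V x) = snd x \<odot>\<^bsub>Sec \<F> V\<^esub> Res \<F> U V f"
    using V by (simp add: on_opens_apply)
qed

lemma section_endo_res:
  assumes U: "openin T U" "openin T V" "V \<subseteq> U" "f \<in> carrier (Sec \<F> U)"
  shows "Res \<A> U V (section_endo U f) = section_endo V (Res \<F> U V f)"
  unfolding A_res section_endo_def
proof (rule on_opens_cong)
  fix W assume W: "openin T W" "W \<subseteq> V"
  then have "W \<subseteq> U" using U by blast
  then show "on_opens T U (\<lambda>V. \<lambda>x\<in>carrier (Sec \<F> V). snd x \<odot>\<^bsub>Sec \<F> V\<^esub> Res \<F> U V f) W =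
      (\<lambda>x\<in>carrier (Sec \<F> W). snd x \<odot>\<^bsub>Sec \<F> W\<^esub> Res \<F> V W (Res \<F> U V f))"
    using U W by (simp add: on_opens_apply \<F>.res_res)
qed

lemma section_endo_self:
  assumes "openin T U" "f \<in> carrier (Sec \<F> U)" "g \<in> carrier (Sec \<F> U)"
  shows "section_endo U f U g = snd g \<odot>\<^bsub>Sec \<F> U\<^esub> f"
  using assms by (simp add: section_endo_apply \<F>.res_id)

end

section \<open>The corner module\<close>

lemma free_Abelian_group_hom_eq:
  assumes "h \<in> hom (free_Abelian_group S) H" "h' \<in> hom (free_Abelian_group S) H" "group H"
    and eq: "\<And>x. x \<in> S \<Longrightarrow> h (frag_of x) = h' (frag_of x)" and c: "Poly_Mapping.keys c \<subseteq> S"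
  shows "h c = h' c"
proof -
  interpret h: group_hom "free_Abelian_group S" H h
    using assms by (simp add: group_hom_def group_hom_axioms_def)
  interpret h': group_hom "free_Abelian_group S" H h'
    using assms by (simp add: group_hom_def group_hom_axioms_def)
  show ?thesis
  proof (rule free_Abelian_group_induct[OF c])
    show "h 0 = h' 0" using h.hom_one h'.hom_one by simp
    fix x y assume xy: "Poly_Mapping.keys x \<subseteq> S" "Poly_Mapping.keys y \<subseteq> S" "h x = h' x" "h y = h' y"
    \<comment> \<open>The induction on formal sums proceeds by differences, which a group
      homomorphism sees as a product with an inverse.\<close>
    have "k (x - y) = k x \<otimes>\<^bsub>H\<^esub> inv\<^bsub>H\<^esub> k y" if "group_hom (free_Abelian_group S) H k" for k
      using group_hom.hom_mult[OF that, of x "- y"] group_hom.hom_inv[OF that, of y] xy by simp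
    then show "h (x - y) = h' (x - y)" using xy h.group_hom_axioms h'.group_hom_axioms by metis
  qed (use eq in auto)
qed

text \<open>Carries linear combinations along two maps: multiplication by e from \<open>N\<close> to
  its corner, and the inclusion of the corner into \<open>N\<close>.\<close>

lemma finsum_hom_lessThan:
  assumes "abelian_group A" "abelian_group B" "h \<in> carrier A \<rightarrow> carrier B"
    and add: "\<And>x y. \<lbrakk>x \<in> carrier A; y \<in> carrier A\<rbrakk> \<Longrightarrow> h (x \<oplus>\<^bsub>A\<^esub> y) = h x \<oplus>\<^bsub>B\<^esub> h y"
    and zero: "h \<zero>\<^bsub>A\<^esub> = \<zero>\<^bsub>B\<^esub>"
    and g: "\<And>i. i < n \<Longrightarrow> g i \<in> carrier A"
  shows "h (finsum A g {..<n}) = finsum B (\<lambda>i. h (g i)) {..<(n::nat)}"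
  using g
proof (induction n)
  case 0
  interpret A: abelian_group A by fact
  interpret B: abelian_group B by fact
  show ?case by (simp add: zero)
next
  case (Suc n)
  interpret A: abelian_group A by fact
  interpret B: abelian_group B by fact
  have g: "g \<in> {..<n} \<rightarrow> carrier A" "g n \<in> carrier A" using Suc by auto
  then have "(\<lambda>i. h (g i)) \<in> {..<n} \<rightarrow> carrier B" "h (g n) \<in> carrier B" using assms(3) by auto
  then show ?case using Suc g by (simp add: lessThan_Suc add A.finsum_closed)
qed

lemma generated_by_cong:
  assumes "openin T U" and Sec: "\<And>V. \<lbrakk>openin T V; V \<subseteq> U\<rbrakk> \<Longrightarrow> Sec M V = Sec M' V" and Res: "Res M = Res M'"
    and gen: "generated_by T R M U n s"
  shows "generated_by T R M' U n s"
  unfolding generated_by_def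
proof (intro conjI allI impI ballI; (elim conjE)?)
  show "s i \<in> carrier (Sec M' U)" if "i < n" for i
    using gen that Sec[OF assms(1)] by (simp add: generated_by_def)
  fix V t x assume V: "openin T V" "V \<subseteq> U" "t \<in> carrier (Sec M' V)" "x \<in> V"
  have "\<exists>W a. openin T W \<and> x \<in> W \<and> W \<subseteq> V \<and> (\<forall>i<n. a i \<in> carrier (Sec R W)) \<and>
      Res M V W t = finsum (Sec M W) (\<lambda>i. a i \<odot>\<^bsub>Sec M W\<^esub> Res M U W (s i)) {..<n}"
    by (rule gen[unfolded generated_by_def, THEN conjunct2, rule_format, of V t x]) (use V Sec[OF V(1,2)] in simp_all)
  then obtain W a where W: "openin T W" "x \<in> W" "W \<subseteq> V" "\<forall>i<n. a i \<in> carrier (Sec R W)"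
    "Res M V W t = finsum (Sec M W) (\<lambda>i. a i \<odot>\<^bsub>Sec M W\<^esub> Res M U W (s i)) {..<n}"
    by blast
  moreover have "Sec M W = Sec M' W" using W V by (intro Sec) auto
  ultimately show "\<exists>W a. openin T W \<and> x \<in> W \<and> W \<subseteq> V \<and> (\<forall>i<n. a i \<in> carrier (Sec R W)) \<and>
      Res M' V W t = finsum (Sec M' W) (\<lambda>i. a i \<odot>\<^bsub>Sec M' W\<^esub> Res M' U W (s i)) {..<n}"
    by (intro exI[of _ W] exI[of _ a]) (simp add: Res)
qed

text \<open>Equality is asked inside \<open>U\<close> only, because the relation sheaves of
  \<open>N\<close> and of its corner are compared only there.\<close>

lemma finite_type_on_cong:
  assumes Sec: "\<And>V. \<lbrakk>openin T V; V \<subseteq> U\<rbrakk> \<Longrightarrow> Sec M V = Sec M' V" and Res: "Res M = Res M'"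
    and fin: "finite_type_on T R M U"
  shows "finite_type_on T R M' U"
  unfolding finite_type_on_def
proof
  fix x assume "x \<in> U"
  then obtain V n s where V: "openin T V" "x \<in> V" "V \<subseteq> U" "generated_by T R M V n s"
    using fin unfolding finite_type_on_def by blast
  have "Sec M W = Sec M' W" if "openin T W" "W \<subseteq> V" for W using that V by (intro Sec) auto
  from generated_by_cong[OF V(1) this Res V(4)] V
  show "\<exists>V n s. openin T V \<and> x \<in> V \<and> V \<subseteq> U \<and> generated_by T R M' V n s" by blast
qed

context locally_ringed
begin

abbreviation idem :: "'a set \<Rightarrow> ('a, 'r) auslander_section" where
  "idem U \<equiv> section_endo U (unit_section U)"

text \<open>The \<O>-module e N. Taking the fixed sections of e instead of its image turns
  membership into an equation, which suits the sheaf axiom, and keeps the type of sections of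
  \<open>N\<close>. Scalars act through \<open>Auslander_scalar X\<close>, which identifies \<O>
  with e \<A> e.\<close>

definition corner :: "('a, ('a, 'r) auslander_section, 'n) mod_presheaf \<Rightarrow> ('a, 'r, 'n) mod_presheaf" where
  "corner N =
    \<lparr>Sec = (\<lambda>U.
       \<lparr>carrier = {y \<in> carrier (Sec N U). idem U \<odot>\<^bsub>Sec N U\<^esub> y = y},
        monoid.mult = undefined, monoid.one = undefined,
        ring.zero = \<zero>\<^bsub>Sec N U\<^esub>, ring.add = ring.add (Sec N U),
        smult = (\<lambda>r. smult (Sec N U) (\<iota> U r))\<rparr>),
     Res = Res N\<rparr>"

lemma corner_simps [simp]:
  "y \<in> carrier (Sec (corner N) U) \<longleftrightarrow> y \<in> carrier (Sec N U) \<and> idem U \<odot>\<^bsub>Sec N U\<^esub> y = y"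
  "\<zero>\<^bsub>Sec (corner N) U\<^esub> = \<zero>\<^bsub>Sec N U\<^esub>"
  "y \<oplus>\<^bsub>Sec (corner N) U\<^esub> y' = y \<oplus>\<^bsub>Sec N U\<^esub> y'"
  "r \<odot>\<^bsub>Sec (corner N) U\<^esub> y = \<iota> U r \<odot>\<^bsub>Sec N U\<^esub> y"
  "Res (corner N) = Res N"
  by (simp_all add: corner_def)

lemma restrict_scalars_simps [simp]:
  "carrier (Sec (restrict_scalars j N) U) = carrier (Sec N U)"
  "\<zero>\<^bsub>Sec (restrict_scalars j N) U\<^esub> = \<zero>\<^bsub>Sec N U\<^esub>"
  "y \<oplus>\<^bsub>Sec (restrict_scalars j N) U\<^esub> y' = y \<oplus>\<^bsub>Sec N U\<^esub> y'"
  "r \<odot>\<^bsub>Sec (restrict_scalars j N) U\<^esub> y = j U r \<odot>\<^bsub>Sec N U\<^esub> y"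
  "Res (restrict_scalars j N) = Res N"
  by (simp_all add: restrict_scalars_def)

text \<open>The counit on representatives, obtained from the universal property of the free abelian
  group. Its domain allows all sections of \<open>N\<close>, so that the naturality statements need
  no fixed-point condition.\<close>

definition evaluation ::
    "('a, ('a, 'r) auslander_section, 'n) mod_presheaf \<Rightarrow> 'a set \<Rightarrow> (('r \<times> 'r) \<times> 'n \<Rightarrow>\<^sub>0 int) \<Rightarrow> 'n" where
  "evaluation N U = (SOME h.
     h \<in> hom (free_Abelian_group (carrier (Sec \<F> U) \<times> carrier (Sec N U))) (add_monoid (Sec N U)) \<and>
     (\<forall>f\<in>carrier (Sec \<F> U). \<forall>y\<in>carrier (Sec N U). h (frag_of (f, y)) = section_endo U f \<odot>\<^bsub>Sec N U\<^esub> y))"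

end

text \<open>The second assumption is contained in \<open>coherent_Auslander\<close>; having it at
  hand spares a proof that \<open>Auslander_scalar X\<close> is a ring homomorphism.\<close>

locale auslander_module = locally_ringed X
  for X :: "('a, 'r) ringed_space" +
  fixes N :: "('a, ('a, 'r) auslander_section, 'n) mod_presheaf"
  assumes A_module: "sheaf_of_left_modules (Space X) (Auslander_sheaf X) N"
    and O_module: "sheaf_of_left_modules (Space X) (Struct X) (restrict_scalars (Auslander_scalar X) N)"
begin

lemma A_left_module: "openin T U \<Longrightarrow> left_module (Sec \<A> U) (Sec N U)"
  using A_module by (simp add: sheaf_of_left_modules_def)

lemma O_left_module: "openin T U \<Longrightarrow> left_module (Sec \<O> U) (Sec (restrict_scalars \<iota> N) U)"
  using O_module by (simp add: sheaf_of_left_modules_def)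

lemma N_group: "openin T U \<Longrightarrow> abelian_group (Sec N U)"
  using A_left_module left_module.axioms(2) by blast

lemma is_sheaf_N: "is_sheaf T N"
  using A_module by (simp add: sheaf_of_left_modules_def)

sublocale N: module_presheaf T \<A> N
  by (rule module_presheaf_of_sheaf[OF A_module A_presheaf])

lemma endo_closed:
  "\<lbrakk>openin T U; f \<in> carrier (Sec \<F> U); y \<in> carrier (Sec N U)\<rbrakk> \<Longrightarrow>
    section_endo U f \<odot>\<^bsub>Sec N U\<^esub> y \<in> carrier (Sec N U)"
  by (simp add: N.smult_closed section_endo_carrier)

lemma scalar_closed:
  "\<lbrakk>openin T U; r \<in> carrier (Sec \<O> U); y \<in> carrier (Sec N U)\<rbrakk> \<Longrightarrow>
    \<iota> U r \<odot>\<^bsub>Sec N U\<^esub> y \<in> carrier (Sec N U)"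
  by (simp add: N.smult_closed scalar_carrier)

lemma endo_image:
  "\<lbrakk>openin T U; a \<in> carrier (Sec \<A> U); f \<in> carrier (Sec \<F> U); y \<in> carrier (Sec N U)\<rbrakk> \<Longrightarrow>
    a \<odot>\<^bsub>Sec N U\<^esub> (section_endo U f \<odot>\<^bsub>Sec N U\<^esub> y) = section_endo U (a U f) \<odot>\<^bsub>Sec N U\<^esub> y"
  using left_module.smult_assoc[OF A_left_module] by (simp add: section_endo_image section_endo_carrier)

lemma endo_scalar:
  "\<lbrakk>openin T U; r \<in> carrier (Sec \<O> U); f \<in> carrier (Sec \<F> U); y \<in> carrier (Sec N U)\<rbrakk> \<Longrightarrow>
    section_endo U f \<odot>\<^bsub>Sec N U\<^esub> (\<iota> U r \<odot>\<^bsub>Sec N U\<^esub> y) = section_endo U (r \<odot>\<^bsub>Sec \<F> U\<^esub> f) \<odot>\<^bsub>Sec N U\<^esub> y"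
  using left_module.smult_assoc[OF A_left_module]
  by (simp add: section_endo_carrier scalar_carrier flip: section_endo_scalar)

text \<open>As \<F> = \<A> e, the endomorphism of \<open>f\<close> sees only the part e y of
  \<open>y\<close>.\<close>

lemma endo_idem:
  "\<lbrakk>openin T U; f \<in> carrier (Sec \<F> U); y \<in> carrier (Sec N U)\<rbrakk> \<Longrightarrow>
    section_endo U f \<odot>\<^bsub>Sec N U\<^esub> (idem U \<odot>\<^bsub>Sec N U\<^esub> y) = section_endo U f \<odot>\<^bsub>Sec N U\<^esub> y"
  using left_module.smult_assoc[OF A_left_module, of U "section_endo U f" "idem U" y]
  by (simp add: section_endo_carrier unit_section_carrier section_endo_idem)

lemma endo_add_left:
  "\<lbrakk>openin T U; f \<in> carrier (Sec \<F> U); g \<in> carrier (Sec \<F> U); y \<in> carrier (Sec N U)\<rbrakk> \<Longrightarrow>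
    section_endo U (f \<oplus>\<^bsub>Sec \<F> U\<^esub> g) \<odot>\<^bsub>Sec N U\<^esub> y =
    section_endo U f \<odot>\<^bsub>Sec N U\<^esub> y \<oplus>\<^bsub>Sec N U\<^esub> section_endo U g \<odot>\<^bsub>Sec N U\<^esub> y"
  using left_module.smult_l_distr[OF A_left_module] by (simp add: section_endo_carrier section_endo_add)

lemma smult_add:
  "\<lbrakk>openin T U; a \<in> carrier (Sec \<A> U); y \<in> carrier (Sec N U); y' \<in> carrier (Sec N U)\<rbrakk> \<Longrightarrow>
    a \<odot>\<^bsub>Sec N U\<^esub> (y \<oplus>\<^bsub>Sec N U\<^esub> y') = a \<odot>\<^bsub>Sec N U\<^esub> y \<oplus>\<^bsub>Sec N U\<^esub> a \<odot>\<^bsub>Sec N U\<^esub> y'"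
  using left_module.smult_r_distr[OF A_left_module] by simp

lemma smult_zero:
  assumes "openin T U" "a \<in> carrier (Sec \<A> U)"
  shows "a \<odot>\<^bsub>Sec N U\<^esub> \<zero>\<^bsub>Sec N U\<^esub> = \<zero>\<^bsub>Sec N U\<^esub>"
proof -
  interpret abelian_group "Sec N U" using N_group assms by blast
  have a: "a \<odot>\<^bsub>Sec N U\<^esub> \<zero>\<^bsub>Sec N U\<^esub> \<in> carrier (Sec N U)" using assms by (simp add: N.smult_closed)
  have "a \<odot>\<^bsub>Sec N U\<^esub> \<zero>\<^bsub>Sec N U\<^esub> \<oplus>\<^bsub>Sec N U\<^esub> a \<odot>\<^bsub>Sec N U\<^esub> \<zero>\<^bsub>Sec N U\<^esub> = a \<odot>\<^bsub>Sec N U\<^esub> \<zero>\<^bsub>Sec N U\<^esub>"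
    using smult_add[OF assms, of "\<zero>\<^bsub>Sec N U\<^esub>" "\<zero>\<^bsub>Sec N U\<^esub>"] by simp
  then show ?thesis using a by simp
qed

lemma idem_carrier: "openin T U \<Longrightarrow> idem U \<in> carrier (Sec \<A> U)"
  by (simp add: section_endo_carrier unit_section_carrier)

lemma idem_closed:
  "\<lbrakk>openin T U; y \<in> carrier (Sec N U)\<rbrakk> \<Longrightarrow> idem U \<odot>\<^bsub>Sec N U\<^esub> y \<in> carrier (Sec (corner N) U)"
  by (simp add: endo_closed endo_idem unit_section_carrier)

text \<open>Both sides are \<open>r \<odot> (0, 1)\<close>, read as an endomorphism, applied to
  \<open>y\<close>. Hence e N is stable under \<O>.\<close>

lemma idem_scalar:
  "\<lbrakk>openin T U; r \<in> carrier (Sec \<O> U); y \<in> carrier (Sec N U)\<rbrakk> \<Longrightarrow>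
    idem U \<odot>\<^bsub>Sec N U\<^esub> (\<iota> U r \<odot>\<^bsub>Sec N U\<^esub> y) = \<iota> U r \<odot>\<^bsub>Sec N U\<^esub> (idem U \<odot>\<^bsub>Sec N U\<^esub> y)"
  by (simp add: endo_scalar endo_image unit_section_carrier scalar_carrier scalar_apply)

lemma idem_res:
  "\<lbrakk>openin T U; openin T V; V \<subseteq> U; y \<in> carrier (Sec N U)\<rbrakk> \<Longrightarrow>
    Res N U V (idem U \<odot>\<^bsub>Sec N U\<^esub> y) = idem V \<odot>\<^bsub>Sec N V\<^esub> Res N U V y"
  by (simp add: N.res_smult section_endo_carrier unit_section_carrier section_endo_res unit_section_res)

lemma corner_abelian_group:
  assumes U: "openin T U"
  shows "abelian_group (Sec (corner N) U)"
proof -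
  interpret abelian_group "Sec N U" using N_group U by blast
  show ?thesis
  proof (rule abelian_groupI)
    fix y assume y: "y \<in> carrier (Sec (corner N) U)"
    \<comment> \<open>The candidate for the negative is e(-y) instead of -y: it lies in the corner
      by \<open>idem_closed\<close>, and e y = y makes it cancel \<open>y\<close>.\<close>
    have "idem U \<odot>\<^bsub>Sec N U\<^esub> (\<ominus>\<^bsub>Sec N U\<^esub> y) \<oplus>\<^bsub>Sec N U\<^esub> y = \<zero>\<^bsub>Sec N U\<^esub>"
      using smult_add[OF U idem_carrier[OF U], of "\<ominus>\<^bsub>Sec N U\<^esub> y" y] y
        smult_zero[OF U idem_carrier[OF U]] by (simp add: l_neg)
    then show "\<exists>x\<in>carrier (Sec (corner N) U). x \<oplus>\<^bsub>Sec (corner N) U\<^esub> y = \<zero>\<^bsub>Sec (corner N) U\<^esub>"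
      using idem_closed[OF U, of "\<ominus>\<^bsub>Sec N U\<^esub> y"] y by auto
  qed (use U in \<open>auto simp: smult_add idem_carrier smult_zero a_ac\<close>)
qed

lemma corner_left_module:
  assumes U: "openin T U"
  shows "left_module (Sec \<O> U) (Sec (corner N) U)"
proof -
  interpret cring "Sec \<O> U" using U cring_sections by blast
  interpret c: abelian_group "Sec (corner N) U" using U by (rule corner_abelian_group)
  note m = left_module.smult_l_distr[OF O_left_module[OF U]] left_module.smult_r_distr[OF O_left_module[OF U]]
    left_module.smult_assoc[OF O_left_module[OF U]] left_module.smult_one[OF O_left_module[OF U]]
  show ?thesis
    by unfold_locales (use U m in \<open>auto simp: scalar_closed idem_scalar\<close>)
qed

lemma corner_res_closed:
  "\<lbrakk>openin T U; openin T V; V \<subseteq> U; y \<in> carrier (Sec (corner N) U)\<rbrakk> \<Longrightarrow> Res N U V y \<in> carrier (Sec (corner N) V)"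
  by (simp add: N.res_closed flip: idem_res)

lemma corner_is_sheaf: "is_sheaf T (corner N)"
  unfolding is_sheaf_def
proof (intro conjI allI impI; (elim conjE)?)
  show "is_presheaf T (corner N)"
    unfolding is_presheaf_def using corner_res_closed by (auto simp: N.res_id N.res_res simp del: corner_simps(1)) (auto simp: N.res_id N.res_res)
  fix \<U> s
  assume s: "\<forall>U\<in>\<U>. openin T U \<and> s U \<in> carrier (Sec (corner N) U)"
    and comp: "\<forall>U\<in>\<U>. \<forall>V\<in>\<U>. Res (corner N) U (U \<inter> V) (s U) = Res (corner N) V (U \<inter> V) (s V)"
  have UU: "openin T (\<Union>\<U>)" using s by blast
  have "\<exists>!t. t \<in> carrier (Sec N (\<Union>\<U>)) \<and> (\<forall>U\<in>\<U>. Res N (\<Union>\<U>) U t = s U)"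
    using is_sheaf_N[unfolded is_sheaf_def, THEN conjunct2, rule_format, of \<U> s] s comp by simp
  then obtain t where t: "t \<in> carrier (Sec N (\<Union>\<U>))" "\<And>U. U \<in> \<U> \<Longrightarrow> Res N (\<Union>\<U>) U t = s U"
    and uniq: "\<And>t'. \<lbrakk>t' \<in> carrier (Sec N (\<Union>\<U>)); \<forall>U\<in>\<U>. Res N (\<Union>\<U>) U t' = s U\<rbrakk> \<Longrightarrow> t' = t"
    by (elim ex1E conjE) blast
  \<comment> \<open>As e commutes with restriction and fixes every \<open>s U\<close>, the section e
    t glues the same family as \<open>t\<close>; uniqueness of gluing in \<open>N\<close> makes
    \<open>t\<close> a fixed section.\<close>
  have "idem (\<Union>\<U>) \<odot>\<^bsub>Sec N (\<Union>\<U>)\<^esub> t = t"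
  proof (rule uniq)
    show "idem (\<Union>\<U>) \<odot>\<^bsub>Sec N (\<Union>\<U>)\<^esub> t \<in> carrier (Sec N (\<Union>\<U>))" using idem_closed[OF UU t(1)] by simp
    show "\<forall>U\<in>\<U>. Res N (\<Union>\<U>) U (idem (\<Union>\<U>) \<odot>\<^bsub>Sec N (\<Union>\<U>)\<^esub> t) = s U"
    proof
      fix U assume "U \<in> \<U>"
      then show "Res N (\<Union>\<U>) U (idem (\<Union>\<U>) \<odot>\<^bsub>Sec N (\<Union>\<U>)\<^esub> t) = s U"
        using s t idem_res[OF UU _ _ t(1), of U] by (simp add: Union_upper)
    qed
  qed
  then show "\<exists>!t. t \<in> carrier (Sec (corner N) (\<Union>\<U>)) \<and> (\<forall>U\<in>\<U>. Res (corner N) (\<Union>\<U>) U t = s U)"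
    unfolding corner_simps
  proof (intro ex1I[of _ t] conjI ballI)
    fix t' assume "(t' \<in> carrier (Sec N (\<Union>\<U>)) \<and> idem (\<Union>\<U>) \<odot>\<^bsub>Sec N (\<Union>\<U>)\<^esub> t' = t') \<and>
      (\<forall>U\<in>\<U>. Res N (\<Union>\<U>) U t' = s U)"
    then show "t' = t" by (elim conjE) (rule uniq)
  qed (use t in blast)+
qed

lemma corner_sheaf_of_left_modules: "sheaf_of_left_modules T \<O> (corner N)"
  unfolding sheaf_of_left_modules_def
  using corner_is_sheaf corner_left_module O_module
  by (simp add: sheaf_of_left_modules_def)

sublocale corner: module_presheaf T \<O> "corner N"
  by (rule module_presheaf_of_sheaf[OF corner_sheaf_of_left_modules \<O>.is_presheaf])

lemma finsum_corner:
  assumes "openin T U" "\<And>i. i < n \<Longrightarrow> g i \<in> carrier (Sec (corner N) U)"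
  shows "finsum (Sec (restrict_scalars \<iota> N) U) g {..<n} = finsum (Sec (corner N) U) g {..<(n::nat)}"
  using finsum_hom_lessThan[of "Sec (corner N) U" "Sec (restrict_scalars \<iota> N) U" "\<lambda>y. y" n g]
    corner_abelian_group left_module.axioms(2)[OF O_left_module] assms by simp

text \<open>e N is a direct summand of \<open>N\<close> over \<O>: it is generated by the images
  under e of generators of \<open>N\<close>, and sections of e N satisfy the same relations there as
  in \<open>N\<close>.\<close>

lemma coherent_corner:
  assumes "coherent X (restrict_scalars \<iota> N)"
  shows "coherent X (corner N)"
  unfolding coherent_def
proof (intro conjI allI impI; (elim conjE)?)
  show "sheaf_of_left_modules T \<O> (corner N)" by (rule corner_sheaf_of_left_modules)
  show "finite_type_on T \<O> (corner N) (topspace T)"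
    unfolding finite_type_on_def
  proof
    fix x assume "x \<in> topspace T"
    then obtain V n s where V: "openin T V" "x \<in> V" and gen: "generated_by T \<O> (restrict_scalars \<iota> N) V n s"
      using assms unfolding coherent_def finite_type_on_def by blast
    have s: "s i \<in> carrier (Sec N V)" if "i < n" for i
      using gen that unfolding generated_by_def by simp
    have "generated_by T \<O> (corner N) V n (\<lambda>i. idem V \<odot>\<^bsub>Sec N V\<^esub> s i)"
      unfolding generated_by_def
    proof (intro conjI allI impI ballI; (elim conjE)?)
      show "idem V \<odot>\<^bsub>Sec N V\<^esub> s i \<in> carrier (Sec (corner N) V)" if "i < n" for i
        using idem_closed V s that by blast
      fix W t y assume W: "openin T W" "W \<subseteq> V" "t \<in> carrier (Sec (corner N) W)" "y \<in> W"
      have "\<exists>Z a. openin T Z \<and> y \<in> Z \<and> Z \<subseteq> W \<and> (\<forall>i<n. a i \<in> carrier (Sec \<O> Z)) \<and>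
          Res (restrict_scalars \<iota> N) W Z t = finsum (Sec (restrict_scalars \<iota> N) Z)
            (\<lambda>i. a i \<odot>\<^bsub>Sec (restrict_scalars \<iota> N) Z\<^esub> Res (restrict_scalars \<iota> N) V Z (s i)) {..<n}"
        by (rule gen[unfolded generated_by_def, THEN conjunct2, rule_format, of W t y]) (use W in simp_all)
      then obtain Z a where Z: "openin T Z" "y \<in> Z" "Z \<subseteq> W" and a: "\<And>i. i < n \<Longrightarrow> a i \<in> carrier (Sec \<O> Z)"
        and eq: "Res N W Z t = finsum (Sec (restrict_scalars \<iota> N) Z) (\<lambda>i. \<iota> Z (a i) \<odot>\<^bsub>Sec N Z\<^esub> Res N V Z (s i)) {..<n}"
        unfolding restrict_scalars_simps by blast
      have ZV: "Z \<subseteq> V" using Z W by blast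
      have sZ: "Res N V Z (s i) \<in> carrier (Sec N Z)" if "i < n" for i
        using N.res_closed V Z ZV s that by blast
      have idem_sZ: "idem Z \<odot>\<^bsub>Sec N Z\<^esub> Res N V Z (s i) = Res N V Z (idem V \<odot>\<^bsub>Sec N V\<^esub> s i)" if "i < n" for i
        using V Z ZV s that by (simp add: idem_res)
      have cl: "Res N V Z (idem V \<odot>\<^bsub>Sec N V\<^esub> s i) \<in> carrier (Sec N Z)" if "i < n" for i
        using V Z ZV s that by (intro N.res_closed) (auto simp: endo_closed unit_section_carrier)
      \<comment> \<open>The section \<open>t\<close> is fixed by e, so applying e to its expression
        in the generators of \<open>N\<close> leaves \<open>t\<close> alone and moves e onto the
        generators.\<close>
      have "Res N W Z t = idem Z \<odot>\<^bsub>Sec N Z\<^esub> Res N W Z t"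
        using corner_res_closed[of W Z t] W Z by simp
      also have "\<dots> = finsum (Sec (corner N) Z) (\<lambda>i. idem Z \<odot>\<^bsub>Sec N Z\<^esub> (\<iota> Z (a i) \<odot>\<^bsub>Sec N Z\<^esub> Res N V Z (s i))) {..<n}"
        unfolding eq
        by (rule finsum_hom_lessThan[where h = "\<lambda>y. idem Z \<odot>\<^bsub>Sec N Z\<^esub> y"])
          (use Z a sZ idem_closed[OF Z(1)] in \<open>auto simp: corner_abelian_group left_module.axioms(2)[OF O_left_module]
             smult_add idem_carrier smult_zero scalar_closed\<close>)
      also have "\<dots> = finsum (Sec (corner N) Z)
          (\<lambda>i. a i \<odot>\<^bsub>Sec (corner N) Z\<^esub> Res (corner N) V Z (idem V \<odot>\<^bsub>Sec N V\<^esub> s i)) {..<n}"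
      proof (rule abelian_monoid.finsum_cong')
        show "abelian_monoid (Sec (corner N) Z)"
          using corner_abelian_group[OF Z(1)] by (rule abelian_group.axioms(1))
        show "(\<lambda>i. a i \<odot>\<^bsub>Sec (corner N) Z\<^esub> Res (corner N) V Z (idem V \<odot>\<^bsub>Sec N V\<^esub> s i)) \<in> {..<n} \<rightarrow> carrier (Sec (corner N) Z)"
          using Z ZV V s a corner_res_closed[of V Z] idem_closed[of V]
          by (intro Pi_I corner.smult_closed) auto
        show "idem Z \<odot>\<^bsub>Sec N Z\<^esub> (\<iota> Z (a i) \<odot>\<^bsub>Sec N Z\<^esub> Res N V Z (s i)) =
            a i \<odot>\<^bsub>Sec (corner N) Z\<^esub> Res (corner N) V Z (idem V \<odot>\<^bsub>Sec N V\<^esub> s i)" if "i \<in> {..<n}" for i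
          using that Z a sZ by (simp add: idem_scalar idem_sZ)
      qed simp
      finally show "\<exists>Z a. openin T Z \<and> y \<in> Z \<and> Z \<subseteq> W \<and> (\<forall>i<n. a i \<in> carrier (Sec \<O> Z)) \<and>
          Res (corner N) W Z t = finsum (Sec (corner N) Z)
            (\<lambda>i. a i \<odot>\<^bsub>Sec (corner N) Z\<^esub> Res (corner N) V Z (idem V \<odot>\<^bsub>Sec N V\<^esub> s i)) {..<n}"
        using Z a by (intro exI[of _ Z] exI[of _ a]) simp
    qed
    then show "\<exists>V n s. openin T V \<and> x \<in> V \<and> V \<subseteq> topspace T \<and> generated_by T \<O> (corner N) V n s"
      using V openin_subset by blast
  qed
  fix U s and n :: nat assume U: "openin T U" and s: "\<forall>i<n. s i \<in> carrier (Sec (corner N) U)"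
  show "finite_type_on T \<O> (relation_sheaf \<O> (corner N) U n s) U"
  proof (rule finite_type_on_cong)
    show "finite_type_on T \<O> (relation_sheaf \<O> (restrict_scalars \<iota> N) U n s) U"
      using assms U s unfolding coherent_def by simp
    fix V assume V: "openin T V" "V \<subseteq> U"
    \<comment> \<open>Sums of corner sections are the same in the corner and in \<open>N\<close>, so
      the two relation sheaves have literally equal carriers over \<open>V\<close>.\<close>
    have "finsum (Sec (restrict_scalars \<iota> N) V) (\<lambda>i. a i \<odot>\<^bsub>Sec (corner N) V\<^esub> Res N U V (s i)) {..<n} =
        finsum (Sec (corner N) V) (\<lambda>i. a i \<odot>\<^bsub>Sec (corner N) V\<^esub> Res N U V (s i)) {..<n}"
      if "a \<in> (\<Pi>\<^sub>E i\<in>{..<n}. carrier (Sec \<O> V))" for a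
      by (rule finsum_corner[OF V(1)], rule corner.smult_closed)
        (use that U V s corner_res_closed[OF U V] in auto)
    then have "{a \<in> (\<Pi>\<^sub>E i\<in>{..<n}. carrier (Sec \<O> V)).
          finsum (Sec (restrict_scalars \<iota> N) V) (\<lambda>i. a i \<odot>\<^bsub>Sec (restrict_scalars \<iota> N) V\<^esub> Res N U V (s i)) {..<n} = \<zero>\<^bsub>Sec N V\<^esub>} =
        {a \<in> (\<Pi>\<^sub>E i\<in>{..<n}. carrier (Sec \<O> V)).
          finsum (Sec (corner N) V) (\<lambda>i. a i \<odot>\<^bsub>Sec (corner N) V\<^esub> Res N U V (s i)) {..<n} = \<zero>\<^bsub>Sec N V\<^esub>}"
      by (intro Collect_cong conj_cong refl) simp
    then show "Sec (relation_sheaf \<O> (restrict_scalars \<iota> N) U n s) V = Sec (relation_sheaf \<O> (corner N) U n s) V"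
      by (simp add: relation_sheaf_def)
  qed (simp add: relation_sheaf_def)
qed

subsection \<open>Evaluation of formal sums\<close>

lemma
  assumes U: "openin T U"
  shows evaluation_hom:
      "evaluation N U \<in> hom (free_Abelian_group (carrier (Sec \<F> U) \<times> carrier (Sec N U))) (add_monoid (Sec N U))"
    and evaluation_frag: "\<lbrakk>f \<in> carrier (Sec \<F> U); y \<in> carrier (Sec N U)\<rbrakk> \<Longrightarrow>
      evaluation N U (frag_of (f, y)) = section_endo U f \<odot>\<^bsub>Sec N U\<^esub> y"
proof -
  interpret abelian_group "Sec N U" using N_group U by blast
  obtain h where h: "h \<in> hom (free_Abelian_group (carrier (Sec \<F> U) \<times> carrier (Sec N U))) (add_monoid (Sec N U))"
    "\<And>x. x \<in> carrier (Sec \<F> U) \<times> carrier (Sec N U) \<Longrightarrow>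
      h (frag_of x) = (case x of (f, y) \<Rightarrow> section_endo U f \<odot>\<^bsub>Sec N U\<^esub> y)"
  proof (rule comm_group.free_Abelian_group_universal[OF a_comm_group])
    show "(\<lambda>(f, y). section_endo U f \<odot>\<^bsub>Sec N U\<^esub> y) ` (carrier (Sec \<F> U) \<times> carrier (Sec N U)) \<subseteq>
        carrier (add_monoid (Sec N U))"
      using U by (auto simp: endo_closed)
  qed blast
  have "\<exists>h. h \<in> hom (free_Abelian_group (carrier (Sec \<F> U) \<times> carrier (Sec N U))) (add_monoid (Sec N U)) \<and>
     (\<forall>f\<in>carrier (Sec \<F> U). \<forall>y\<in>carrier (Sec N U). h (frag_of (f, y)) = section_endo U f \<odot>\<^bsub>Sec N U\<^esub> y)"
    using h by (intro exI[of _ h]) auto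
  from someI_ex[OF this] show
    "evaluation N U \<in> hom (free_Abelian_group (carrier (Sec \<F> U) \<times> carrier (Sec N U))) (add_monoid (Sec N U))"
    "\<lbrakk>f \<in> carrier (Sec \<F> U); y \<in> carrier (Sec N U)\<rbrakk> \<Longrightarrow>
      evaluation N U (frag_of (f, y)) = section_endo U f \<odot>\<^bsub>Sec N U\<^esub> y"
    by (simp_all add: evaluation_def)
qed

lemma evaluation_closed:
  "\<lbrakk>openin T U; Poly_Mapping.keys c \<subseteq> carrier (Sec \<F> U) \<times> carrier (Sec N U)\<rbrakk> \<Longrightarrow>
    evaluation N U c \<in> carrier (Sec N U)"
  using hom_in_carrier[OF evaluation_hom, of U c] by simp

lemma evaluation_add:
  "\<lbrakk>openin T U; Poly_Mapping.keys c \<subseteq> carrier (Sec \<F> U) \<times> carrier (Sec N U);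
    Poly_Mapping.keys d \<subseteq> carrier (Sec \<F> U) \<times> carrier (Sec N U)\<rbrakk> \<Longrightarrow>
    evaluation N U (c + d) = evaluation N U c \<oplus>\<^bsub>Sec N U\<^esub> evaluation N U d"
  using hom_mult[OF evaluation_hom, of U c d] by simp

lemma evaluation_zero: "openin T U \<Longrightarrow> evaluation N U 0 = \<zero>\<^bsub>Sec N U\<^esub>"
  using hom_one[OF evaluation_hom, of U] abelian_group.a_group[OF N_group] by simp

lemma evaluation_diff:
  assumes U: "openin T U" and c: "Poly_Mapping.keys c \<subseteq> carrier (Sec \<F> U) \<times> carrier (Sec N U)"
    and d: "Poly_Mapping.keys d \<subseteq> carrier (Sec \<F> U) \<times> carrier (Sec N U)"
  shows "evaluation N U (c - d) = evaluation N U c \<ominus>\<^bsub>Sec N U\<^esub> evaluation N U d"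
proof -
  interpret abelian_group "Sec N U" using N_group U by blast
  have "evaluation N U (c - d) \<oplus>\<^bsub>Sec N U\<^esub> evaluation N U d = evaluation N U c"
    using evaluation_add[OF U keys_diff_subset[OF c d] d] by simp
  then show ?thesis
    using evaluation_closed[OF U keys_diff_subset[OF c d]] evaluation_closed[OF U d]
    by (metis a_minus_def add.inv_closed add.m_assoc r_neg r_zero)
qed

end

section \<open>Tensor products with \<open>\<F>\<close>\<close>

context locally_ringed
begin

text \<open>The left factor as it occurs in \<open>tensor_presheaf\<close>: scalars act through
  \<open>Auslander_scalar X\<close>, and \<open>scalar_apply\<close> translates this back to the
  action on \<open>F_sheaf X\<close>.\<close>

abbreviation F_sections :: "'a set \<Rightarrow> ('r, 'r \<times> 'r) module" where
  "F_sections U \<equiv> Sec (restrict_scalars \<iota> (End_tautological \<F>)) U"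

abbreviation fsums :: "('a, 'r, 'm) mod_presheaf \<Rightarrow> 'a set \<Rightarrow> (('r \<times> 'r) \<times> 'm \<Rightarrow>\<^sub>0 int) set" where
  "fsums M U \<equiv> {c. Poly_Mapping.keys c \<subseteq> carrier (Sec \<F> U) \<times> carrier (Sec M U)}"

abbreviation ker :: "('a, 'r, 'm) mod_presheaf \<Rightarrow> 'a set \<Rightarrow> (('r \<times> 'r) \<times> 'm \<Rightarrow>\<^sub>0 int) set" where
  "ker M U \<equiv> tensor_kernel (Sec \<O> U) (F_sections U) (Sec M U)"

abbreviation cls :: "('a, 'r, 'm) mod_presheaf \<Rightarrow> 'a set \<Rightarrow> (('r \<times> 'r) \<times> 'm \<Rightarrow>\<^sub>0 int) \<Rightarrow>
    (('r \<times> 'r) \<times> 'm \<Rightarrow>\<^sub>0 int) set" where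
  "cls M U \<equiv> tensor_pair.tensor_class (Sec \<O> U) (F_sections U) (Sec M U)"

abbreviation restrict_sum :: "('a, 'r, 'm) mod_presheaf \<Rightarrow> 'a set \<Rightarrow> 'a set \<Rightarrow>
    (('r \<times> 'r) \<times> 'm \<Rightarrow>\<^sub>0 int) \<Rightarrow> (('r \<times> 'r) \<times> 'm \<Rightarrow>\<^sub>0 int)" where
  "restrict_sum M U V \<equiv> pair_map (Res \<F> U V) (Res M U V)"

abbreviation F_tensor :: "('a, 'r, 'm) mod_presheaf \<Rightarrow>
    ('a, ('a, 'r) auslander_section, (('r \<times> 'r) \<times> 'm \<Rightarrow>\<^sub>0 int) set) mod_presheaf" where
  "F_tensor M \<equiv> tensor_presheaf \<O> \<iota> (End_tautological \<F>) M"

lemma End_tautological_smult: "smult (Sec (End_tautological \<F>) U) a = a U"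
  by (rule ext) (simp add: End_tautological_def)

lemma F_sections_simps [simp]:
  "carrier (Sec (End_tautological \<F>) U) = carrier (Sec \<F> U)"
  "f \<oplus>\<^bsub>Sec (End_tautological \<F>) U\<^esub> g = f \<oplus>\<^bsub>Sec \<F> U\<^esub> g"
  "a \<odot>\<^bsub>Sec (End_tautological \<F>) U\<^esub> f = a U f"
  "Res (End_tautological \<F>) = Res \<F>"
  by (simp_all add: End_tautological_def)

end

section \<open>The presheaf tensor product of \<F> with an \<O>-module, computed on formal
  sums\<close>

locale structure_module = locally_ringed X
  for X :: "('a, 'r) ringed_space" +
  fixes M :: "('a, 'r, 'm) mod_presheaf"
  assumes is_structure_module: "sheaf_of_left_modules (Space X) (Struct X) M"
begin

sublocale M: module_presheaf T \<O> M
  by (rule module_presheaf_of_sheaf[OF is_structure_module \<O>.is_presheaf])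

lemma M_group: "openin T U \<Longrightarrow> abelian_group (Sec M U)"
  using is_structure_module left_module.axioms(2)[of "Sec \<O> U" "Sec M U"] by (simp add: sheaf_of_left_modules_def)

lemma tensor_pair: "openin T U \<Longrightarrow> tensor_pair (Sec \<O> U) (F_sections U) (Sec M U)"
  by unfold_locales (simp_all add: \<F>.add_closed M.add_closed scalar_apply \<F>.smult_closed M.smult_closed)

lemma tensor_pair_map_res:
  assumes "openin T U" "openin T V" "V \<subseteq> U"
  shows "tensor_pair_map (Sec \<O> U) (F_sections U) (Sec M U) (Sec \<O> V) (F_sections V) (Sec M V)
    (Res \<O> U V) (Res \<F> U V) (Res M U V)"
  by (intro tensor_pair_map.intro tensor_pair assms tensor_pair_map_axioms.intro)
    (use assms in \<open>simp_all add: Pi_iff \<O>.res_closed \<F>.res_closed M.res_closed \<F>.res_add M.res_add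
      scalar_apply \<F>.res_smult M.res_smult\<close>)

lemma tensor_pair_map_act:
  assumes "openin T U" "a \<in> carrier (Sec \<A> U)"
  shows "tensor_pair_map (Sec \<O> U) (F_sections U) (Sec M U) (Sec \<O> U) (F_sections U) (Sec M U)
    (\<lambda>r. r) (a U) (\<lambda>y. y)"
  by (intro tensor_pair_map.intro tensor_pair assms tensor_pair_map_axioms.intro)
    (use assms in \<open>simp_all add: Pi_iff A_closed A_linear_add scalar_apply A_linear_smult\<close>)

lemma tensor_pair_map_hom:
  assumes "sheaf_hom T \<O> M M2 h" "structure_module X M2" "openin T U"
  shows "tensor_pair_map (Sec \<O> U) (F_sections U) (Sec M U) (Sec \<O> U) (F_sections U) (Sec M2 U)
    (\<lambda>r. r) (\<lambda>f. f) (h U)"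
  by (intro tensor_pair_map.intro tensor_pair structure_module.tensor_pair[OF assms(2)] assms(3)
      tensor_pair_map_axioms.intro)
    (use assms(3) in \<open>simp_all add: Pi_iff sheaf_hom_closed[OF assms(1)] sheaf_hom_add[OF assms(1)]
      sheaf_hom_smult[OF assms(1)]\<close>)

lemma F_tensor_carrier:
  "openin T U \<Longrightarrow> carrier (Sec (F_tensor M) U) = cls M U ` fsums M U"
  using tensor_pair.carrier_tensor_group[OF tensor_pair] by (simp add: tensor_presheaf_def Let_def)

lemma F_tensorE:
  assumes "openin T U" "t \<in> carrier (Sec (F_tensor M) U)"
  obtains c where "c \<in> fsums M U" "t = cls M U c"
  using assms F_tensor_carrier by blast

lemma cls_carrier: "\<lbrakk>openin T U; c \<in> fsums M U\<rbrakk> \<Longrightarrow> cls M U c \<in> carrier (Sec (F_tensor M) U)"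
  by (simp add: F_tensor_carrier)

lemma cls_eq_iff:
  "\<lbrakk>openin T U; c \<in> fsums M U; d \<in> fsums M U\<rbrakk> \<Longrightarrow> cls M U c = cls M U d \<longleftrightarrow> c - d \<in> ker M U"
  using tensor_pair.tensor_class_eq_iff[OF tensor_pair] by simp

lemma F_tensor_add:
  "\<lbrakk>openin T U; c \<in> fsums M U; d \<in> fsums M U\<rbrakk> \<Longrightarrow>
    cls M U c \<oplus>\<^bsub>Sec (F_tensor M) U\<^esub> cls M U d = cls M U (c + d)"
  using tensor_pair.tensor_class_add[OF tensor_pair, of U c d] by (simp add: tensor_presheaf_def Let_def)

lemma F_tensor_smult:
  "\<lbrakk>openin T U; a \<in> carrier (Sec \<A> U); c \<in> fsums M U\<rbrakk> \<Longrightarrow>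
    a \<odot>\<^bsub>Sec (F_tensor M) U\<^esub> cls M U c = cls M U (pair_map (a U) (\<lambda>y. y) c)"
  using tensor_pair_map.tensor_map_class[OF tensor_pair_map_act, of U a c]
  by (simp add: tensor_presheaf_def Let_def End_tautological_smult)

lemma F_tensor_res:
  "\<lbrakk>openin T U; openin T V; V \<subseteq> U; c \<in> fsums M U\<rbrakk> \<Longrightarrow>
    Res (F_tensor M) U V (cls M U c) = cls M V (restrict_sum M U V c)"
  using tensor_pair_map.tensor_map_class[OF tensor_pair_map_res, of U V c]
  by (simp add: tensor_presheaf_def Let_def)

lemma sums_add: "\<lbrakk>c \<in> fsums M U; d \<in> fsums M U\<rbrakk> \<Longrightarrow> c + d \<in> fsums M U"
  unfolding mem_Collect_eq by (rule keys_add_subset)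

lemma sums_diff: "\<lbrakk>c \<in> fsums M U; d \<in> fsums M U\<rbrakk> \<Longrightarrow> c - d \<in> fsums M U"
  unfolding mem_Collect_eq by (rule keys_diff_subset)

lemma restrict_sum_closed:
  "\<lbrakk>openin T U; openin T V; V \<subseteq> U; c \<in> fsums M U\<rbrakk> \<Longrightarrow> restrict_sum M U V c \<in> fsums M V"
  using tensor_pair_map.pair_map_carrier[OF tensor_pair_map_res, of U V c] by simp

lemma restrict_sum_restrict_sum:
  assumes "openin T U" "openin T V" "openin T W" "W \<subseteq> V" "V \<subseteq> U" "c \<in> fsums M U"
  shows "restrict_sum M V W (restrict_sum M U V c) = restrict_sum M U W c"
  unfolding pair_map_compose
  by (rule pair_map_cong[of _ "carrier (Sec \<F> U)" "carrier (Sec M U)"])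
    (use assms in \<open>auto simp: \<F>.res_res M.res_res\<close>)

lemma restrict_sum_ker:
  "\<lbrakk>openin T U; openin T V; V \<subseteq> U; c \<in> ker M U\<rbrakk> \<Longrightarrow> restrict_sum M U V c \<in> ker M V"
  using tensor_pair_map.pair_map_kernel[OF tensor_pair_map_res, of U V c] by simp

lemma act_sum_closed:
  "\<lbrakk>openin T U; a \<in> carrier (Sec \<A> U); c \<in> fsums M U\<rbrakk> \<Longrightarrow> pair_map (a U) (\<lambda>y. y) c \<in> fsums M U"
  using tensor_pair_map.pair_map_carrier[OF tensor_pair_map_act, of U a c] by simp

lemma ker_sums: "\<lbrakk>openin T U; c \<in> ker M U\<rbrakk> \<Longrightarrow> c \<in> fsums M U"
  using tensor_pair.kernel_keys[OF tensor_pair] by simp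

text \<open>Every section is the class of a formal sum, which reduces the laws to identities between
  \<open>pair_map\<close>s; compatibility of the action with restriction is naturality of the
  endomorphism \<open>a\<close>.\<close>

lemma F_tensor_module_presheaf: "module_presheaf T \<A> (F_tensor M)"
proof
  show "is_presheaf T \<A>" by (rule A_presheaf)
  show "is_presheaf T (F_tensor M)"
    unfolding is_presheaf_def
  proof (intro conjI allI impI ballI; (elim conjE)?)
    fix U V assume U: "openin T U" "openin T V" "V \<subseteq> U"
    show "Res (F_tensor M) U V \<in> carrier (Sec (F_tensor M) U) \<rightarrow> carrier (Sec (F_tensor M) V)"
    proof
      fix t assume "t \<in> carrier (Sec (F_tensor M) U)"
      then obtain c where "c \<in> fsums M U" "t = cls M U c" using F_tensorE U by blast
      then show "Res (F_tensor M) U V t \<in> carrier (Sec (F_tensor M) V)"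
        using U restrict_sum_closed[OF U] by (simp only: F_tensor_res cls_carrier)
    qed
  next
    fix U t assume U: "openin T U" "t \<in> carrier (Sec (F_tensor M) U)"
    then obtain c where c: "c \<in> fsums M U" "t = cls M U c" using F_tensorE by blast
    have "restrict_sum M U U c = c"
      by (rule pair_map_id[of _ "carrier (Sec \<F> U)" "carrier (Sec M U)"])
        (use U c in \<open>auto simp: \<F>.res_id M.res_id\<close>)
    then show "Res (F_tensor M) U U t = t" using U c F_tensor_res[of U U c] by simp
  next
    fix U V W t assume U: "openin T U" "openin T V" "openin T W" "W \<subseteq> V" "V \<subseteq> U" "t \<in> carrier (Sec (F_tensor M) U)"
    then obtain c where c: "c \<in> fsums M U" "t = cls M U c" using F_tensorE by blast
    have "W \<subseteq> U" using U by blast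
    then show "Res (F_tensor M) V W (Res (F_tensor M) U V t) = Res (F_tensor M) U W t"
      using U c restrict_sum_closed[OF U(1,2,5) c(1)] restrict_sum_restrict_sum[OF U(1-5) c(1)]
      by (simp only: F_tensor_res)
  qed
  fix U s assume U: "openin T U" "s \<in> carrier (Sec (F_tensor M) U)"
  then obtain c where c: "c \<in> fsums M U" "s = cls M U c" using F_tensorE by blast
  show "s \<oplus>\<^bsub>Sec (F_tensor M) U\<^esub> t \<in> carrier (Sec (F_tensor M) U)" if t: "t \<in> carrier (Sec (F_tensor M) U)" for t
  proof -
    obtain d where d: "d \<in> fsums M U" "t = cls M U d" using F_tensorE U t by blast
    show ?thesis using U(1) c d sums_add[OF c(1) d(1)] by (simp only: F_tensor_add cls_carrier)
  qed
  show "a \<odot>\<^bsub>Sec (F_tensor M) U\<^esub> s \<in> carrier (Sec (F_tensor M) U)" if a: "a \<in> carrier (Sec \<A> U)" for a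
    using U(1) c a act_sum_closed[OF U(1) a c(1)] by (simp only: F_tensor_smult cls_carrier)
  fix V assume V: "openin T V" "V \<subseteq> U"
  note rc = restrict_sum_closed[OF U(1) V c(1)]
  show "Res (F_tensor M) U V (s \<oplus>\<^bsub>Sec (F_tensor M) U\<^esub> t) =
      Res (F_tensor M) U V s \<oplus>\<^bsub>Sec (F_tensor M) V\<^esub> Res (F_tensor M) U V t"
    if t: "t \<in> carrier (Sec (F_tensor M) U)" for t
  proof -
    obtain d where d: "d \<in> fsums M U" "t = cls M U d" using F_tensorE U t by blast
    show ?thesis using U(1) V c d sums_add[OF c(1) d(1)] rc restrict_sum_closed[OF U(1) V d(1)]
      by (simp only: F_tensor_add F_tensor_res frag_extend_add)
  qed
  show "Res (F_tensor M) U V (a \<odot>\<^bsub>Sec (F_tensor M) U\<^esub> s) =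
      Res \<A> U V a \<odot>\<^bsub>Sec (F_tensor M) V\<^esub> Res (F_tensor M) U V s"
    if a: "a \<in> carrier (Sec \<A> U)" for a
  proof -
    have "Res \<A> U V a \<in> carrier (Sec \<A> V)"
      using presheaf.res_closed[OF presheaf.intro[OF A_presheaf] U(1) V a] .
    moreover have "restrict_sum M U V (pair_map (a U) (\<lambda>y. y) c) =
        pair_map (Res \<A> U V a V) (\<lambda>y. y) (restrict_sum M U V c)"
      unfolding pair_map_compose
      by (rule pair_map_cong[of _ "carrier (Sec \<F> U)" "carrier (Sec M U)"])
        (use U V a c in \<open>auto simp: A_natural A_res on_opens_apply\<close>)
    ultimately show ?thesis
      using U(1) V c a rc act_sum_closed[OF U(1) a c(1)] by (simp only: F_tensor_smult F_tensor_res)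
  qed
qed

end

subsection \<open>Right exactness\<close>

text \<open>The input for right exactness: exactness in the middle and surjectivity on the right,
  both after shrinking.\<close>

locale locally_exact_sequence =
  locally_ringed X + L: structure_module X M' + M: structure_module X M + R: structure_module X M''
  for X :: "('a, 'r) ringed_space" and M' :: "('a, 'r, 'm1) mod_presheaf"
    and M :: "('a, 'r, 'm) mod_presheaf" and M'' :: "('a, 'r, 'm2) mod_presheaf" +
  fixes i :: "'a set \<Rightarrow> 'm1 \<Rightarrow> 'm" and p :: "'a set \<Rightarrow> 'm \<Rightarrow> 'm2"
  assumes i_hom: "sheaf_hom (Space X) (Struct X) M' M i" and p_hom: "sheaf_hom (Space X) (Struct X) M M'' p"
    and exact: "\<lbrakk>openin (Space X) U; x \<in> U; y \<in> carrier (Sec M U); p U y = \<zero>\<^bsub>Sec M'' U\<^esub>\<rbrakk> \<Longrightarrow>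
      \<forall>\<^sub>F W in nhd (Space X) x. Res M U W y \<in> i W ` carrier (Sec M' W)"
    and surjective: "\<lbrakk>openin (Space X) U; x \<in> U; z \<in> carrier (Sec M'' U)\<rbrakk> \<Longrightarrow>
      \<forall>\<^sub>F W in nhd (Space X) x. Res M'' U W z \<in> p W ` carrier (Sec M W)"
begin

abbreviation "i_sum U \<equiv> pair_map (\<lambda>f. f) (i U)"
abbreviation "p_sum U \<equiv> pair_map (\<lambda>f. f) (p U)"

text \<open>A defining relation over \<open>M''\<close> involves at most two sections of
  \<open>M''\<close>. Near \<open>x\<close> these lift along \<open>p\<close>, and the same relation
  between the lifts belongs to the kernel over \<open>M\<close>.\<close>

lemma kernel_lift:
  assumes U: "openin T U" "x \<in> U" and c: "c \<in> ker M'' U"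
  shows "\<forall>\<^sub>F W in nhd T x. \<exists>k\<in>ker M W. p_sum W k = restrict_sum M'' U W c"
proof -
  note nhd_U = eventually_nhd_subset[OF U]
  note pair = M.tensor_pair
  show ?thesis using c
  proof (induction rule: tensor_pair.tensor_kernel_induct[OF R.tensor_pair[OF U(1)], consumes 1])
    case 1
    then show ?case using nhd_U
      by eventually_elim (use tensor_pair.kernel_zero[OF pair] in \<open>auto intro!: bexI[of _ 0]\<close>)
  next
    case (2 f f' z)
    then have f: "f \<in> carrier (Sec \<F> U)" "f' \<in> carrier (Sec \<F> U)" by auto
    show ?case using surjective[OF U 2(3)] nhd_U
    proof eventually_elim
      case (elim W)
      then obtain y where y: "y \<in> carrier (Sec M W)" "p W y = Res M'' U W z" by auto
      note fW = \<F>.res_closed[OF U(1) _ _ f(1), of W] \<F>.res_closed[OF U(1) _ _ f(2), of W]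
      show ?case
        using tensor_pair.kernel_left_add[OF pair, of W "Res \<F> U W f" "Res \<F> U W f'" y] elim fW f y U
        by (intro bexI) (auto simp: frag_extend_diff \<F>.res_add)
    qed
  next
    case (3 f z z')
    then have f: "f \<in> carrier (Sec \<F> U)" by auto
    show ?case using surjective[OF U 3(2)] surjective[OF U 3(3)] nhd_U
    proof eventually_elim
      case (elim W)
      then obtain y y' where y: "y \<in> carrier (Sec M W)" "p W y = Res M'' U W z"
        "y' \<in> carrier (Sec M W)" "p W y' = Res M'' U W z'" by auto
      note fW = \<F>.res_closed[OF U(1) _ _ f, of W]
      show ?case
        using tensor_pair.kernel_right_add[OF pair, of W "Res \<F> U W f" y y'] elim fW f y U 3
        by (intro bexI) (auto simp: frag_extend_diff R.M.res_add sheaf_hom_add[OF p_hom])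
    qed
  next
    case (4 r f z)
    then have f: "f \<in> carrier (Sec \<F> U)" by auto
    show ?case using surjective[OF U 4(3)] nhd_U
    proof eventually_elim
      case (elim W)
      then obtain y where y: "y \<in> carrier (Sec M W)" "p W y = Res M'' U W z" by auto
      note fW = \<F>.res_closed[OF U(1) _ _ f, of W] \<O>.res_closed[OF U(1) _ _ 4(1), of W]
      show ?case
        using tensor_pair.kernel_balanced[OF pair, of W "Res \<O> U W r" "Res \<F> U W f" y] elim fW f y U 4
        by (intro bexI) (auto simp: frag_extend_diff R.M.res_smult sheaf_hom_smult[OF p_hom]
            scalar_apply \<F>.res_smult)
    qed
  next
    case (5 c)
    show ?case using 5(2) nhd_U
    proof eventually_elim
      case (elim W)
      then obtain k where "k \<in> ker M W" "p_sum W k = restrict_sum M'' U W c" by blast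
      then show ?case using elim tensor_pair.kernel_uminus[OF pair, of W k]
        by (intro bexI[of _ "- k"]) (auto simp: frag_extend_minus)
    qed
  next
    case (6 c d)
    show ?case using 6(3,4) nhd_U
    proof eventually_elim
      case (elim W)
      then obtain k l where "k \<in> ker M W" "p_sum W k = restrict_sum M'' U W c"
        "l \<in> ker M W" "p_sum W l = restrict_sum M'' U W d" by blast
      then show ?case using elim tensor_pair.kernel_add[OF pair, of W k l]
        by (intro bexI[of _ "k + l"]) (auto simp: frag_extend_add)
    qed
  qed
qed

text \<open>A formal sum killed by \<open>p\<close> is a combination of differences \<open>(f, y) - (f, y')\<close> with
  \<open>p y = p y'\<close>: take for \<open>(f, y')\<close> a fixed representative of the fibre of \<open>(f, y)\<close>.\<close>

lemma formal_sum_exact: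
  assumes U: "openin T U" "x \<in> U" and c: "c \<in> fsums M U" and pc: "p_sum U c = 0"
  shows "\<forall>\<^sub>F W in nhd T x. \<exists>c'\<in>fsums M' W. restrict_sum M U W c - i_sum W c' \<in> ker M W"
proof -
  note nhd_U = eventually_nhd_subset[OF U]
  note pair = M.tensor_pair
  define q where "q = (\<lambda>(f :: 'r \<times> 'r, y). (f, p U y))"
  define rep where "rep = inv_into (carrier (Sec \<F> U) \<times> carrier (Sec M U)) q"
  \<comment> \<open>Subtracting the chosen representatives makes the claim additive in
    \<open>c\<close>, so it may be checked on single pairs; the condition on
    \<open>p_sum U c\<close> is used only afterwards.\<close>
  have fibre: "\<forall>\<^sub>F W in nhd T x. \<exists>c'\<in>fsums M' W.
      restrict_sum M U W (c - frag_extend (frag_of \<circ> rep \<circ> q) c) - i_sum W c' \<in> ker M W"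
    if "Poly_Mapping.keys c \<subseteq> carrier (Sec \<F> U) \<times> carrier (Sec M U)" for c
  proof (rule free_Abelian_group_induct[OF that])
    show "\<forall>\<^sub>F W in nhd T x. \<exists>c'\<in>fsums M' W.
        restrict_sum M U W (0 - frag_extend (frag_of \<circ> rep \<circ> q) 0) - i_sum W c' \<in> ker M W"
      using nhd_U
      by eventually_elim (use tensor_pair.kernel_zero[OF pair] in \<open>auto intro!: exI[of _ 0]\<close>)
  next
    fix c d
    assume "\<forall>\<^sub>F W in nhd T x. \<exists>c'\<in>fsums M' W.
        restrict_sum M U W (c - frag_extend (frag_of \<circ> rep \<circ> q) c) - i_sum W c' \<in> ker M W"
      "\<forall>\<^sub>F W in nhd T x. \<exists>c'\<in>fsums M' W.
        restrict_sum M U W (d - frag_extend (frag_of \<circ> rep \<circ> q) d) - i_sum W c' \<in> ker M W"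
    then show "\<forall>\<^sub>F W in nhd T x. \<exists>c'\<in>fsums M' W.
        restrict_sum M U W (c - d - frag_extend (frag_of \<circ> rep \<circ> q) (c - d)) - i_sum W c' \<in> ker M W"
      using nhd_U
    proof eventually_elim
      case (elim W)
      then obtain c' d' where cd: "c' \<in> fsums M' W" "d' \<in> fsums M' W"
        "restrict_sum M U W (c - frag_extend (frag_of \<circ> rep \<circ> q) c) - i_sum W c' \<in> ker M W"
        "restrict_sum M U W (d - frag_extend (frag_of \<circ> rep \<circ> q) d) - i_sum W d' \<in> ker M W" by blast
      have "(restrict_sum M U W (c - frag_extend (frag_of \<circ> rep \<circ> q) c) - i_sum W c') -
          (restrict_sum M U W (d - frag_extend (frag_of \<circ> rep \<circ> q) d) - i_sum W d') \<in> ker M W"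
        by (rule tensor_pair.kernel_diff[OF pair cd(3,4)]) (use elim in simp)
      moreover have "(restrict_sum M U W (c - frag_extend (frag_of \<circ> rep \<circ> q) c) - i_sum W c') -
          (restrict_sum M U W (d - frag_extend (frag_of \<circ> rep \<circ> q) d) - i_sum W d') =
          restrict_sum M U W (c - d - frag_extend (frag_of \<circ> rep \<circ> q) (c - d)) - i_sum W (c' - d')"
        by (simp only: frag_extend_diff) (simp add: algebra_simps)
      ultimately show ?case using L.sums_diff[OF cd(1,2)] by (intro bexI[of _ "c' - d'"]) simp_all
    qed
  next
    fix z assume z: "z \<in> carrier (Sec \<F> U) \<times> carrier (Sec M U)"
    obtain f y where fy: "z = (f, y)" "f \<in> carrier (Sec \<F> U)" "y \<in> carrier (Sec M U)" using z by auto
    have "rep (q z) \<in> carrier (Sec \<F> U) \<times> carrier (Sec M U)" "q (rep (q z)) = q z"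
      unfolding rep_def using z by (auto intro: inv_into_into f_inv_into_f simp: image_iff)
    then obtain y' where y': "rep (q z) = (f, y')" "y' \<in> carrier (Sec M U)" "p U y' = p U y"
      by (cases "rep (q z)") (auto simp: q_def fy)
    interpret MU: abelian_group "Sec M U" using M.M_group U by blast
    interpret RU: abelian_group "Sec M'' U" using R.M_group U by blast
    \<comment> \<open>The difference \<open>w\<close> of two points of one fibre is killed by
      \<open>p\<close>, so it comes locally from \<open>M'\<close>. Additivity in the second factor
      identifies \<open>(f, y) - (f, y')\<close> with \<open>(f, w)\<close> modulo the
      kernel.\<close>
    define w where "w = y \<oplus>\<^bsub>Sec M U\<^esub> (\<ominus>\<^bsub>Sec M U\<^esub> y')"
    have w: "w \<in> carrier (Sec M U)" "w \<oplus>\<^bsub>Sec M U\<^esub> y' = y"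
      using fy y' by (auto simp: w_def MU.a_assoc MU.l_neg)
    have "p U w \<oplus>\<^bsub>Sec M'' U\<^esub> p U y' = p U y'"
      using sheaf_hom_add[OF p_hom U(1) w(1) y'(2)] w(2) y'(3) by simp
    then have "p U w = \<zero>\<^bsub>Sec M'' U\<^esub>"
      using sheaf_hom_closed[OF p_hom U(1)] w y' fy by simp
    from exact[OF U w(1) this] nhd_U
    show "\<forall>\<^sub>F W in nhd T x. \<exists>c'\<in>fsums M' W.
        restrict_sum M U W (frag_of z - frag_extend (frag_of \<circ> rep \<circ> q) (frag_of z)) - i_sum W c' \<in> ker M W"
    proof eventually_elim
      case (elim W)
      then obtain w' where w': "w' \<in> carrier (Sec M' W)" "i W w' = Res M U W w" by auto
      note cl = \<F>.res_closed[OF U(1) _ _ fy(2), of W] M.M.res_closed[OF U(1) _ _ w(1), of W]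
        M.M.res_closed[OF U(1) _ _ y'(2), of W]
      have "Res M U W y = Res M U W w \<oplus>\<^bsub>Sec M W\<^esub> Res M U W y'"
        using w y' U elim by (simp flip: M.M.res_add)
      then have "frag_of (Res \<F> U W f, Res M U W y) - frag_of (Res \<F> U W f, Res M U W w) -
          frag_of (Res \<F> U W f, Res M U W y') \<in> ker M W"
        using tensor_pair.kernel_right_add[OF pair, of W "Res \<F> U W f" "Res M U W w" "Res M U W y'"] elim cl by simp
      then show ?case
        using w' cl elim
        by (intro bexI[of _ "frag_of (Res \<F> U W f, w')"])
          (simp_all add: fy y'[unfolded fy] frag_extend_diff algebra_simps)
    qed
  qed
  \<comment> \<open>The representative of a pair depends only on its image under \<open>q\<close>,
    so the subtracted sum factors through \<open>p_sum U c\<close>, which vanishes.\<close>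
  have "frag_extend (frag_of \<circ> rep \<circ> q) c = 0"
  proof -
    have "frag_extend (frag_of \<circ> q) c = p_sum U c"
      by (rule frag_extend_eq) (auto simp: q_def)
    then show ?thesis using pc frag_extend_compose[of "frag_of \<circ> rep" q c] by (simp add: comp_assoc)
  qed
  moreover have "Poly_Mapping.keys c \<subseteq> carrier (Sec \<F> U) \<times> carrier (Sec M U)" using c by simp
  note fibre[OF this]
  ultimately show ?thesis by (simp only: diff_0_right)
qed

end

section \<open>The essential image\<close>

context locally_ringed
begin

text \<open>The counit \<open>\<F> \<otimes> corner N \<rightarrow> N\<close> of the adjunction between \<open>\<F> \<otimes> -\<close> and \<open>corner\<close> is
  locally injective and locally surjective.\<close>

definition counit_bijective :: "('a, ('a, 'r) auslander_section, 'n) mod_presheaf \<Rightarrow> bool" where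
  "counit_bijective N \<longleftrightarrow>
     (\<forall>U x c. openin T U \<and> x \<in> U \<and> c \<in> fsums (corner N) U \<and> evaluation N U c = \<zero>\<^bsub>Sec N U\<^esub> \<longrightarrow>
        (\<forall>\<^sub>F W in nhd T x. restrict_sum (corner N) U W c \<in> ker (corner N) W)) \<and>
     (\<forall>U x n. openin T U \<and> x \<in> U \<and> n \<in> carrier (Sec N U) \<longrightarrow>
        (\<forall>\<^sub>F W in nhd T x. Res N U W n \<in> evaluation N W ` fsums (corner N) W))"

lemma
  assumes "counit_bijective N" "openin T U" "x \<in> U"
  shows counit_inj: "\<lbrakk>c \<in> fsums (corner N) U; evaluation N U c = \<zero>\<^bsub>Sec N U\<^esub>\<rbrakk> \<Longrightarrow>
      \<forall>\<^sub>F W in nhd T x. restrict_sum (corner N) U W c \<in> ker (corner N) W"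
    and counit_surj: "n \<in> carrier (Sec N U) \<Longrightarrow>
      \<forall>\<^sub>F W in nhd T x. Res N U W n \<in> evaluation N W ` fsums (corner N) W"
  using assms unfolding counit_bijective_def by blast+

text \<open>A formal sum has finite support, so its second components lift over a common
  neighbourhood.\<close>

lemma formal_sum_lift:
  assumes U: "openin T U" "x \<in> U" and c: "c \<in> fsums M2 U"
    and surj: "\<And>y. y \<in> carrier (Sec M2 U) \<Longrightarrow> \<forall>\<^sub>F W in nhd T x. Res M2 U W y \<in> h W ` carrier (Sec M W)"
  shows "\<forall>\<^sub>F W in nhd T x. \<exists>d\<in>fsums M W. pair_map (\<lambda>f. f) (h W) d = restrict_sum M2 U W c"
proof -
  have "Poly_Mapping.keys c \<subseteq> carrier (Sec \<F> U) \<times> carrier (Sec M2 U)" using c by simp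
  then show ?thesis
  proof (rule free_Abelian_group_induct)
    show "\<forall>\<^sub>F W in nhd T x. \<exists>d\<in>fsums M W. pair_map (\<lambda>f. f) (h W) d = restrict_sum M2 U W 0"
      by (rule always_eventually) (auto intro!: exI[of _ 0])
  next
    fix c c'
    assume "\<forall>\<^sub>F W in nhd T x. \<exists>d\<in>fsums M W. pair_map (\<lambda>f. f) (h W) d = restrict_sum M2 U W c"
      "\<forall>\<^sub>F W in nhd T x. \<exists>d\<in>fsums M W. pair_map (\<lambda>f. f) (h W) d = restrict_sum M2 U W c'"
    then show "\<forall>\<^sub>F W in nhd T x. \<exists>d\<in>fsums M W. pair_map (\<lambda>f. f) (h W) d = restrict_sum M2 U W (c - c')"
    proof eventually_elim
      case (elim W)
      then obtain d d' where d: "d \<in> fsums M W" "pair_map (\<lambda>f. f) (h W) d = restrict_sum M2 U W c"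
        "d' \<in> fsums M W" "pair_map (\<lambda>f. f) (h W) d' = restrict_sum M2 U W c'" by blast
      have "d - d' \<in> fsums M W" using d(1,3) unfolding mem_Collect_eq by (rule keys_diff_subset)
      then show ?case using d by (intro bexI[of _ "d - d'"]) (simp_all add: frag_extend_diff)
    qed
  next
    fix z assume "z \<in> carrier (Sec \<F> U) \<times> carrier (Sec M2 U)"
    then obtain f y where fy: "z = (f, y)" "f \<in> carrier (Sec \<F> U)" "y \<in> carrier (Sec M2 U)" by auto
    show "\<forall>\<^sub>F W in nhd T x. \<exists>d\<in>fsums M W. pair_map (\<lambda>f. f) (h W) d = restrict_sum M2 U W (frag_of z)"
      using surj[OF fy(3)] eventually_nhd_subset[OF U]
    proof eventually_elim
      case (elim W)
      then obtain m where "m \<in> carrier (Sec M W)" "Res M2 U W y = h W m" by auto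
      then show ?case using elim \<F>.res_closed[OF U(1) _ _ fy(2), of W]
        by (intro bexI[of _ "frag_of (Res \<F> U W f, m)"]) (simp_all add: fy)
    qed
  qed
qed

end

context auslander_module
begin

sublocale C: structure_module X "corner N"
  by unfold_locales (rule corner_sheaf_of_left_modules)

lemma fsums_corner: "c \<in> fsums (corner N) U \<Longrightarrow> Poly_Mapping.keys c \<subseteq> carrier (Sec \<F> U) \<times> carrier (Sec N U)"
  by auto

lemma smult_hom: "\<lbrakk>openin T U; a \<in> carrier (Sec \<A> U)\<rbrakk> \<Longrightarrow>
    smult (Sec N U) a \<in> hom (add_monoid (Sec N U)) (add_monoid (Sec N U))"
  by (rule homI) (simp_all add: N.smult_closed smult_add)

lemma res_hom: "\<lbrakk>openin T U; openin T V; V \<subseteq> U\<rbrakk> \<Longrightarrow>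
    Res N U V \<in> hom (add_monoid (Sec N U)) (add_monoid (Sec N V))"
  by (rule homI) (simp_all add: N.res_closed N.res_add)

lemma evaluation_res:
  assumes U: "openin T U" "openin T V" "V \<subseteq> U" and c: "Poly_Mapping.keys c \<subseteq> carrier (Sec \<F> U) \<times> carrier (Sec N U)"
  shows "Res N U V (evaluation N U c) = evaluation N V (pair_map (Res \<F> U V) (Res N U V) c)"
proof -
  have "(Res N U V \<circ> evaluation N U) c = (evaluation N V \<circ> pair_map (Res \<F> U V) (Res N U V)) c"
  proof (rule free_Abelian_group_hom_eq[OF _ _ _ _ c, where H = "add_monoid (Sec N V)"])
    show "Res N U V \<circ> evaluation N U \<in> hom (free_Abelian_group (carrier (Sec \<F> U) \<times> carrier (Sec N U))) (add_monoid (Sec N V))"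
      by (rule hom_compose[OF evaluation_hom res_hom]) (use U in auto)
    show "evaluation N V \<circ> pair_map (Res \<F> U V) (Res N U V) \<in>
        hom (free_Abelian_group (carrier (Sec \<F> U) \<times> carrier (Sec N U))) (add_monoid (Sec N V))"
      by (rule hom_compose[OF pair_map_hom evaluation_hom]) (use U \<F>.res_closed N.res_closed in auto)
    show "group (add_monoid (Sec N V))" using U N_group abelian_group.a_group by blast
    fix z assume "z \<in> carrier (Sec \<F> U) \<times> carrier (Sec N U)"
    then show "(Res N U V \<circ> evaluation N U) (frag_of z) =
        (evaluation N V \<circ> pair_map (Res \<F> U V) (Res N U V)) (frag_of z)"
      using U by (auto simp: evaluation_frag \<F>.res_closed N.res_closed N.res_smult section_endo_carrier section_endo_res)
  qed
  then show ?thesis by simp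
qed

text \<open>\<A>-linearity of the counit; on a single pair it is \<open>endo_image\<close>.\<close>

lemma evaluation_act:
  assumes U: "openin T U" "a \<in> carrier (Sec \<A> U)" and c: "Poly_Mapping.keys c \<subseteq> carrier (Sec \<F> U) \<times> carrier (Sec N U)"
  shows "a \<odot>\<^bsub>Sec N U\<^esub> evaluation N U c = evaluation N U (pair_map (a U) (\<lambda>y. y) c)"
proof -
  have "(smult (Sec N U) a \<circ> evaluation N U) c = (evaluation N U \<circ> pair_map (a U) (\<lambda>y. y)) c"
  proof (rule free_Abelian_group_hom_eq[OF _ _ _ _ c, where H = "add_monoid (Sec N U)"])
    show "smult (Sec N U) a \<circ> evaluation N U \<in> hom (free_Abelian_group (carrier (Sec \<F> U) \<times> carrier (Sec N U))) (add_monoid (Sec N U))"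
      by (rule hom_compose[OF evaluation_hom smult_hom]) (use U in auto)
    show "evaluation N U \<circ> pair_map (a U) (\<lambda>y. y) \<in>
        hom (free_Abelian_group (carrier (Sec \<F> U) \<times> carrier (Sec N U))) (add_monoid (Sec N U))"
      by (rule hom_compose[OF pair_map_hom evaluation_hom]) (use U A_closed in auto)
    show "group (add_monoid (Sec N U))" using U N_group abelian_group.a_group by blast
    fix z assume "z \<in> carrier (Sec \<F> U) \<times> carrier (Sec N U)"
    then show "(smult (Sec N U) a \<circ> evaluation N U) (frag_of z) =
        (evaluation N U \<circ> pair_map (a U) (\<lambda>y. y)) (frag_of z)"
      using U by (auto simp: evaluation_frag A_closed endo_image)
  qed
  then show ?thesis by simp
qed

text \<open>Naturality of the counit in the module: it provides the commuting squares of the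
  chase.\<close>

lemma evaluation_hom_natural:
  assumes h: "sheaf_hom T \<A> N N2 h" and N2: "auslander_module X N2" and U: "openin T U"
    and c: "Poly_Mapping.keys c \<subseteq> carrier (Sec \<F> U) \<times> carrier (Sec N U)"
  shows "h U (evaluation N U c) = evaluation N2 U (pair_map (\<lambda>f. f) (h U) c)"
proof -
  interpret N2: auslander_module X N2 by fact
  have hU: "h U \<in> hom (add_monoid (Sec N U)) (add_monoid (Sec N2 U))"
    by (rule homI) (use U in \<open>simp_all add: sheaf_hom_closed[OF h] sheaf_hom_add[OF h]\<close>)
  have "(h U \<circ> evaluation N U) c = (evaluation N2 U \<circ> pair_map (\<lambda>f. f) (h U)) c"
  proof (rule free_Abelian_group_hom_eq[OF _ _ _ _ c, where H = "add_monoid (Sec N2 U)"])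
    show "h U \<circ> evaluation N U \<in> hom (free_Abelian_group (carrier (Sec \<F> U) \<times> carrier (Sec N U))) (add_monoid (Sec N2 U))"
      by (rule hom_compose[OF evaluation_hom hU]) (use U in auto)
    show "evaluation N2 U \<circ> pair_map (\<lambda>f. f) (h U) \<in>
        hom (free_Abelian_group (carrier (Sec \<F> U) \<times> carrier (Sec N U))) (add_monoid (Sec N2 U))"
      by (rule hom_compose[OF pair_map_hom N2.evaluation_hom]) (use U sheaf_hom_closed[OF h] in auto)
    show "group (add_monoid (Sec N2 U))" using U N2.N_group abelian_group.a_group by blast
    fix z assume "z \<in> carrier (Sec \<F> U) \<times> carrier (Sec N U)"
    then show "(h U \<circ> evaluation N U) (frag_of z) = (evaluation N2 U \<circ> pair_map (\<lambda>f. f) (h U)) (frag_of z)"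
      using U by (auto simp: evaluation_frag N2.evaluation_frag sheaf_hom_closed[OF h] sheaf_hom_smult[OF h] section_endo_carrier)
  qed
  then show ?thesis by simp
qed

text \<open>The counit descends to the tensor product: it is biadditive by the module laws and
  balanced by \<open>endo_scalar\<close>.\<close>

lemma evaluation_ker:
  assumes U: "openin T U" and c: "c \<in> ker (corner N) U"
  shows "evaluation N U c = \<zero>\<^bsub>Sec N U\<^esub>"
proof -
  interpret abelian_group "Sec N U" using N_group U by blast
  have cancel: "(a \<oplus>\<^bsub>Sec N U\<^esub> b) \<ominus>\<^bsub>Sec N U\<^esub> a \<ominus>\<^bsub>Sec N U\<^esub> b = \<zero>\<^bsub>Sec N U\<^esub>"
    if "a \<in> carrier (Sec N U)" "b \<in> carrier (Sec N U)" for a b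
    using that r_neg[of "a \<oplus>\<^bsub>Sec N U\<^esub> b"] by (simp add: a_minus_def minus_add a_assoc)
  have cancel2: "a \<ominus>\<^bsub>Sec N U\<^esub> a = \<zero>\<^bsub>Sec N U\<^esub>" if "a \<in> carrier (Sec N U)" for a
    using that by (simp add: a_minus_def r_neg)
  show ?thesis using c
  proof (induction rule: tensor_pair.tensor_kernel_induct[OF C.tensor_pair[OF U], consumes 1])
    case 1
    then show ?case using U by (rule evaluation_zero)
  next
    case (2 f f' y)
    then show ?case using U
      by (simp add: evaluation_diff keys_diff_subset evaluation_frag \<F>.add_closed endo_add_left cancel endo_closed)
  next
    case (3 f y y')
    then show ?case using U
      by (simp add: evaluation_diff keys_diff_subset evaluation_frag N.add_closed smult_add section_endo_carrier cancel endo_closed)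
  next
    case (4 r f y)
    then show ?case using U
      by (simp add: evaluation_diff evaluation_frag scalar_apply \<F>.smult_closed scalar_closed endo_scalar endo_closed cancel2)
  next
    case (5 c)
    then show ?case
      using U evaluation_diff[OF U, of 0 c] fsums_corner[OF C.ker_sums[OF U 5(1)]] cancel2
      by (simp add: evaluation_zero)
  next
    case (6 c d)
    then show ?case
      using U fsums_corner[OF C.ker_sums[OF U 6(1)]] fsums_corner[OF C.ker_sums[OF U 6(2)]]
      by (simp add: evaluation_add)
  qed
qed

text \<open>An \<A>-linear map commutes with e and so preserves its fixed sections.\<close>

lemma corner_hom:
  assumes h: "sheaf_hom T \<A> N N2 h"
  shows "sheaf_hom T \<O> (corner N) (corner N2) h"
  unfolding sheaf_hom_def
  by (auto simp: sheaf_hom_closed[OF h] sheaf_hom_add[OF h] sheaf_hom_res[OF h] scalar_carrier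
      section_endo_carrier unit_section_carrier simp flip: sheaf_hom_smult[OF h])

theorem sheaf_isomorphic_of_counit_bijective:
  assumes "counit_bijective N"
  shows "sheaf_isomorphic T \<A> (F_functor X (corner N)) N"
proof -
  interpret P: module_presheaf T \<A> "F_tensor (corner N)" by (rule C.F_tensor_module_presheaf)
  \<comment> \<open>The counit on classes is evaluation at a chosen representative; by
    \<open>evaluation_ker\<close> the choice does not matter.\<close>
  define \<beta> where "\<beta> U t = evaluation N U (SOME c. c \<in> fsums (corner N) U \<and> t = cls (corner N) U c)" for U t
  have \<beta>: "\<beta> U (cls (corner N) U c) = evaluation N U c" if U: "openin T U" and c: "c \<in> fsums (corner N) U" for U c
  proof -
    interpret abelian_group "Sec N U" using N_group U by blast
    define d where "d = (SOME d. d \<in> fsums (corner N) U \<and> cls (corner N) U c = cls (corner N) U d)"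
    have d: "d \<in> fsums (corner N) U" "cls (corner N) U d = cls (corner N) U c"
      using someI[of "\<lambda>d. d \<in> fsums (corner N) U \<and> cls (corner N) U c = cls (corner N) U d" c] c
      unfolding d_def by auto
    then have "d - c \<in> ker (corner N) U" using C.cls_eq_iff[OF U d(1) c] by simp
    then have "evaluation N U d \<ominus>\<^bsub>Sec N U\<^esub> evaluation N U c = \<zero>\<^bsub>Sec N U\<^esub>"
      using evaluation_ker[OF U] evaluation_diff[OF U fsums_corner[OF d(1)] fsums_corner[OF c]] by simp
    then have "evaluation N U d = evaluation N U c"
      using minus_equality[of "evaluation N U d" "\<ominus>\<^bsub>Sec N U\<^esub> evaluation N U c"]
        evaluation_closed[OF U fsums_corner[OF d(1)]] evaluation_closed[OF U fsums_corner[OF c]]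
      by (simp add: a_minus_def)
    then show ?thesis by (simp add: \<beta>_def d_def)
  qed
  have "sheaf_hom T \<A> (F_tensor (corner N)) N \<beta>"
    unfolding sheaf_hom_def
  proof (intro conjI allI impI ballI; (elim conjE)?)
    fix U assume U: "openin T U"
    show "\<beta> U \<in> carrier (Sec (F_tensor (corner N)) U) \<rightarrow> carrier (Sec N U)"
    proof
      fix t assume "t \<in> carrier (Sec (F_tensor (corner N)) U)"
      then obtain c where "c \<in> fsums (corner N) U" "t = cls (corner N) U c" using C.F_tensorE U by blast
      then show "\<beta> U t \<in> carrier (Sec N U)" using evaluation_closed[OF U fsums_corner] by (simp only: \<beta>[OF U])
    qed
    show "\<beta> U (s \<oplus>\<^bsub>Sec (F_tensor (corner N)) U\<^esub> t) = \<beta> U s \<oplus>\<^bsub>Sec N U\<^esub> \<beta> U t"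
      if st: "s \<in> carrier (Sec (F_tensor (corner N)) U)" "t \<in> carrier (Sec (F_tensor (corner N)) U)" for s t
    proof -
      obtain c where c: "c \<in> fsums (corner N) U" "s = cls (corner N) U c" using C.F_tensorE U st(1) by blast
      obtain d where d: "d \<in> fsums (corner N) U" "t = cls (corner N) U d" using C.F_tensorE U st(2) by blast
      show ?thesis using U c d C.sums_add[OF c(1) d(1)] evaluation_add[OF U fsums_corner[OF c(1)] fsums_corner[OF d(1)]]
        by (simp only: C.F_tensor_add \<beta>)
    qed
    show "\<beta> U (a \<odot>\<^bsub>Sec (F_tensor (corner N)) U\<^esub> t) = a \<odot>\<^bsub>Sec N U\<^esub> \<beta> U t"
      if at: "a \<in> carrier (Sec \<A> U)" "t \<in> carrier (Sec (F_tensor (corner N)) U)" for a t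
    proof -
      obtain c where c: "c \<in> fsums (corner N) U" "t = cls (corner N) U c" using C.F_tensorE U at(2) by blast
      show ?thesis using U c at C.act_sum_closed[OF U at(1) c(1)] evaluation_act[OF U at(1) fsums_corner[OF c(1)]]
        by (simp only: C.F_tensor_smult \<beta>)
    qed
  next
    fix U V t assume U: "openin T U" "openin T V" "V \<subseteq> U" "t \<in> carrier (Sec (F_tensor (corner N)) U)"
    then obtain c where c: "c \<in> fsums (corner N) U" "t = cls (corner N) U c" using C.F_tensorE by blast
    show "Res N U V (\<beta> U t) = \<beta> V (Res (F_tensor (corner N)) U V t)"
      using U c C.restrict_sum_closed[OF U(1-3) c(1)] evaluation_res[OF U(1-3) fsums_corner[OF c(1)]]
      by (simp only: C.F_tensor_res \<beta> corner_simps)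
  qed
  moreover have "locally_bijective T (F_tensor (corner N)) N \<beta>"
    unfolding locally_bijective_def
  proof (intro conjI allI impI; elim conjE)
    fix U x s t
    assume U: "openin T U" "x \<in> U" and st: "s \<in> carrier (Sec (F_tensor (corner N)) U)"
      "t \<in> carrier (Sec (F_tensor (corner N)) U)" "\<beta> U s = \<beta> U t"
    interpret abelian_group "Sec N U" using N_group U by blast
    obtain c where c: "c \<in> fsums (corner N) U" "s = cls (corner N) U c" using C.F_tensorE U st(1) by blast
    obtain d where d: "d \<in> fsums (corner N) U" "t = cls (corner N) U d" using C.F_tensorE U st(2) by blast
    have "evaluation N U c = evaluation N U d" using U c d st(3) by (simp only: \<beta>)
    then have "evaluation N U (c - d) = \<zero>\<^bsub>Sec N U\<^esub>"
      using evaluation_diff[OF U(1) fsums_corner[OF c(1)] fsums_corner[OF d(1)]] evaluation_closed[OF U(1) fsums_corner[OF d(1)]]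
      by (simp add: a_minus_def r_neg)
    from counit_inj[OF assms U C.sums_diff[OF c(1) d(1)] this] eventually_nhd_subset[OF U]
    show "\<forall>\<^sub>F W in nhd T x. Res (F_tensor (corner N)) U W s = Res (F_tensor (corner N)) U W t"
    proof eventually_elim
      case (elim W)
      then have W: "openin T W" "W \<subseteq> U" by auto
      have "restrict_sum (corner N) U W c - restrict_sum (corner N) U W d \<in> ker (corner N) W"
        using elim by (simp only: frag_extend_diff)
      then show ?case
        using U W c d C.restrict_sum_closed[OF U(1) W c(1)] C.restrict_sum_closed[OF U(1) W d(1)]
        by (simp only: C.F_tensor_res C.cls_eq_iff)
    qed
  next
    fix U x n assume U: "openin T U" "x \<in> U" and n: "n \<in> carrier (Sec N U)"
    from counit_surj[OF assms U n] eventually_nhd_subset[OF U]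
    show "\<forall>\<^sub>F W in nhd T x. Res N U W n \<in> \<beta> W ` carrier (Sec (F_tensor (corner N)) W)"
    proof eventually_elim
      case (elim W)
      then obtain c where "c \<in> fsums (corner N) W" "Res N U W n = evaluation N W c" by blast
      then show ?case using elim \<beta>[of W c] C.cls_carrier[of W c]
        by (intro image_eqI[of _ _ "cls (corner N) W c"]) simp_all
    qed
  qed
  ultimately show ?thesis
    unfolding F_functor_def by (rule P.sheafify_isomorphic[OF N.module_presheaf_axioms is_sheaf_N])
qed

end

context auslander_module
begin

text \<open>An isomorphism \<open>\<F> \<otimes> M \<rightarrow> N\<close> identifies \<open>M\<close>, via \<open>m \<mapsto> (0, 1) \<otimes> m\<close>, locally with the corner of \<open>N\<close>.\<close>

theorem counit_bijective_of_isomorphic: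
  fixes M :: "('a, 'r, 'm) mod_presheaf"
  assumes M: "sheaf_of_left_modules T \<O> M" and iso: "sheaf_isomorphic T \<A> (F_functor X M) N"
  shows "counit_bijective N"
proof -
  interpret M: structure_module X M by unfold_locales (rule M)
  interpret P: module_presheaf T \<A> "F_tensor M" by (rule M.F_tensor_module_presheaf)
  obtain \<beta> where \<beta>: "sheaf_hom T \<A> (F_tensor M) N \<beta>" "locally_bijective T (F_tensor M) N \<beta>"
    using P.sheafify_isomorphicD iso unfolding F_functor_def by blast
  define \<alpha> where "\<alpha> U m = \<beta> U (cls M U (frag_of (unit_section U, m)))" for U m
  have frag: "frag_of (f, m) \<in> fsums M U" if "f \<in> carrier (Sec \<F> U)" "m \<in> carrier (Sec M U)" for f m U
    using that by simp
  have unit: "frag_of (unit_section U, m) \<in> fsums M U" if "openin T U" "m \<in> carrier (Sec M U)" for m U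
    using that by (simp add: unit_section_carrier)
  have act: "a \<odot>\<^bsub>Sec N U\<^esub> \<beta> U (cls M U (frag_of (f, m))) = \<beta> U (cls M U (frag_of (a U f, m)))"
    if "openin T U" "a \<in> carrier (Sec \<A> U)" "f \<in> carrier (Sec \<F> U)" "m \<in> carrier (Sec M U)" for a f m U
    using that M.F_tensor_smult[OF that(1,2) frag[OF that(3,4)]] M.cls_carrier[OF that(1) frag[OF that(3,4)]]
    by (simp flip: sheaf_hom_smult[OF \<beta>(1)])
  have balanced: "cls M U (frag_of (r \<odot>\<^bsub>Sec \<F> U\<^esub> f, m)) = cls M U (frag_of (f, r \<odot>\<^bsub>Sec M U\<^esub> m))"
    if "openin T U" "r \<in> carrier (Sec \<O> U)" "f \<in> carrier (Sec \<F> U)" "m \<in> carrier (Sec M U)" for r f m U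
    using that tensor_pair.kernel_balanced[OF M.tensor_pair[OF that(1)], of r f m]
    by (subst M.cls_eq_iff) (simp_all add: \<F>.smult_closed M.M.smult_closed scalar_apply)
  \<comment> \<open>Every \<open>f\<close> is the image of (0, 1) under its own endomorphism, so
    \<A>-linearity expresses \<beta> on all pairs through \<alpha>.\<close>
  have \<alpha>_endo: "section_endo U f \<odot>\<^bsub>Sec N U\<^esub> \<alpha> U m = \<beta> U (cls M U (frag_of (f, m)))"
    if "openin T U" "f \<in> carrier (Sec \<F> U)" "m \<in> carrier (Sec M U)" for f m U
    using that act[OF that(1) section_endo_carrier[OF that(1,2)] unit_section_carrier[OF that(1)] that(3)]
    by (simp add: \<alpha>_def section_endo_self unit_section_carrier snd_unit_section F_smult_one)
  \<comment> \<open>e sends \<open>f\<close> to \<open>snd f\<close> times (0, 1), and the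
    coefficient moves across the tensor sign.\<close>
  have idem_\<beta>: "idem U \<odot>\<^bsub>Sec N U\<^esub> \<beta> U (cls M U (frag_of (f, m))) = \<alpha> U (snd f \<odot>\<^bsub>Sec M U\<^esub> m)"
    if "openin T U" "f \<in> carrier (Sec \<F> U)" "m \<in> carrier (Sec M U)" for f m U
    using that act[OF that(1) idem_carrier[OF that(1)] that(2,3)]
      balanced[OF that(1) snd_carrier[OF that(2)] unit_section_carrier[OF that(1)] that(3)]
    by (simp add: \<alpha>_def section_endo_self unit_section_carrier)
  have \<alpha>_hom: "sheaf_hom T \<O> M (corner N) \<alpha>"
    unfolding sheaf_hom_def
  proof (intro conjI allI impI ballI; (elim conjE)?)
    fix U assume U: "openin T U"
    show "\<alpha> U \<in> carrier (Sec M U) \<rightarrow> carrier (Sec (corner N) U)"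
    proof
      fix m assume m: "m \<in> carrier (Sec M U)"
      have "\<alpha> U m \<in> carrier (Sec N U)"
        unfolding \<alpha>_def by (rule sheaf_hom_closed[OF \<beta>(1) U M.cls_carrier[OF U unit[OF U m]]])
      then show "\<alpha> U m \<in> carrier (Sec (corner N) U)"
        using \<alpha>_endo[OF U unit_section_carrier[OF U] m] by (simp add: \<alpha>_def)
    qed
    show "\<alpha> U (m \<oplus>\<^bsub>Sec M U\<^esub> n) = \<alpha> U m \<oplus>\<^bsub>Sec (corner N) U\<^esub> \<alpha> U n"
      if mn: "m \<in> carrier (Sec M U)" "n \<in> carrier (Sec M U)" for m n
    proof -
      let ?u = "unit_section U"
      have "cls M U (frag_of (?u, m \<oplus>\<^bsub>Sec M U\<^esub> n)) = cls M U (frag_of (?u, m) + frag_of (?u, n))"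
        using tensor_pair.kernel_right_add[OF M.tensor_pair[OF U], of ?u m n] mn unit_section_carrier[OF U] U
        by (subst M.cls_eq_iff[OF U unit[OF U] M.sums_add[OF unit[OF U] unit[OF U]]])
          (simp_all add: M.M.add_closed algebra_simps)
      then show ?thesis
        using U mn unit[OF U mn(1)] unit[OF U mn(2)] M.cls_carrier[OF U unit[OF U mn(1)]] M.cls_carrier[OF U unit[OF U mn(2)]]
        by (simp only: \<alpha>_def corner_simps flip: sheaf_hom_add[OF \<beta>(1)] M.F_tensor_add)
    qed
    show "\<alpha> U (r \<odot>\<^bsub>Sec M U\<^esub> m) = r \<odot>\<^bsub>Sec (corner N) U\<^esub> \<alpha> U m"
      if rm: "r \<in> carrier (Sec \<O> U)" "m \<in> carrier (Sec M U)" for r m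
      using act[OF U scalar_carrier[OF U rm(1)] unit_section_carrier[OF U] rm(2)]
        balanced[OF U rm(1) unit_section_carrier[OF U] rm(2)] U rm
      by (simp add: \<alpha>_def scalar_apply unit_section_carrier)
  next
    fix U V m assume U: "openin T U" "openin T V" "V \<subseteq> U" "m \<in> carrier (Sec M U)"
    show "Res (corner N) U V (\<alpha> U m) = \<alpha> V (Res M U V m)"
      using U sheaf_hom_res[OF \<beta>(1) U(1-3) M.cls_carrier[OF U(1) unit[OF U(1,4)]]]
        M.F_tensor_res[OF U(1-3) unit[OF U(1,4)]]
      by (simp add: \<alpha>_def unit_section_res)
  qed
  \<comment> \<open>The given \<beta> is the counit after \<F> \<otimes> \<alpha>; as both sides are
    additive, \<open>\<alpha>_endo\<close> settles it on pairs.\<close>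
  have \<beta>_hom: "\<beta> U (cls M U c) = evaluation N U (pair_map (\<lambda>f. f) (\<alpha> U) c)"
    if U: "openin T U" and c: "c \<in> fsums M U" for U c
  proof -
    have "(\<lambda>c. \<beta> U (cls M U c)) c = (evaluation N U \<circ> pair_map (\<lambda>f. f) (\<alpha> U)) c"
    proof (rule free_Abelian_group_hom_eq[where S = "carrier (Sec \<F> U) \<times> carrier (Sec M U)" and H = "add_monoid (Sec N U)"])
      show "(\<lambda>c. \<beta> U (cls M U c)) \<in> hom (free_Abelian_group (carrier (Sec \<F> U) \<times> carrier (Sec M U))) (add_monoid (Sec N U))"
      proof (rule homI; simp)
        fix c d :: "('r \<times> 'r) \<times> 'm \<Rightarrow>\<^sub>0 int"
        assume cd: "Poly_Mapping.keys c \<subseteq> carrier (Sec \<F> U) \<times> carrier (Sec M U)"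
          "Poly_Mapping.keys d \<subseteq> carrier (Sec \<F> U) \<times> carrier (Sec M U)"
        then show "\<beta> U (cls M U (c + d)) = \<beta> U (cls M U c) \<oplus>\<^bsub>Sec N U\<^esub> \<beta> U (cls M U d)"
          using U M.cls_carrier[OF U, of c] M.cls_carrier[OF U, of d] M.F_tensor_add[OF U, of c d]
          by (simp flip: sheaf_hom_add[OF \<beta>(1)])
      next
        fix c :: "('r \<times> 'r) \<times> 'm \<Rightarrow>\<^sub>0 int"
        assume "Poly_Mapping.keys c \<subseteq> carrier (Sec \<F> U) \<times> carrier (Sec M U)"
        then show "\<beta> U (cls M U c) \<in> carrier (Sec N U)"
          using M.cls_carrier[OF U, of c] by (simp add: sheaf_hom_closed[OF \<beta>(1) U])
      qed
      show "evaluation N U \<circ> pair_map (\<lambda>f. f) (\<alpha> U) \<in>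
          hom (free_Abelian_group (carrier (Sec \<F> U) \<times> carrier (Sec M U))) (add_monoid (Sec N U))"
        by (rule hom_compose[OF pair_map_hom evaluation_hom]) (use U sheaf_hom_closed[OF \<alpha>_hom U] in auto)
      show "group (add_monoid (Sec N U))" using U N_group abelian_group.a_group by blast
      fix z assume "z \<in> carrier (Sec \<F> U) \<times> carrier (Sec M U)"
      then obtain f m where fm: "z = (f, m)" "f \<in> carrier (Sec \<F> U)" "m \<in> carrier (Sec M U)" by auto
      then show "\<beta> U (cls M U (frag_of z)) = (evaluation N U \<circ> pair_map (\<lambda>f. f) (\<alpha> U)) (frag_of z)"
        using U sheaf_hom_closed[OF \<alpha>_hom U fm(3)] by (simp add: evaluation_frag \<alpha>_endo)
    qed (use c in simp)
    then show ?thesis by simp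
  qed
  have \<alpha>_sum: "pair_map (\<lambda>f. f) (\<alpha> U) c \<in> fsums (corner N) U" if "openin T U" "c \<in> fsums M U" for U c
    using tensor_pair_map.pair_map_carrier[OF M.tensor_pair_map_hom[OF \<alpha>_hom C.structure_module_axioms that(1)], of c] that(2)
    by simp
  have idem_image: "idem U \<odot>\<^bsub>Sec N U\<^esub> \<beta> U (cls M U c) \<in> \<alpha> U ` carrier (Sec M U)"
    if U: "openin T U" and c: "c \<in> fsums M U" for U c
  proof -
    interpret NU: abelian_group "Sec N U" using N_group U by blast
    interpret MU: abelian_group "Sec M U" using M.M_group U by blast
    \<comment> \<open>In terms of \<open>evaluation\<close> the left side is visibly additive in
      \<open>d\<close>, as the induction on differences below requires.\<close>
    have eval_form: "idem U \<odot>\<^bsub>Sec N U\<^esub> \<beta> U (cls M U d) = evaluation N U (pair_map (idem U U) (\<lambda>y. y) (pair_map (\<lambda>f. f) (\<alpha> U) d))"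
      if "d \<in> fsums M U" for d
      using evaluation_act[OF U idem_carrier[OF U] fsums_corner[OF \<alpha>_sum[OF U that]]] \<beta>_hom[OF U that] by simp
    have closed: "Poly_Mapping.keys (pair_map (idem U U) (\<lambda>y. y) (pair_map (\<lambda>f. f) (\<alpha> U) d)) \<subseteq> carrier (Sec \<F> U) \<times> carrier (Sec N U)"
      if "d \<in> fsums M U" for d
      using fsums_corner[OF C.act_sum_closed[OF U idem_carrier[OF U] \<alpha>_sum[OF U that]]] .
    have "Poly_Mapping.keys c \<subseteq> carrier (Sec \<F> U) \<times> carrier (Sec M U)" using c by simp
    then show ?thesis
    proof (rule free_Abelian_group_induct)
      have "\<alpha> U \<zero>\<^bsub>Sec M U\<^esub> \<oplus>\<^bsub>Sec N U\<^esub> \<alpha> U \<zero>\<^bsub>Sec M U\<^esub> = \<alpha> U \<zero>\<^bsub>Sec M U\<^esub>"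
        using sheaf_hom_add[OF \<alpha>_hom U, of "\<zero>\<^bsub>Sec M U\<^esub>" "\<zero>\<^bsub>Sec M U\<^esub>"] by simp
      then have "\<alpha> U \<zero>\<^bsub>Sec M U\<^esub> = \<zero>\<^bsub>Sec N U\<^esub>"
        using sheaf_hom_closed[OF \<alpha>_hom U, of "\<zero>\<^bsub>Sec M U\<^esub>"] by simp
      then show "idem U \<odot>\<^bsub>Sec N U\<^esub> \<beta> U (cls M U 0) \<in> \<alpha> U ` carrier (Sec M U)"
        using eval_form[of 0] U by (auto simp: evaluation_zero intro!: image_eqI[of _ _ "\<zero>\<^bsub>Sec M U\<^esub>"])
    next
      fix c d assume cd: "Poly_Mapping.keys c \<subseteq> carrier (Sec \<F> U) \<times> carrier (Sec M U)"
        "Poly_Mapping.keys d \<subseteq> carrier (Sec \<F> U) \<times> carrier (Sec M U)"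
        "idem U \<odot>\<^bsub>Sec N U\<^esub> \<beta> U (cls M U c) \<in> \<alpha> U ` carrier (Sec M U)"
        "idem U \<odot>\<^bsub>Sec N U\<^esub> \<beta> U (cls M U d) \<in> \<alpha> U ` carrier (Sec M U)"
      then have cd': "c \<in> fsums M U" "d \<in> fsums M U" by auto
      obtain m n where mn: "m \<in> carrier (Sec M U)" "n \<in> carrier (Sec M U)"
        "idem U \<odot>\<^bsub>Sec N U\<^esub> \<beta> U (cls M U c) = \<alpha> U m" "idem U \<odot>\<^bsub>Sec N U\<^esub> \<beta> U (cls M U d) = \<alpha> U n"
        using cd(3,4) by blast
      have \<alpha>mn: "\<alpha> U m \<in> carrier (Sec N U)" "\<alpha> U n \<in> carrier (Sec N U)" "\<alpha> U (m \<ominus>\<^bsub>Sec M U\<^esub> n) \<in> carrier (Sec N U)"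
        using sheaf_hom_closed[OF \<alpha>_hom U] mn by simp_all
      have "\<alpha> U (m \<ominus>\<^bsub>Sec M U\<^esub> n) \<oplus>\<^bsub>Sec N U\<^esub> \<alpha> U n = \<alpha> U m"
        using sheaf_hom_add[OF \<alpha>_hom U, of "m \<ominus>\<^bsub>Sec M U\<^esub> n" n] mn
        by (simp add: a_minus_def MU.a_assoc MU.l_neg)
      then have "\<alpha> U m \<ominus>\<^bsub>Sec N U\<^esub> \<alpha> U n = \<alpha> U (m \<ominus>\<^bsub>Sec M U\<^esub> n)"
        using \<alpha>mn by (metis NU.a_assoc NU.a_inv_closed NU.r_neg NU.r_zero a_minus_def)
      then have "idem U \<odot>\<^bsub>Sec N U\<^esub> \<beta> U (cls M U (c - d)) = \<alpha> U (m \<ominus>\<^bsub>Sec M U\<^esub> n)"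
        using eval_form[OF cd'(1)] eval_form[OF cd'(2)] eval_form[OF M.sums_diff[OF cd']] mn
          evaluation_diff[OF U closed[OF cd'(1)] closed[OF cd'(2)]]
        by (simp only: frag_extend_diff)
      then show "idem U \<odot>\<^bsub>Sec N U\<^esub> \<beta> U (cls M U (c - d)) \<in> \<alpha> U ` carrier (Sec M U)"
        using mn by simp
    next
      fix z assume "z \<in> carrier (Sec \<F> U) \<times> carrier (Sec M U)"
      then obtain f m where fm: "z = (f, m)" "f \<in> carrier (Sec \<F> U)" "m \<in> carrier (Sec M U)" by auto
      show "idem U \<odot>\<^bsub>Sec N U\<^esub> \<beta> U (cls M U (frag_of z)) \<in> \<alpha> U ` carrier (Sec M U)"
        using imageI[OF M.M.smult_closed[OF U snd_carrier[OF fm(2)] fm(3)], of "\<alpha> U"] U fm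
        by (simp add: idem_\<beta>)
    qed
  qed
  have \<beta>_surj: "\<forall>\<^sub>F W in nhd T x. \<exists>c\<in>fsums M W. Res N U W n = \<beta> W (cls M W c)"
    if U: "openin T U" "x \<in> U" and n: "n \<in> carrier (Sec N U)" for U x n
    using locally_bijective_surj[OF \<beta>(2) U n] eventually_nhd_subset[OF U]
    by eventually_elim (auto elim!: M.F_tensorE)
  \<comment> \<open>A corner section is locally a value of \<beta>; since e fixes it,
    \<open>idem_image\<close> exhibits it as a value of \<alpha>.\<close>
  have \<alpha>_surj: "\<forall>\<^sub>F W in nhd T x. Res (corner N) U W y \<in> \<alpha> W ` carrier (Sec M W)"
    if U: "openin T U" "x \<in> U" and y: "y \<in> carrier (Sec (corner N) U)" for U x y
  proof -
    have "y \<in> carrier (Sec N U)" using y by simp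
    from \<beta>_surj[OF U this] eventually_nhd_subset[OF U] show ?thesis
    proof eventually_elim
      case (elim W)
      then obtain c where c: "c \<in> fsums M W" "Res N U W y = \<beta> W (cls M W c)" by blast
      have "idem W \<odot>\<^bsub>Sec N W\<^esub> Res N U W y = Res N U W y"
        using corner_res_closed[of U W y] U elim y by simp
      then show ?case using idem_image[of W c] c elim by simp
    qed
  qed
  show ?thesis
    unfolding counit_bijective_def
  proof (intro conjI allI impI; elim conjE)
    fix U x c assume U: "openin T U" "x \<in> U" and c: "c \<in> fsums (corner N) U" and eval0: "evaluation N U c = \<zero>\<^bsub>Sec N U\<^esub>"
    \<comment> \<open>Injectivity of the counit is pulled back to \<beta>: \<open>c\<close> lifts
      along \<alpha> to a formal sum \<open>d\<close> over \<open>M\<close> whose class is killed by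
      \<beta>. Hence \<open>d\<close> becomes a relation near \<open>x\<close>, and \<alpha> carries
      this relation back to \<open>c\<close>.\<close>
    obtain V d where V: "openin T V" "x \<in> V" "V \<subseteq> U" and d: "d \<in> fsums M V"
      "pair_map (\<lambda>f. f) (\<alpha> V) d = restrict_sum (corner N) U V c"
      by (rule eventually_nhdE[OF formal_sum_lift[OF U c \<alpha>_surj[OF U]] U]) (assumption, elim bexE, rule that)
    have zero: "0 \<in> fsums M V" by simp
    interpret NU: abelian_group "Sec N U" using N_group U by blast
    interpret NV: abelian_group "Sec N V" using N_group V by blast
    have "Res N U V \<zero>\<^bsub>Sec N U\<^esub> = \<zero>\<^bsub>Sec N V\<^esub>"
      using hom_one[OF res_hom[OF U(1) V(1,3)]] NU.a_group NV.a_group by simp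
    then have "\<beta> V (cls M V d) = \<zero>\<^bsub>Sec N V\<^esub>"
      using \<beta>_hom[OF V(1) d(1)] d(2) evaluation_res[OF U(1) V(1,3) fsums_corner[OF c]] eval0 by simp
    \<comment> \<open>Local injectivity of \<beta> compares two sections, so zero is presented as
      the value at the class of the empty sum.\<close>
    also have "\<dots> = \<beta> V (cls M V 0)"
      using \<beta>_hom[OF V(1) zero] evaluation_zero[OF V(1)] by simp
    finally have "\<forall>\<^sub>F W in nhd T x. Res (F_tensor M) V W (cls M V d) = Res (F_tensor M) V W (cls M V 0)"
      using locally_bijective_inj[OF \<beta>(2) V(1,2) M.cls_carrier[OF V(1) d(1)] M.cls_carrier[OF V(1) zero]] by blast
    then show "\<forall>\<^sub>F W in nhd T x. restrict_sum (corner N) U W c \<in> ker (corner N) W"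
      using eventually_nhd_subset[OF V(1,2)]
    proof eventually_elim
      case (elim W)
      then have W: "openin T W" "W \<subseteq> V" by auto
      have "restrict_sum M V W d \<in> ker M W"
        using elim(1) M.F_tensor_res[OF V(1) W d(1)] M.F_tensor_res[OF V(1) W zero]
          M.cls_eq_iff[OF W(1) M.restrict_sum_closed[OF V(1) W d(1)] M.restrict_sum_closed[OF V(1) W zero]] by simp
      then have "pair_map (\<lambda>f. f) (\<alpha> W) (restrict_sum M V W d) \<in> ker (corner N) W"
        by (rule tensor_pair_map.pair_map_kernel[OF M.tensor_pair_map_hom[OF \<alpha>_hom C.structure_module_axioms W(1)]])
      also have "pair_map (\<lambda>f. f) (\<alpha> W) (restrict_sum M V W d) =
          restrict_sum (corner N) V W (pair_map (\<lambda>f. f) (\<alpha> V) d)"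
        unfolding pair_map_compose
        by (rule pair_map_cong[of _ "carrier (Sec \<F> V)" "carrier (Sec M V)"])
          (use d(1) sheaf_hom_res[OF \<alpha>_hom V(1) W] in auto)
      also have "\<dots> = restrict_sum (corner N) U W c"
        unfolding d(2) by (rule C.restrict_sum_restrict_sum[OF U(1) V(1) W(1,2) V(3) c])
      finally show ?case .
    qed
  next
    fix U x n assume U: "openin T U" "x \<in> U" and n: "n \<in> carrier (Sec N U)"
    show "\<forall>\<^sub>F W in nhd T x. Res N U W n \<in> evaluation N W ` fsums (corner N) W"
      using \<beta>_surj[OF U n] eventually_nhd_subset[OF U]
    proof eventually_elim
      case (elim W)
      then obtain c where c: "c \<in> fsums M W" "Res N U W n = \<beta> W (cls M W c)" by blast
      have W: "openin T W" using elim by simp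
      show ?case unfolding c(2) \<beta>_hom[OF W c(1)] by (rule imageI[OF \<alpha>_sum[OF W c(1)]])
    qed
  qed
qed

end

subsection \<open>Extensions\<close>

context locally_ringed
begin

text \<open>\<open>locally_in_image\<close> grants one neighbourhood; since \<open>h\<close>
  commutes with restriction, the preimage restricts to all smaller ones.\<close>

lemma eventually_in_image:
  assumes h: "sheaf_hom T \<A> N1 N2 h" and N1: "auslander_module X N1" and N2: "auslander_module X N2"
    and U: "openin T U" "x \<in> U" and y: "y \<in> carrier (Sec N2 U)" and loc: "locally_in_image T N1 N2 h U y"
  shows "\<forall>\<^sub>F W in nhd T x. Res N2 U W y \<in> h W ` carrier (Sec N1 W)"
proof -
  interpret N1: auslander_module X N1 by fact
  interpret N2: auslander_module X N2 by fact
  obtain V z where V: "openin T V" "x \<in> V" "V \<subseteq> U" "z \<in> carrier (Sec N1 V)" "Res N2 U V y = h V z"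
    using loc U unfolding locally_in_image_def by blast
  show ?thesis
  proof (rule eventually_nhdI[OF V(1,2)])
    fix W assume W: "openin T W" "W \<subseteq> V"
    have "Res N2 U W y = h W (Res N1 V W z)"
      using U V W y sheaf_hom_res[OF h V(1) W V(4)] N2.N.res_res[OF U(1) V(1) W V(3) y] by simp
    then show "Res N2 U W y \<in> h W ` carrier (Sec N1 W)" using V W N1.N.res_closed by blast
  qed
qed

lemma sum_hom_closed:
  assumes "sheaf_hom T \<O> M1 M2 h" "structure_module X M1" "structure_module X M2" "openin T U" "c \<in> fsums M1 U"
  shows "pair_map (\<lambda>f. f) (h U) c \<in> fsums M2 U"
  using tensor_pair_map.pair_map_carrier[OF structure_module.tensor_pair_map_hom[OF assms(2,1,3,4)], of c] assms(5)
  by simp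

lemma sum_hom_res:
  assumes "sheaf_hom T \<O> M1 M2 h" "openin T U" "openin T V" "V \<subseteq> U" "c \<in> fsums M1 U"
  shows "pair_map (\<lambda>f. f) (h V) (restrict_sum M1 U V c) = restrict_sum M2 U V (pair_map (\<lambda>f. f) (h U) c)"
  unfolding pair_map_compose
  by (rule pair_map_cong[of _ "carrier (Sec \<F> U)" "carrier (Sec M1 U)"])
    (use assms(5) sheaf_hom_res[OF assms(1-4)] in auto)

end

locale auslander_extension =
  locally_ringed X + L: auslander_module X N' + M: auslander_module X N + R: auslander_module X N''
  for X :: "('a, 'r) ringed_space" and N' :: "('a, ('a, 'r) auslander_section, 'n1) mod_presheaf"
    and N :: "('a, ('a, 'r) auslander_section, 'n) mod_presheaf"
    and N'' :: "('a, ('a, 'r) auslander_section, 'n2) mod_presheaf" +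
  fixes i :: "'a set \<Rightarrow> 'n1 \<Rightarrow> 'n" and p :: "'a set \<Rightarrow> 'n \<Rightarrow> 'n2"
  assumes short_exact: "short_exact (Space X) (Auslander_sheaf X) N' N N'' i p"
begin

lemma i_hom: "sheaf_hom T \<A> N' N i" and p_hom: "sheaf_hom T \<A> N N'' p"
  using short_exact by (simp_all add: short_exact_def)

lemma i_inj: "\<lbrakk>openin T U; y \<in> carrier (Sec N' U); i U y = \<zero>\<^bsub>Sec N U\<^esub>\<rbrakk> \<Longrightarrow> y = \<zero>\<^bsub>Sec N' U\<^esub>"
  using short_exact by (simp add: short_exact_def)

lemma exact_middle:
  "\<lbrakk>openin T U; x \<in> U; y \<in> carrier (Sec N U); p U y = \<zero>\<^bsub>Sec N'' U\<^esub>\<rbrakk> \<Longrightarrow>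
    \<forall>\<^sub>F W in nhd T x. Res N U W y \<in> i W ` carrier (Sec N' W)"
  using short_exact
  by (intro eventually_in_image[OF i_hom L.auslander_module_axioms M.auslander_module_axioms])
    (simp_all add: short_exact_def)

lemma exact_right:
  "\<lbrakk>openin T U; x \<in> U; z \<in> carrier (Sec N'' U)\<rbrakk> \<Longrightarrow> \<forall>\<^sub>F W in nhd T x. Res N'' U W z \<in> p W ` carrier (Sec N W)"
  using short_exact
  by (intro eventually_in_image[OF p_hom M.auslander_module_axioms R.auslander_module_axioms])
    (simp_all add: short_exact_def)

text \<open>Exactness of taking corners: if a section fixed by e has a local preimage, then e times
  that preimage is a preimage in the corner.\<close>

sublocale corner: locally_exact_sequence X "corner N'" "corner N" "corner N''" i p
proof
  show "sheaf_hom T \<O> (corner N') (corner N) i" by (rule L.corner_hom[OF i_hom])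
  show "sheaf_hom T \<O> (corner N) (corner N'') p" by (rule M.corner_hom[OF p_hom])
  fix U x assume U: "openin T U" "x \<in> U"
  show "\<forall>\<^sub>F W in nhd T x. Res (corner N) U W y \<in> i W ` carrier (Sec (corner N') W)"
    if y: "y \<in> carrier (Sec (corner N) U)" and py: "p U y = \<zero>\<^bsub>Sec (corner N'') U\<^esub>" for y
  proof -
    have "y \<in> carrier (Sec N U)" "p U y = \<zero>\<^bsub>Sec N'' U\<^esub>" using y py by auto
    from exact_middle[OF U this] eventually_nhd_subset[OF U] show ?thesis
    proof eventually_elim
      case (elim W)
      then obtain z where z: "z \<in> carrier (Sec N' W)" "Res N U W y = i W z" by auto
      have "idem W \<odot>\<^bsub>Sec N W\<^esub> Res N U W y = Res N U W y"
        using M.corner_res_closed[of U W y] U elim y by simp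
      then have "Res N U W y = i W (idem W \<odot>\<^bsub>Sec N' W\<^esub> z)"
        using z elim by (simp add: sheaf_hom_smult[OF i_hom] L.idem_carrier)
      then show ?case using L.idem_closed[of W z] z elim by auto
    qed
  qed
  show "\<forall>\<^sub>F W in nhd T x. Res (corner N'') U W z \<in> p W ` carrier (Sec (corner N) W)"
    if z: "z \<in> carrier (Sec (corner N'') U)" for z
  proof -
    have "z \<in> carrier (Sec N'' U)" using z by auto
    from exact_right[OF U this] eventually_nhd_subset[OF U] show ?thesis
    proof eventually_elim
      case (elim W)
      then obtain y where y: "y \<in> carrier (Sec N W)" "Res N'' U W z = p W y" by auto
      have "idem W \<odot>\<^bsub>Sec N'' W\<^esub> Res N'' U W z = Res N'' U W z"
        using R.corner_res_closed[of U W z] U elim z by simp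
      then have "Res N'' U W z = p W (idem W \<odot>\<^bsub>Sec N W\<^esub> y)"
        using y elim by (simp add: sheaf_hom_smult[OF p_hom] M.idem_carrier)
      then show ?case using M.idem_closed[of W y] y elim by auto
    qed
  qed
qed

text \<open>The five lemma for the counits of the three terms, with the row of tensor products exact
  only in the middle and on the right. Each choice costs a shrinking, whence the nested
  neighbourhoods \<open>V\<close>, \<open>W\<close>, \<open>Z\<close>, \<open>Y\<close>.\<close>

theorem counit_bijective_extension:
  assumes L: "counit_bijective N'" and R: "counit_bijective N''"
  shows "counit_bijective N"
  unfolding counit_bijective_def
proof (intro conjI allI impI; elim conjE)
  fix U x n assume U: "openin T U" "x \<in> U" and n: "n \<in> carrier (Sec N U)"
  have pn: "p U n \<in> carrier (Sec N'' U)" using sheaf_hom_closed[OF p_hom U(1) n] .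
  \<comment> \<open>Surjectivity: the image of \<open>n\<close> in \<open>N''\<close> is a value of
    the counit at \<open>c''\<close>, which then lifts to a formal sum \<open>c\<close> over the
    corner of \<open>N\<close>.\<close>
  obtain V c'' where V: "openin T V" "x \<in> V" "V \<subseteq> U" and c'': "c'' \<in> fsums (corner N'') V"
    "Res N'' U V (p U n) = evaluation N'' V c''"
    by (rule eventually_nhdE[OF counit_surj[OF R U pn] U]) blast
  obtain W c where W: "openin T W" "x \<in> W" "W \<subseteq> V" and c: "c \<in> fsums (corner N) W"
    "pair_map (\<lambda>f. f) (p W) c = restrict_sum (corner N'') V W c''"
    by (rule eventually_nhdE[OF formal_sum_lift[OF V(1,2) c''(1) corner.surjective[OF V(1,2)]] V(1,2)]) (assumption, elim bexE, rule that)
  have WU: "W \<subseteq> U" using W V by blast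
  interpret NW: abelian_group "Sec N W" using M.N_group W by blast
  interpret NW'': abelian_group "Sec N'' W" using R.N_group W by blast
  define e where "e = evaluation N W c"
  \<comment> \<open>The value \<open>e\<close> at the lift has the same image in \<open>N''\<close>
    as \<open>n\<close>; the correction \<open>y\<close> is therefore killed by \<open>p\<close> and
    comes from \<open>N'\<close>, where the counit is surjective.\<close>
  define y where "y = Res N U W n \<ominus>\<^bsub>Sec N W\<^esub> e"
  have e: "e \<in> carrier (Sec N W)" unfolding e_def by (rule M.evaluation_closed[OF W(1) M.fsums_corner[OF c(1)]])
  have nW: "Res N U W n \<in> carrier (Sec N W)" using M.N.res_closed U(1) W(1) WU n by blast
  have y: "y \<in> carrier (Sec N W)" "y \<oplus>\<^bsub>Sec N W\<^esub> e = Res N U W n"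
    using e nW by (simp_all add: y_def a_minus_def NW.a_assoc NW.l_neg)
  have "p W e = evaluation N'' W (restrict_sum (corner N'') V W c'')"
    using M.evaluation_hom_natural[OF p_hom R.auslander_module_axioms W(1) M.fsums_corner[OF c(1)]] c(2)
    by (simp add: e_def)
  also have "\<dots> = Res N'' V W (evaluation N'' V c'')"
    using R.evaluation_res[OF V(1) W(1,3) R.fsums_corner[OF c''(1)]] by simp
  also have "\<dots> = p W (Res N U W n)"
    using c''(2) R.N.res_res[OF U(1) V(1) W(1,3) V(3) pn] sheaf_hom_res[OF p_hom U(1) W(1) WU n] by simp
  finally have pe: "p W (Res N U W n) = p W e" by simp
  have "p W y \<oplus>\<^bsub>Sec N'' W\<^esub> p W e = p W e"
    using sheaf_hom_add[OF p_hom W(1) y(1) e] y(2) pe by simp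
  then have "p W y = \<zero>\<^bsub>Sec N'' W\<^esub>"
    using sheaf_hom_closed[OF p_hom W(1)] y(1) e by simp
  then obtain Z y' where Z: "openin T Z" "x \<in> Z" "Z \<subseteq> W" and y': "y' \<in> carrier (Sec N' Z)" "Res N W Z y = i Z y'"
    by (rule eventually_nhdE[OF exact_middle[OF W(1,2) y(1)] W(1,2)]) auto
  from counit_surj[OF L Z(1,2) y'(1)] eventually_nhd_subset[OF Z(1,2)]
  show "\<forall>\<^sub>F W in nhd T x. Res N U W n \<in> evaluation N W ` fsums (corner N) W"
  proof eventually_elim
    case (elim Y)
    then obtain c' where c': "c' \<in> fsums (corner N') Y" "Res N' Z Y y' = evaluation N' Y c'" by blast
    have Y: "openin T Y" "Y \<subseteq> Z" "Y \<subseteq> W" using elim Z by auto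
    define d where "d = pair_map (\<lambda>f. f) (i Y) c'"
    define r where "r = restrict_sum (corner N) W Y c"
    have d: "d \<in> fsums (corner N) Y"
      unfolding d_def by (rule sum_hom_closed[OF corner.i_hom L.C.structure_module_axioms M.C.structure_module_axioms Y(1) c'(1)])
    have r: "r \<in> fsums (corner N) Y" unfolding r_def by (rule M.C.restrict_sum_closed[OF W(1) Y(1,3) c(1)])
    have "Res N W Y y = Res N Z Y (i Z y')" using M.N.res_res[OF W(1) Z(1) Y(1,2) Z(3) y(1)] y'(2) by simp
    also have "\<dots> = i Y (evaluation N' Y c')" using sheaf_hom_res[OF i_hom Z(1) Y(1,2) y'(1)] c'(2) by simp
    also have "\<dots> = evaluation N Y d"
      unfolding d_def by (rule L.evaluation_hom_natural[OF i_hom M.auslander_module_axioms Y(1) L.fsums_corner[OF c'(1)]])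
    finally have yd: "Res N W Y y = evaluation N Y d" .
    have er: "Res N W Y e = evaluation N Y r"
      using M.evaluation_res[OF W(1) Y(1,3) M.fsums_corner[OF c(1)]] by (simp add: e_def r_def)
    have "Res N U Y n = Res N W Y (y \<oplus>\<^bsub>Sec N W\<^esub> e)"
      using M.N.res_res[OF U(1) W(1) Y(1,3) WU n] y(2) by simp
    also have "\<dots> = evaluation N Y (d + r)"
      using M.N.res_add[OF W(1) Y(1,3) y(1) e] yd er M.evaluation_add[OF Y(1) M.fsums_corner[OF d] M.fsums_corner[OF r]] by simp
    finally show ?case using M.C.sums_add[OF d r] by blast
  qed
next
  fix U x c assume U: "openin T U" "x \<in> U" and c: "c \<in> fsums (corner N) U" and c0: "evaluation N U c = \<zero>\<^bsub>Sec N U\<^esub>"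
  have res0: "Res N V W \<zero>\<^bsub>Sec N V\<^esub> = \<zero>\<^bsub>Sec N W\<^esub>" if "openin T V" "openin T W" "W \<subseteq> V" for V W
    using hom_one[OF M.res_hom[OF that]] abelian_group.a_group[OF M.N_group] that by simp
  define pc where "pc = pair_map (\<lambda>f. f) (p U) c"
  have pc: "pc \<in> fsums (corner N'') U"
    unfolding pc_def by (rule sum_hom_closed[OF corner.p_hom M.C.structure_module_axioms R.C.structure_module_axioms U(1) c])
  have "p U \<in> hom (add_monoid (Sec N U)) (add_monoid (Sec N'' U))"
    by (rule homI) (use U in \<open>simp_all add: sheaf_hom_closed[OF p_hom] sheaf_hom_add[OF p_hom]\<close>)
  from hom_one[OF this] have "p U \<zero>\<^bsub>Sec N U\<^esub> = \<zero>\<^bsub>Sec N'' U\<^esub>"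
    using abelian_group.a_group[OF M.N_group[OF U(1)]] abelian_group.a_group[OF R.N_group[OF U(1)]] by simp
  then have "evaluation N'' U pc = \<zero>\<^bsub>Sec N'' U\<^esub>"
    using M.evaluation_hom_natural[OF p_hom R.auslander_module_axioms U(1) M.fsums_corner[OF c]] c0
    by (simp add: pc_def)
  \<comment> \<open>By injectivity of the counit of \<open>N''\<close> the image of \<open>c\<close>
    is a tensor relation near \<open>x\<close>; the next step lifts it to a relation
    \<open>k\<close> over the corner of \<open>N\<close>.\<close>
  then obtain V where V: "openin T V" "x \<in> V" "V \<subseteq> U" "restrict_sum (corner N'') U V pc \<in> ker (corner N'') V"
    by (rule eventually_nhdE[OF counit_inj[OF R U pc] U])
  obtain W k where W: "openin T W" "x \<in> W" "W \<subseteq> V" and k: "k \<in> ker (corner N) W"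
    "pair_map (\<lambda>f. f) (p W) k = restrict_sum (corner N'') V W (restrict_sum (corner N'') U V pc)"
    by (rule eventually_nhdE[OF corner.kernel_lift[OF V(1,2,4)] V(1,2)]) (elim bexE, rule that)
  have WU: "W \<subseteq> U" using W V by blast
  have k_sum: "k \<in> fsums (corner N) W" by (rule M.C.ker_sums[OF W(1) k(1)])
  \<comment> \<open>Subtracting the relation \<open>k\<close> keeps the class of \<open>c\<close>
    but makes the image under \<open>p\<close> vanish as a formal sum, which is what
    \<open>formal_sum_exact\<close> asks for.\<close>
  define d where "d = restrict_sum (corner N) U W c - k"
  have cW: "restrict_sum (corner N) U W c \<in> fsums (corner N) W"
    by (rule M.C.restrict_sum_closed[OF U(1) W(1) WU c])
  have d: "d \<in> fsums (corner N) W" unfolding d_def by (rule M.C.sums_diff[OF cW k_sum])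
  have "pair_map (\<lambda>f. f) (p W) d = 0"
    using sum_hom_res[OF corner.p_hom U(1) W(1) WU c] k(2) R.C.restrict_sum_restrict_sum[OF U(1) V(1) W(1,3) V(3) pc]
    by (simp add: d_def frag_extend_diff pc_def)
  then obtain Z c' where Z: "openin T Z" "x \<in> Z" "Z \<subseteq> W" and c': "c' \<in> fsums (corner N') Z"
    "restrict_sum (corner N) W Z d - pair_map (\<lambda>f. f) (i Z) c' \<in> ker (corner N) Z"
    by (rule eventually_nhdE[OF corner.formal_sum_exact[OF W(1,2) d] W(1,2)]) (elim bexE, rule that)
  define j where "j = pair_map (\<lambda>f. f) (i Z) c'"
  \<comment> \<open>Over \<open>Z\<close> the sum \<open>d\<close> splits into a relation
    \<open>l\<close> and the image \<open>j\<close> of a formal sum \<open>c'\<close> over the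
    corner of \<open>N'\<close>.\<close>
  define l where "l = restrict_sum (corner N) W Z d - j"
  have j: "j \<in> fsums (corner N) Z"
    unfolding j_def by (rule sum_hom_closed[OF corner.i_hom L.C.structure_module_axioms M.C.structure_module_axioms Z(1) c'(1)])
  have l: "l \<in> ker (corner N) Z" using c'(2) by (simp add: l_def j_def)
  interpret NW: abelian_group "Sec N W" using M.N_group W by blast
  interpret NZ: abelian_group "Sec N Z" using M.N_group Z by blast
  have "evaluation N W (restrict_sum (corner N) U W c) = \<zero>\<^bsub>Sec N W\<^esub>"
    using M.evaluation_res[OF U(1) W(1) WU M.fsums_corner[OF c]] c0 res0[OF U(1) W(1) WU] by simp
  then have "evaluation N W d = \<zero>\<^bsub>Sec N W\<^esub>"
    using M.evaluation_diff[OF W(1) M.fsums_corner[OF cW] M.fsums_corner[OF k_sum]] M.evaluation_ker[OF W(1) k(1)]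
    by (simp add: d_def a_minus_def)
  then have "evaluation N Z (restrict_sum (corner N) W Z d) = \<zero>\<^bsub>Sec N Z\<^esub>"
    using M.evaluation_res[OF W(1) Z(1,3) M.fsums_corner[OF d]] res0[OF W(1) Z(1,3)] by simp
  moreover have "restrict_sum (corner N) W Z d = l + j" by (simp add: l_def)
  ultimately have "evaluation N Z j = \<zero>\<^bsub>Sec N Z\<^esub>"
    using M.evaluation_add[OF Z(1) M.fsums_corner[OF M.C.ker_sums[OF Z(1) l]] M.fsums_corner[OF j]]
      M.evaluation_ker[OF Z(1) l] M.evaluation_closed[OF Z(1) M.fsums_corner[OF j]] by simp
  \<comment> \<open>Evaluation kills both \<open>d\<close> and the relation \<open>l\<close>, hence
    \<open>j\<close>. Injectivity of \<open>i\<close> on sections transfers this to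
    \<open>c'\<close>, and the counit of \<open>N'\<close> makes \<open>c'\<close> a relation after
    shrinking.\<close>
  then have "i Z (evaluation N' Z c') = \<zero>\<^bsub>Sec N Z\<^esub>"
    using L.evaluation_hom_natural[OF i_hom M.auslander_module_axioms Z(1) L.fsums_corner[OF c'(1)]] by (simp add: j_def)
  then have "evaluation N' Z c' = \<zero>\<^bsub>Sec N' Z\<^esub>"
    using i_inj[OF Z(1) L.evaluation_closed[OF Z(1) L.fsums_corner[OF c'(1)]]] by simp
  from counit_inj[OF L Z(1,2) c'(1) this] eventually_nhd_subset[OF Z(1,2)]
  show "\<forall>\<^sub>F W in nhd T x. restrict_sum (corner N) U W c \<in> ker (corner N) W"
  proof eventually_elim
    case (elim Y)
    have Y: "openin T Y" "Y \<subseteq> Z" "Y \<subseteq> W" using elim Z by auto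
    have "pair_map (\<lambda>f. f) (i Y) (restrict_sum (corner N') Z Y c') \<in> ker (corner N) Y"
      by (rule tensor_pair_map.pair_map_kernel[OF L.C.tensor_pair_map_hom[OF corner.i_hom M.C.structure_module_axioms Y(1)]])
        (use elim in blast)
    then have "restrict_sum (corner N) Z Y j \<in> ker (corner N) Y"
      using sum_hom_res[OF corner.i_hom Z(1) Y(1,2) c'(1)] by (simp add: j_def)
    \<comment> \<open>Over \<open>Y\<close> the formal sum \<open>c\<close> is the total of three
      relations: \<open>l\<close>, the image \<open>j\<close> of \<open>c'\<close>, and
      \<open>k\<close>.\<close>
    then have "restrict_sum (corner N) Z Y l + restrict_sum (corner N) Z Y j + restrict_sum (corner N) W Y k \<in> ker (corner N) Y"
      by (intro tensor_pair.kernel_add[OF M.C.tensor_pair[OF Y(1)]] M.C.restrict_sum_ker[OF Z(1) Y(1,2) l]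
          M.C.restrict_sum_ker[OF W(1) Y(1,3) k(1)])
    also have "restrict_sum (corner N) Z Y l + restrict_sum (corner N) Z Y j = restrict_sum (corner N) Z Y (restrict_sum (corner N) W Z d)"
      by (simp add: l_def frag_extend_diff)
    also have "\<dots> = restrict_sum (corner N) W Y d"
      by (rule M.C.restrict_sum_restrict_sum[OF W(1) Z(1) Y(1,2) Z(3) d])
    also have "\<dots> + restrict_sum (corner N) W Y k = restrict_sum (corner N) W Y (restrict_sum (corner N) U W c)"
      by (simp add: d_def frag_extend_diff)
    also have "\<dots> = restrict_sum (corner N) U Y c"
      by (rule M.C.restrict_sum_restrict_sum[OF U(1) W(1) Y(1,3) WU c])
    finally show ?case .
  qed
qed

end

text \<open>The preimage of \<open>N\<close> is \<open>corner N\<close>, whose sections have type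
  \<open>'n\<close>; the preimages of the outer terms may live on any types \<open>'m1\<close> and
  \<open>'m2\<close>.\<close>

theorem proposition4p2:
  fixes K :: "'k ring"
    and X :: "('a, 'r) ringed_space"
    and \<sigma> :: "'k \<Rightarrow> 'r"
    and N' :: "('a, ('a, 'r) auslander_section, 'n1) mod_presheaf"
    and N :: "('a, ('a, 'r) auslander_section, 'n) mod_presheaf"
    and N'' :: "('a, ('a, 'r) auslander_section, 'n2) mod_presheaf"
    and i :: "'a set \<Rightarrow> 'n1 \<Rightarrow> 'n"
    and p :: "'a set \<Rightarrow> 'n \<Rightarrow> 'n2"
  assumes "algebraically_closed K"
    and "reduced_curve K X \<sigma>"
    and "\<forall>x\<in>singular_points X. node K X \<sigma> x"
    and "coherent_Auslander X N"
    and "short_exact (Space X) (Auslander_sheaf X) N' N N'' i p"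
    and "essential_image TYPE('m1) X N'"
    and "essential_image TYPE('m2) X N''"
  shows "essential_image TYPE('n) X N"
proof -
  interpret locally_ringed X
    using assms(2) by unfold_locales (simp add: reduced_curve_def scheme_over_def scheme_def)
  have module: "auslander_module X Q" if "coherent_Auslander X Q"
    for Q :: "('a, ('a, 'r) auslander_section, 'q) mod_presheaf"
    by unfold_locales (use that in \<open>simp_all add: coherent_Auslander_def coherent_def\<close>)
  \<comment> \<open>Polymorphic in the types of \<open>Q\<close> and of its preimage, so that it
    applies to both \<open>N'\<close> and \<open>N''\<close>.\<close>
  have bijective: "counit_bijective Q" if image: "essential_image TYPE('s) X Q"
    for Q :: "('a, ('a, 'r) auslander_section, 'q) mod_presheaf"
  proof -
    have "coherent_Auslander X Q" using image by (simp add: essential_image_def)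
    then interpret Q: auslander_module X Q by (rule module)
    obtain M :: "('a, 'r, 's) mod_presheaf" where
      "coherent X M" "sheaf_isomorphic T \<A> (F_functor X M) Q"
      using image unfolding essential_image_def by (elim conjE exE)
    then show ?thesis by (intro Q.counit_bijective_of_isomorphic) (simp_all add: coherent_def)
  qed
  have coh: "coherent_Auslander X N'" "coherent_Auslander X N''"
    using assms(6,7) by (simp_all add: essential_image_def)
  interpret auslander_extension X N' N N'' i p
    by (intro auslander_extension.intro locally_ringed_axioms module coh assms(4)
        auslander_extension_axioms.intro assms(5))
  have "counit_bijective N"
    by (rule counit_bijective_extension[OF bijective[OF assms(6)] bijective[OF assms(7)]])
  then have "sheaf_isomorphic T \<A> (F_functor X (corner N)) N"
    by (rule M.sheaf_isomorphic_of_counit_bijective)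
  moreover have "coherent X (corner N)"
    using assms(4) by (intro M.coherent_corner) (simp add: coherent_Auslander_def)
  ultimately show ?thesis using assms(4) unfolding essential_image_def by (intro conjI exI)
qed

end
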